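(* (1) If $\psi$ is an arithmetical formula (a formula of Peano arithmetic $PA$), then $BT_0^{cl}\vdash\psi^*\equiv\psi$. (2) For every $s\geqslant0$ and every formula $\psi$ of $SA_s$: if $SA_s\vdash\psi$, then $BT_s^{cl}\vdash(\overline{\overline{\psi}})^*$, where $\overline{\overline{\psi}}$ is the universal closure of $\psi$.
   Context: $BT$ is the many-typed applicative theory with intuitionistic logic defined as follows. Types $\omega$ and $k\geqslant0$ ($\omega$ smallest). Variables: numerical $m,n,\ldots$ (type $\omega$), $X^k,Y^k,Z^k,\ldots$ of type $k$; type-$0$ variables also written $x,y,z,f,g,u,v$. Constants: $0$ (numerical), type-0 constants $\underline{k},\underline{s},\underline{d},\underline{p},\underline{p}_1,\underline{p}_2,\underline{c}_n$ $(n\geqslant0)$. No function symbols. Predicates: $Ap(f,x,y)$, $x=_{0\omega}m$, $x=_{0k}Y^k$, $X^k\in_kY^{k+1}$. Formulas built from atomic ones and $\bot$ by $\wedge,\vee,\supset,\forall,\exists$. A formula is $n$-elementary if it contains only types $\leqslant n$, no quantifier over type-$n$ variables and no $=_{0n}$. External terms: constants, variables, and applications $t\tau$ (left-associated). $t\simeq x$ is $x=_{0s}t$ for $t$ a constant/variable of type $s$, and $\exists y,z(t_1\simeq y\wedge t_2\simeq z\wedge Ap(y,z,x))$ for $t=t_1t_2$; $t\downarrow:=\exists x(t\simeq x)$, $t\simeq\tau:=\exists x(t\simeq x\wedge\tau\simeq x)$, $t\cong\tau:=\forall x(t\simeq x\equiv\tau\simeq x)$, $\varphi(t):=\exists x(t\simeq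 x\wedge\varphi(x))$; $\tau(t_1,\ldots,t_n)$ means $\tau\langle t_1,\ldots,t_n\rangle$ with $\langle x_1\rangle=x_1$, $\langle x_1,\ldots,x_{n+1}\rangle=\underline{p}\langle x_1,\ldots,x_n\rangle x_{n+1}$. Axioms: (1) intuitionistic logic; (2) equality: $x=_{00}x$; $u=_{0k}X^k\wedge v=_{0k}X\wedge u=_{0n}Y^n\supset v=_{0n}Y$; $u=_{0\omega}m\wedge v=_{0\omega}m\supset u=_{00}v$; $u=_{0\omega}m\wedge u=_{00}v\supset v=_{0\omega}m$; $Ap(f,x,y)\wedge f=_{00}g\wedge x=_{00}u\wedge y=_{00}v\supset Ap(g,u,v)$; $X^k\in_kY^{k+1}\wedge X^k=_kU^k\wedge Y^{k+1}=_{k+1}Z^{k+1}\supset U\in_kZ$; (3) combinatorial: $Ap(f,x,y)\wedge Ap(f,x,z)\supset y=z$; $\underline{k}xy\simeq x$; $\underline{s}xy\downarrow$; $\underline{s}xyz\cong xz(yz)$; $\underline{p}xy\downarrow$; $\neg(\underline{p}xy\simeq0)$; $\underline{p}_ix\downarrow$; $\underline{p}_i(\underline{p}x_1x_2)\simeq x_i$; $\exists m(\underline{p}n0\simeq m)$; $\exists Z^k(\underline{p}xY^k\simeq Z)$; $n=m\supset\underline{d}xynm\simeq x$; $n\neq m\supset\underline{d}xynm\simeq y$; $\exists x(x=_{0\omega}n)$; $\exists x(x=_{0k}Y^k)$; (4) induction rule: from $\varphi[n/0]$ and $\varphi\supset\exists m(\underline{p}n0\simeq m\wedge\varphi[n/m])$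 infer $\varphi$; (5) comprehension: $\exists U^{k+1}[\underline{c}_n(\widetilde X)\simeq U\wedge\forall Z^k(Z\in_kU\equiv\varphi)]$ for $\widetilde X$ a list of variables of types $\leqslant k+1$, $\varphi$ $(k+1)$-elementary with parameters among $Z^k,\widetilde X$, and $n$ the Gödel number of $Z^k.\widetilde X.\varphi$. $BT_s$ is the fragment with types $\leqslant s$ only; $BT^{cl}$, $BT^{cl}_s$ are $BT$, $BT_s$ with classical logic. Arithmetic (successor $\underline{p}n0$, primitive recursive functions via combinators) is embedded in $BT_0$, so arithmetical terms and formulas are regarded as terms/formulas of $BT_0$. $SA$ is the classical many-sorted second-order arithmetic with numerical variables, set variables $x_i^{(k)}$ of sort $k\geqslant1$, constants $0,1$, symbols $+,\cdot,=,\in_k$, and axioms: Peano axioms, induction for all formulas, comprehension $\exists z^{(k)}\forall n(n\in z\equiv\varphi(n))$ for $k$-simple $\varphi$ (no set quantifiers, no sorts $>k$) not containing $z$, and choice $\forall n\exists!x^{(k)}\varphi(n,x)\supset\exists y^{(k+1)}\forall n\exists x^{(k)}[\varphi(n,x)\wedge\forall m(m\in x\equiv(n,m)\in y)]$ for $k$-simple $\varphi$ ($(n,m)$ a standard pairing). $SA_s$ uses only sorts $\leqslant s$; $SA_0=PA$. Translation $*$: In $BT$, $\{n\}^0:=n$ and $\{n\}^{k+1}:=\{\{n\}^k\}$, where $\{\cdot\}$ is the singleton-forming external term, so that $\{n\}^k$ denotes an object of type $k$. For $k\geqslant1$, $M_k(X^k):=(\forall Z^{k-1}\in X)\exists n(\{n\}^{k-1}\simeq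 Z)$. Then: $(t=\tau)^*:=t=\tau$; $(t\in_kx_i^{(k)})^*:=\{t\}^{k-1}\in_{k-1}X_i^k$; $\bot^*:=\bot$; $(\psi\diamond\chi)^*:=\psi^*\diamond\chi^*$ for $\diamond\in\{\wedge,\vee,\supset\}$; $(Qn\psi)^*:=Qn\psi^*$; $(\forall x_i^{(k)}\psi)^*:=\forall X_i^k[M_k(X_i)\supset\psi^*]$; $(\exists x_i^{(k)}\psi)^*:=\exists X_i^k[M_k(X_i)\wedge\psi^*]$. *)

theory Defs
  imports "HOL-Library.Nat_Bijection"
begin

section \<open>Many-sorted formulas\<close>

text \<open>
  Both theories are formalised with one index space per type in de Bruijn style: a quantifier
  of type \<open>T\<close> binds index 0 of the type-\<open>T\<close> variables in its scope and shifts the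
  other type-\<open>T\<close> variables by one; variables of other types are unaffected. A free variable
  is a type together with an index. Formulas are thereby identified up to renaming of bound
  variables.
\<close>

datatype ty = Omega | Ty nat

primrec ty_le :: "ty \<Rightarrow> nat \<Rightarrow> bool" where
  "ty_le Omega n \<longleftrightarrow> True"
| "ty_le (Ty k) n \<longleftrightarrow> k \<le> n"

datatype 'a fm =
    Atom 'a
  | Bot
  | And "'a fm" "'a fm" (infixr "\<^bold>\<and>" 35)
  | Or "'a fm" "'a fm" (infixr "\<^bold>\<or>" 30)
  | Imp "'a fm" "'a fm" (infixr "\<^bold>\<longrightarrow>" 25)
  | All ty "'a fm"
  | Ex ty "'a fm"

definition Neg :: "'a fm \<Rightarrow> 'a fm" where
  "Neg \<phi> = (\<phi> \<^bold>\<longrightarrow> Bot)"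

definition Iff :: "'a fm \<Rightarrow> 'a fm \<Rightarrow> 'a fm" (infix "\<^bold>\<longleftrightarrow>" 25) where
  "(\<phi> \<^bold>\<longleftrightarrow> \<psi>) = ((\<phi> \<^bold>\<longrightarrow> \<psi>) \<^bold>\<and> (\<psi> \<^bold>\<longrightarrow> \<phi>))"

inductive ipl_axiom :: "'a fm \<Rightarrow> bool" where
  "ipl_axiom (\<phi> \<^bold>\<longrightarrow> \<psi> \<^bold>\<longrightarrow> \<phi>)"
| "ipl_axiom ((\<phi> \<^bold>\<longrightarrow> \<psi> \<^bold>\<longrightarrow> \<chi>) \<^bold>\<longrightarrow> (\<phi> \<^bold>\<longrightarrow> \<psi>) \<^bold>\<longrightarrow> \<phi> \<^bold>\<longrightarrow> \<chi>)"
| "ipl_axiom (\<phi> \<^bold>\<longrightarrow> \<psi> \<^bold>\<longrightarrow> (\<phi> \<^bold>\<and> \<psi>))"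
| "ipl_axiom ((\<phi> \<^bold>\<and> \<psi>) \<^bold>\<longrightarrow> \<phi>)"
| "ipl_axiom ((\<phi> \<^bold>\<and> \<psi>) \<^bold>\<longrightarrow> \<psi>)"
| "ipl_axiom (\<phi> \<^bold>\<longrightarrow> (\<phi> \<^bold>\<or> \<psi>))"
| "ipl_axiom (\<psi> \<^bold>\<longrightarrow> (\<phi> \<^bold>\<or> \<psi>))"
| "ipl_axiom ((\<phi> \<^bold>\<longrightarrow> \<chi>) \<^bold>\<longrightarrow> (\<psi> \<^bold>\<longrightarrow> \<chi>) \<^bold>\<longrightarrow> (\<phi> \<^bold>\<or> \<psi>) \<^bold>\<longrightarrow> \<chi>)"
| "ipl_axiom (Bot \<^bold>\<longrightarrow> \<phi>)"


section \<open>The language of BT\<close>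

datatype tm =
    Var ty nat
  | Zero
  | CK | CS | CD | CP | CP1 | CP2
  | CC nat

abbreviation v0 :: "nat \<Rightarrow> tm" where "v0 \<equiv> Var (Ty 0)"
abbreviation vN :: "nat \<Rightarrow> tm" where "vN \<equiv> Var Omega"
abbreviation vT :: "nat \<Rightarrow> nat \<Rightarrow> tm" where "vT k \<equiv> Var (Ty k)"

fun type_of :: "tm \<Rightarrow> ty" where
  "type_of (Var T i) = T"
| "type_of Zero = Omega"
| "type_of _ = Ty 0"

text \<open>\<open>EqA T x a\<close> is the equality of the type-0 term \<open>x\<close> with the term \<open>a\<close> of type \<open>T\<close>;
  \<open>InA k X Y\<close> is membership of \<open>X\<close> of type \<open>k\<close> in \<open>Y\<close> of type \<open>k + 1\<close>.\<close>

datatype atom =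
    ApA tm tm tm
  | EqA ty tm tm
  | InA nat tm tm

type_synonym bfm = "atom fm"

abbreviation Ap :: "tm \<Rightarrow> tm \<Rightarrow> tm \<Rightarrow> bfm" where "Ap f x y \<equiv> Atom (ApA f x y)"
abbreviation Eq :: "ty \<Rightarrow> tm \<Rightarrow> tm \<Rightarrow> bfm" where "Eq T x a \<equiv> Atom (EqA T x a)"
abbreviation In :: "nat \<Rightarrow> tm \<Rightarrow> tm \<Rightarrow> bfm" where "In k X Y \<equiv> Atom (InA k X Y)"

text \<open>Terms and atoms are raw syntax; \<open>wff n\<close> imposes typing as well as the bound \<open>n\<close> on all
  types that occur.\<close>

primrec wf_atom :: "nat \<Rightarrow> atom \<Rightarrow> bool" where
  "wf_atom n (ApA f x y) \<longleftrightarrow> type_of f = Ty 0 \<and> type_of x = Ty 0 \<and> type_of y = Ty 0"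
| "wf_atom n (EqA T x a) \<longleftrightarrow> type_of x = Ty 0 \<and> type_of a = T \<and> ty_le T n"
| "wf_atom n (InA k X Y) \<longleftrightarrow> type_of X = Ty k \<and> type_of Y = Ty (Suc k) \<and> Suc k \<le> n"

primrec wff :: "nat \<Rightarrow> bfm \<Rightarrow> bool" where
  "wff n (Atom a) \<longleftrightarrow> wf_atom n a"
| "wff n Bot \<longleftrightarrow> True"
| "wff n (\<phi> \<^bold>\<and> \<psi>) \<longleftrightarrow> wff n \<phi> \<and> wff n \<psi>"
| "wff n (\<phi> \<^bold>\<or> \<psi>) \<longleftrightarrow> wff n \<phi> \<and> wff n \<psi>"
| "wff n (\<phi> \<^bold>\<longrightarrow> \<psi>) \<longleftrightarrow> wff n \<phi> \<and> wff n \<psi>"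
| "wff n (All T \<phi>) \<longleftrightarrow> ty_le T n \<and> wff n \<phi>"
| "wff n (Ex T \<phi>) \<longleftrightarrow> ty_le T n \<and> wff n \<phi>"

primrec no_top_type :: "nat \<Rightarrow> bfm \<Rightarrow> bool" where
  "no_top_type n (Atom a) \<longleftrightarrow> (\<forall>x b. a \<noteq> EqA (Ty n) x b)"
| "no_top_type n Bot \<longleftrightarrow> True"
| "no_top_type n (\<phi> \<^bold>\<and> \<psi>) \<longleftrightarrow> no_top_type n \<phi> \<and> no_top_type n \<psi>"
| "no_top_type n (\<phi> \<^bold>\<or> \<psi>) \<longleftrightarrow> no_top_type n \<phi> \<and> no_top_type n \<psi>"
| "no_top_type n (\<phi> \<^bold>\<longrightarrow> \<psi>) \<longleftrightarrow> no_top_type n \<phi> \<and> no_top_type n \<psi>"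
| "no_top_type n (All T \<phi>) \<longleftrightarrow> T \<noteq> Ty n \<and> no_top_type n \<phi>"
| "no_top_type n (Ex T \<phi>) \<longleftrightarrow> T \<noteq> Ty n \<and> no_top_type n \<phi>"

definition elementary :: "nat \<Rightarrow> bfm \<Rightarrow> bool" where
  "elementary n \<phi> \<longleftrightarrow> wff n \<phi> \<and> no_top_type n \<phi>"

subsection \<open>Substitution and free variables\<close>

primrec tsub :: "(ty \<Rightarrow> nat \<Rightarrow> tm) \<Rightarrow> tm \<Rightarrow> tm" where
  "tsub \<sigma> (Var T i) = \<sigma> T i"
| "tsub \<sigma> Zero = Zero"
| "tsub \<sigma> CK = CK"
| "tsub \<sigma> CS = CS"
| "tsub \<sigma> CD = CD"
| "tsub \<sigma> CP = CP"
| "tsub \<sigma> CP1 = CP1"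
| "tsub \<sigma> CP2 = CP2"
| "tsub \<sigma> (CC n) = CC n"

primrec asub :: "(ty \<Rightarrow> nat \<Rightarrow> tm) \<Rightarrow> atom \<Rightarrow> atom" where
  "asub \<sigma> (ApA f x y) = ApA (tsub \<sigma> f) (tsub \<sigma> x) (tsub \<sigma> y)"
| "asub \<sigma> (EqA T x a) = EqA T (tsub \<sigma> x) (tsub \<sigma> a)"
| "asub \<sigma> (InA k X Y) = InA k (tsub \<sigma> X) (tsub \<sigma> Y)"

text \<open>The shift that makes room for a new innermost binder of type \<open>T\<close>.\<close>

definition shift :: "ty \<Rightarrow> ty \<Rightarrow> nat \<Rightarrow> tm" where
  "shift T T' i = Var T' (if T' = T then Suc i else i)"

definition under :: "ty \<Rightarrow> (ty \<Rightarrow> nat \<Rightarrow> tm) \<Rightarrow> ty \<Rightarrow> nat \<Rightarrow> tm" where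
  "under T \<sigma> T' i =
    (if T' = T then (case i of 0 \<Rightarrow> Var T 0 | Suc j \<Rightarrow> tsub (shift T) (\<sigma> T j))
     else tsub (shift T) (\<sigma> T' i))"

primrec fsub :: "(ty \<Rightarrow> nat \<Rightarrow> tm) \<Rightarrow> bfm \<Rightarrow> bfm" where
  "fsub \<sigma> (Atom a) = Atom (asub \<sigma> a)"
| "fsub \<sigma> Bot = Bot"
| "fsub \<sigma> (\<phi> \<^bold>\<and> \<psi>) = (fsub \<sigma> \<phi> \<^bold>\<and> fsub \<sigma> \<psi>)"
| "fsub \<sigma> (\<phi> \<^bold>\<or> \<psi>) = (fsub \<sigma> \<phi> \<^bold>\<or> fsub \<sigma> \<psi>)"
| "fsub \<sigma> (\<phi> \<^bold>\<longrightarrow> \<psi>) = (fsub \<sigma> \<phi> \<^bold>\<longrightarrow> fsub \<sigma> \<psi>)"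
| "fsub \<sigma> (All T \<phi>) = All T (fsub (under T \<sigma>) \<phi>)"
| "fsub \<sigma> (Ex T \<phi>) = Ex T (fsub (under T \<sigma>) \<phi>)"

abbreviation lift :: "ty \<Rightarrow> bfm \<Rightarrow> bfm" where
  "lift T \<equiv> fsub (shift T)"

text \<open>\<open>inst T t\<close> instantiates the variable bound by a removed quantifier; \<open>repl T i t\<close>
  replaces a free variable and leaves all others alone; \<open>bind T i\<close> turns the free variable
  \<open>i\<close> into the one bound by a new quantifier of type \<open>T\<close> put in front.\<close>

definition inst :: "ty \<Rightarrow> tm \<Rightarrow> ty \<Rightarrow> nat \<Rightarrow> tm" where
  "inst T t T' i =
    (if T' = T then (case i of 0 \<Rightarrow> t | Suc j \<Rightarrow> Var T j) else Var T' i)"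

definition repl :: "ty \<Rightarrow> nat \<Rightarrow> tm \<Rightarrow> ty \<Rightarrow> nat \<Rightarrow> tm" where
  "repl T i t T' j = (if T' = T \<and> j = i then t else Var T' j)"

definition bind :: "ty \<Rightarrow> nat \<Rightarrow> ty \<Rightarrow> nat \<Rightarrow> tm" where
  "bind T i T' j = (if T' = T then Var T (if j = i then 0 else Suc j) else Var T' j)"

primrec fv_tm :: "tm \<Rightarrow> (ty \<times> nat) set" where
  "fv_tm (Var T i) = {(T, i)}"
| "fv_tm Zero = {}"
| "fv_tm CK = {}"
| "fv_tm CS = {}"
| "fv_tm CD = {}"
| "fv_tm CP = {}"
| "fv_tm CP1 = {}"
| "fv_tm CP2 = {}"
| "fv_tm (CC n) = {}"

primrec fv_atom :: "atom \<Rightarrow> (ty \<times> nat) set" where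
  "fv_atom (ApA f x y) = fv_tm f \<union> fv_tm x \<union> fv_tm y"
| "fv_atom (EqA T x a) = fv_tm x \<union> fv_tm a"
| "fv_atom (InA k X Y) = fv_tm X \<union> fv_tm Y"

text \<open>The variables of a scope other than the one bound by its quantifier of type \<open>T\<close>,
  named as outside the scope.\<close>

definition outer_vars :: "ty \<Rightarrow> (ty \<times> nat) set \<Rightarrow> (ty \<times> nat) set" where
  "outer_vars T A = {(T', i). (T', if T' = T then Suc i else i) \<in> A}"

primrec fv :: "bfm \<Rightarrow> (ty \<times> nat) set" where
  "fv (Atom a) = fv_atom a"
| "fv Bot = {}"
| "fv (\<phi> \<^bold>\<and> \<psi>) = fv \<phi> \<union> fv \<psi>"
| "fv (\<phi> \<^bold>\<or> \<psi>) = fv \<phi> \<union> fv \<psi>"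
| "fv (\<phi> \<^bold>\<longrightarrow> \<psi>) = fv \<phi> \<union> fv \<psi>"
| "fv (All T \<phi>) = outer_vars T (fv \<phi>)"
| "fv (Ex T \<phi>) = outer_vars T (fv \<phi>)"


section \<open>External terms\<close>

datatype ext = At tm | App ext ext (infixl "\<^bold>\<cdot>" 90)

primrec esub :: "(ty \<Rightarrow> nat \<Rightarrow> tm) \<Rightarrow> ext \<Rightarrow> ext" where
  "esub \<sigma> (At a) = At (tsub \<sigma> a)"
| "esub \<sigma> (t \<^bold>\<cdot> u) = esub \<sigma> t \<^bold>\<cdot> esub \<sigma> u"

abbreviation elift :: "ty \<Rightarrow> ext \<Rightarrow> ext" where
  "elift T \<equiv> esub (shift T)"

lemma size_esub [simp]: "size (esub \<sigma> t) = size t"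
  by (induction t) auto

text \<open>\<open>val t x\<close> is \<open>t \<simeq> x\<close> for a type-0 term \<open>x\<close>; \<open>sim t u\<close> is \<open>t \<simeq> u\<close> for external terms,
  and also serves as the equality of two objects of the same type.\<close>

function val :: "ext \<Rightarrow> tm \<Rightarrow> bfm" where
  "val (At a) x = Eq (type_of a) x a"
| "val (t \<^bold>\<cdot> u) x =
    Ex (Ty 0) (Ex (Ty 0)
      (val (elift (Ty 0) (elift (Ty 0) t)) (v0 1) \<^bold>\<and>
       val (elift (Ty 0) (elift (Ty 0) u)) (v0 0) \<^bold>\<and>
       Ap (v0 1) (v0 0) (tsub (shift (Ty 0)) (tsub (shift (Ty 0)) x))))"
  by pat_completeness auto
termination by (relation "measure (\<lambda>(t, x). size t)") auto

definition defined :: "ext \<Rightarrow> bfm" where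
  "defined t = Ex (Ty 0) (val (elift (Ty 0) t) (v0 0))"

definition sim :: "ext \<Rightarrow> ext \<Rightarrow> bfm" where
  "sim t u = Ex (Ty 0) (val (elift (Ty 0) t) (v0 0) \<^bold>\<and> val (elift (Ty 0) u) (v0 0))"

definition cong :: "ext \<Rightarrow> ext \<Rightarrow> bfm" where
  "cong t u = All (Ty 0) (val (elift (Ty 0) t) (v0 0) \<^bold>\<longleftrightarrow> val (elift (Ty 0) u) (v0 0))"

text \<open>Membership of the value of an external term, as an object of type \<open>k\<close>.\<close>

definition ext_in :: "nat \<Rightarrow> ext \<Rightarrow> tm \<Rightarrow> bfm" where
  "ext_in k t Y =
    Ex (Ty k) (sim (elift (Ty k) t) (At (vT k 0)) \<^bold>\<and> In k (vT k 0) (tsub (shift (Ty k)) Y))"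

abbreviation pair :: "ext \<Rightarrow> ext \<Rightarrow> ext" where
  "pair t u \<equiv> At CP \<^bold>\<cdot> t \<^bold>\<cdot> u"

text \<open>Application to a tuple; on the empty list it is the operator itself.\<close>

fun app_tuple :: "ext \<Rightarrow> ext list \<Rightarrow> ext" where
  "app_tuple t [] = t"
| "app_tuple t (x # xs) = t \<^bold>\<cdot> foldl pair x xs"


section \<open>Goedel numbering\<close>

primrec gn_ty :: "ty \<Rightarrow> nat" where
  "gn_ty Omega = 0"
| "gn_ty (Ty k) = Suc k"

definition gn_var :: "ty \<times> nat \<Rightarrow> nat" where
  "gn_var = (\<lambda>(T, i). prod_encode (gn_ty T, i))"

primrec gn_tm :: "tm \<Rightarrow> nat" where
  "gn_tm (Var T i) = prod_encode (0, gn_var (T, i))"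
| "gn_tm Zero = prod_encode (1, 0)"
| "gn_tm CK = prod_encode (2, 0)"
| "gn_tm CS = prod_encode (3, 0)"
| "gn_tm CD = prod_encode (4, 0)"
| "gn_tm CP = prod_encode (5, 0)"
| "gn_tm CP1 = prod_encode (6, 0)"
| "gn_tm CP2 = prod_encode (7, 0)"
| "gn_tm (CC n) = prod_encode (8, n)"

primrec gn_atom :: "atom \<Rightarrow> nat" where
  "gn_atom (ApA f x y) =
    prod_encode (0, prod_encode (gn_tm f, prod_encode (gn_tm x, gn_tm y)))"
| "gn_atom (EqA T x a) =
    prod_encode (1, prod_encode (gn_ty T, prod_encode (gn_tm x, gn_tm a)))"
| "gn_atom (InA k X Y) =
    prod_encode (2, prod_encode (k, prod_encode (gn_tm X, gn_tm Y)))"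

primrec gn_fm :: "bfm \<Rightarrow> nat" where
  "gn_fm (Atom a) = prod_encode (0, gn_atom a)"
| "gn_fm Bot = prod_encode (1, 0)"
| "gn_fm (\<phi> \<^bold>\<and> \<psi>) = prod_encode (2, prod_encode (gn_fm \<phi>, gn_fm \<psi>))"
| "gn_fm (\<phi> \<^bold>\<or> \<psi>) = prod_encode (3, prod_encode (gn_fm \<phi>, gn_fm \<psi>))"
| "gn_fm (\<phi> \<^bold>\<longrightarrow> \<psi>) = prod_encode (4, prod_encode (gn_fm \<phi>, gn_fm \<psi>))"
| "gn_fm (All T \<phi>) = prod_encode (5, prod_encode (gn_ty T, gn_fm \<phi>))"
| "gn_fm (Ex T \<phi>) = prod_encode (6, prod_encode (gn_ty T, gn_fm \<phi>))"

text \<open>The number of \<open>Z. X. \<phi>\<close> for \<open>Z\<close> of type \<open>k\<close> and a list \<open>X\<close> of variables;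
  in \<open>\<phi>\<close> the variable \<open>Z\<close> is index 0 of type \<open>k\<close>, as if bound.\<close>

definition gn :: "nat \<Rightarrow> (ty \<times> nat) list \<Rightarrow> bfm \<Rightarrow> nat" where
  "gn k X \<phi> = prod_encode (k, prod_encode (list_encode (map gn_var X), gn_fm \<phi>))"

lemma gn_ty_inject [simp]: "gn_ty T = gn_ty T' \<longleftrightarrow> T = T'"
  by (cases T; cases T') auto

lemma gn_var_inject [simp]: "gn_var x = gn_var y \<longleftrightarrow> x = y"
  by (cases x; cases y) (auto simp: gn_var_def)

lemma gn_tm_inject [simp]: "gn_tm t = gn_tm u \<longleftrightarrow> t = u"
  by (cases t; cases u) auto

lemma gn_atom_inject [simp]: "gn_atom a = gn_atom b \<longleftrightarrow> a = b"
  by (cases a; cases b) auto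

lemma gn_fm_inject [simp]: "gn_fm \<phi> = gn_fm \<psi> \<longleftrightarrow> \<phi> = \<psi>"
proof (induction \<phi> arbitrary: \<psi>)
qed (case_tac \<psi>; simp)+

lemma gn_inject: "gn k X \<phi> = gn k' X' \<phi>' \<longleftrightarrow> k = k' \<and> X = X' \<and> \<phi> = \<phi>'"
proof -
  have "inj gn_var" by (simp add: inj_def)
  then show ?thesis by (simp add: gn_def list_encode_eq)
qed


section \<open>The theories BT with types at most s\<close>

inductive BT_axiom :: "bfm \<Rightarrow> bool" where
  eq_refl: "BT_axiom (Eq (Ty 0) (v0 x) (v0 x))"
| eq_types: "BT_axiom (Eq (Ty k) (v0 u) (vT k X) \<^bold>\<and> Eq (Ty k) (v0 v) (vT k X) \<^bold>\<and>
    Eq (Ty n) (v0 u) (vT n Y) \<^bold>\<longrightarrow> Eq (Ty n) (v0 v) (vT n Y))"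
| eq_num: "BT_axiom (Eq Omega (v0 u) (vN m) \<^bold>\<and> Eq Omega (v0 v) (vN m) \<^bold>\<longrightarrow>
    Eq (Ty 0) (v0 u) (v0 v))"
| eq_num_trans: "BT_axiom (Eq Omega (v0 u) (vN m) \<^bold>\<and> Eq (Ty 0) (v0 u) (v0 v) \<^bold>\<longrightarrow>
    Eq Omega (v0 v) (vN m))"
| eq_Ap: "BT_axiom (Ap (v0 f) (v0 x) (v0 y) \<^bold>\<and> Eq (Ty 0) (v0 f) (v0 g) \<^bold>\<and>
    Eq (Ty 0) (v0 x) (v0 u) \<^bold>\<and> Eq (Ty 0) (v0 y) (v0 v) \<^bold>\<longrightarrow> Ap (v0 g) (v0 u) (v0 v))"
| eq_In: "BT_axiom (In k (vT k X) (vT (Suc k) Y) \<^bold>\<and> sim (At (vT k X)) (At (vT k U)) \<^bold>\<and>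
    sim (At (vT (Suc k) Y)) (At (vT (Suc k) Z)) \<^bold>\<longrightarrow> In k (vT k U) (vT (Suc k) Z))"
| Ap_unique: "BT_axiom (Ap (v0 f) (v0 x) (v0 y) \<^bold>\<and> Ap (v0 f) (v0 x) (v0 z) \<^bold>\<longrightarrow>
    Eq (Ty 0) (v0 y) (v0 z))"
| K: "BT_axiom (val (At CK \<^bold>\<cdot> At (v0 x) \<^bold>\<cdot> At (v0 y)) (v0 x))"
| S_defined: "BT_axiom (defined (At CS \<^bold>\<cdot> At (v0 x) \<^bold>\<cdot> At (v0 y)))"
| S: "BT_axiom (cong (At CS \<^bold>\<cdot> At (v0 x) \<^bold>\<cdot> At (v0 y) \<^bold>\<cdot> At (v0 z))
    (At (v0 x) \<^bold>\<cdot> At (v0 z) \<^bold>\<cdot> (At (v0 y) \<^bold>\<cdot> At (v0 z))))"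
| P_defined: "BT_axiom (defined (pair (At (v0 x)) (At (v0 y))))"
| P_not_0: "BT_axiom (Neg (sim (pair (At (v0 x)) (At (v0 y))) (At Zero)))"
| P1_defined: "BT_axiom (defined (At CP1 \<^bold>\<cdot> At (v0 x)))"
| P2_defined: "BT_axiom (defined (At CP2 \<^bold>\<cdot> At (v0 x)))"
| P1: "BT_axiom (val (At CP1 \<^bold>\<cdot> pair (At (v0 x1)) (At (v0 x2))) (v0 x1))"
| P2: "BT_axiom (val (At CP2 \<^bold>\<cdot> pair (At (v0 x1)) (At (v0 x2))) (v0 x2))"
| succ_num: "BT_axiom (Ex Omega (sim (pair (At (vN (Suc n))) (At Zero)) (At (vN 0))))"
| P_type: "BT_axiom (Ex (Ty k)
    (sim (elift (Ty k) (pair (At (v0 x)) (At (vT k Y)))) (At (vT k 0))))"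
| D_eq: "BT_axiom (sim (At (vN n)) (At (vN m)) \<^bold>\<longrightarrow>
    val (At CD \<^bold>\<cdot> At (v0 x) \<^bold>\<cdot> At (v0 y) \<^bold>\<cdot> At (vN n) \<^bold>\<cdot> At (vN m)) (v0 x))"
| D_neq: "BT_axiom (Neg (sim (At (vN n)) (At (vN m))) \<^bold>\<longrightarrow>
    val (At CD \<^bold>\<cdot> At (v0 x) \<^bold>\<cdot> At (v0 y) \<^bold>\<cdot> At (vN n) \<^bold>\<cdot> At (vN m)) (v0 y))"
| num_type_0: "BT_axiom (Ex (Ty 0) (Eq Omega (v0 0) (vN n)))"
| set_type_0: "BT_axiom (Ex (Ty 0) (Eq (Ty k) (v0 0) (tsub (shift (Ty 0)) (vT k Y))))"
| comprehension: "elementary (Suc k) \<phi> \<Longrightarrow> outer_vars (Ty k) (fv \<phi>) \<subseteq> set X \<Longrightarrow>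
    \<forall>(T, i) \<in> set X. ty_le T (Suc k) \<Longrightarrow>
    BT_axiom (Ex (Ty (Suc k))
      (sim (elift (Ty (Suc k))
             (app_tuple (At (CC (gn k X \<phi>))) (map (\<lambda>(T, i). At (Var T i)) X)))
           (At (vT (Suc k) 0)) \<^bold>\<and>
       All (Ty k) (In k (vT k 0) (vT (Suc k) 0) \<^bold>\<longleftrightarrow> lift (Ty (Suc k)) \<phi>)))"

text \<open>\<open>BT cl s\<close> is derivability in the fragment with types at most \<open>s\<close>, with classical logic
  iff \<open>cl\<close>. In the quantifier rules the shift expresses that the quantified variable is not
  free in the other formula. In \<open>induction\<close>, \<open>n\<close> is a free numerical variable.\<close>

inductive BT :: "bool \<Rightarrow> nat \<Rightarrow> bfm \<Rightarrow> bool" for cl :: bool and s :: nat where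
  propositional: "ipl_axiom \<phi> \<Longrightarrow> wff s \<phi> \<Longrightarrow> BT cl s \<phi>"
| classical: "cl \<Longrightarrow> wff s \<phi> \<Longrightarrow> BT cl s (\<phi> \<^bold>\<or> Neg \<phi>)"
| all_elim: "wff s (All T \<phi>) \<Longrightarrow> type_of t = T \<Longrightarrow>
    BT cl s (All T \<phi> \<^bold>\<longrightarrow> fsub (inst T t) \<phi>)"
| ex_intro: "wff s (Ex T \<phi>) \<Longrightarrow> type_of t = T \<Longrightarrow>
    BT cl s (fsub (inst T t) \<phi> \<^bold>\<longrightarrow> Ex T \<phi>)"
| axiom: "BT_axiom \<phi> \<Longrightarrow> wff s \<phi> \<Longrightarrow> BT cl s \<phi>"
| mp: "BT cl s (\<phi> \<^bold>\<longrightarrow> \<psi>) \<Longrightarrow> BT cl s \<phi> \<Longrightarrow> BT cl s \<psi>"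
| all_intro: "BT cl s (lift T \<phi> \<^bold>\<longrightarrow> \<psi>) \<Longrightarrow> ty_le T s \<Longrightarrow> BT cl s (\<phi> \<^bold>\<longrightarrow> All T \<psi>)"
| ex_elim: "BT cl s (\<psi> \<^bold>\<longrightarrow> lift T \<phi>) \<Longrightarrow> ty_le T s \<Longrightarrow> BT cl s (Ex T \<psi> \<^bold>\<longrightarrow> \<phi>)"
| induction: "BT cl s (fsub (repl Omega n Zero) \<phi>) \<Longrightarrow>
    BT cl s (\<phi> \<^bold>\<longrightarrow> Ex Omega (sim (pair (At (vN (Suc n))) (At Zero)) (At (vN 0)) \<^bold>\<and>
                              fsub (bind Omega n) \<phi>)) \<Longrightarrow>
    BT cl s \<phi>"


section \<open>The theories SA with sorts at most s\<close>

datatype stm = SVar nat | S0 | S1 | SAdd stm stm | SMul stm stm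

text \<open>\<open>SInA k t i\<close> states membership of \<open>t\<close> in the set variable \<open>i\<close> of sort \<open>k\<close>. Quantifiers of type
  \<open>Omega\<close> are numerical; those of type \<open>Ty k\<close> range over sets of sort \<open>k \<ge> 1\<close>.\<close>

datatype satom = SEqA stm stm | SInA nat stm nat

type_synonym sfm = "satom fm"

abbreviation SEq :: "stm \<Rightarrow> stm \<Rightarrow> sfm" where "SEq t u \<equiv> Atom (SEqA t u)"
abbreviation SIn :: "nat \<Rightarrow> stm \<Rightarrow> nat \<Rightarrow> sfm" where "SIn k t i \<equiv> Atom (SInA k t i)"

primrec sort_ok :: "nat \<Rightarrow> ty \<Rightarrow> bool" where
  "sort_ok n Omega \<longleftrightarrow> True"
| "sort_ok n (Ty k) \<longleftrightarrow> 1 \<le> k \<and> k \<le> n"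

primrec swf_atom :: "nat \<Rightarrow> satom \<Rightarrow> bool" where
  "swf_atom n (SEqA t u) \<longleftrightarrow> True"
| "swf_atom n (SInA k t i) \<longleftrightarrow> sort_ok n (Ty k)"

text \<open>The formulas of SA with sorts at most \<open>n\<close>; for \<open>n = 0\<close>, the formulas of Peano
  arithmetic.\<close>

primrec swff :: "nat \<Rightarrow> sfm \<Rightarrow> bool" where
  "swff n (Atom a) \<longleftrightarrow> swf_atom n a"
| "swff n Bot \<longleftrightarrow> True"
| "swff n (\<phi> \<^bold>\<and> \<psi>) \<longleftrightarrow> swff n \<phi> \<and> swff n \<psi>"
| "swff n (\<phi> \<^bold>\<or> \<psi>) \<longleftrightarrow> swff n \<phi> \<and> swff n \<psi>"
| "swff n (\<phi> \<^bold>\<longrightarrow> \<psi>) \<longleftrightarrow> swff n \<phi> \<and> swff n \<psi>"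
| "swff n (All T \<phi>) \<longleftrightarrow> sort_ok n T \<and> swff n \<phi>"
| "swff n (Ex T \<phi>) \<longleftrightarrow> sort_ok n T \<and> swff n \<phi>"

definition arithmetical :: "sfm \<Rightarrow> bool" where
  "arithmetical \<psi> \<longleftrightarrow> swff 0 \<psi>"

primrec no_set_quant :: "sfm \<Rightarrow> bool" where
  "no_set_quant (Atom a) \<longleftrightarrow> True"
| "no_set_quant Bot \<longleftrightarrow> True"
| "no_set_quant (\<phi> \<^bold>\<and> \<psi>) \<longleftrightarrow> no_set_quant \<phi> \<and> no_set_quant \<psi>"
| "no_set_quant (\<phi> \<^bold>\<or> \<psi>) \<longleftrightarrow> no_set_quant \<phi> \<and> no_set_quant \<psi>"
| "no_set_quant (\<phi> \<^bold>\<longrightarrow> \<psi>) \<longleftrightarrow> no_set_quant \<phi> \<and> no_set_quant \<psi>"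
| "no_set_quant (All T \<phi>) \<longleftrightarrow> T = Omega \<and> no_set_quant \<phi>"
| "no_set_quant (Ex T \<phi>) \<longleftrightarrow> T = Omega \<and> no_set_quant \<phi>"

definition simple :: "nat \<Rightarrow> sfm \<Rightarrow> bool" where
  "simple k \<phi> \<longleftrightarrow> swff k \<phi> \<and> no_set_quant \<phi>"

subsection \<open>Substitution and universal closure\<close>

text \<open>\<open>\<sigma>\<close> substitutes terms for numerical variables, \<open>\<rho> k\<close> renames set variables of sort \<open>k\<close>.\<close>

primrec stsub :: "(nat \<Rightarrow> stm) \<Rightarrow> stm \<Rightarrow> stm" where
  "stsub \<sigma> (SVar i) = \<sigma> i"
| "stsub \<sigma> S0 = S0"
| "stsub \<sigma> S1 = S1"
| "stsub \<sigma> (SAdd t u) = SAdd (stsub \<sigma> t) (stsub \<sigma> u)"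
| "stsub \<sigma> (SMul t u) = SMul (stsub \<sigma> t) (stsub \<sigma> u)"

primrec sasub :: "(nat \<Rightarrow> stm) \<Rightarrow> (nat \<Rightarrow> nat \<Rightarrow> nat) \<Rightarrow> satom \<Rightarrow> satom" where
  "sasub \<sigma> \<rho> (SEqA t u) = SEqA (stsub \<sigma> t) (stsub \<sigma> u)"
| "sasub \<sigma> \<rho> (SInA k t i) = SInA k (stsub \<sigma> t) (\<rho> k i)"

fun num_under :: "ty \<Rightarrow> (nat \<Rightarrow> stm) \<Rightarrow> nat \<Rightarrow> stm" where
  "num_under Omega \<sigma> = (\<lambda>i. case i of 0 \<Rightarrow> SVar 0 | Suc j \<Rightarrow> stsub (\<lambda>l. SVar (Suc l)) (\<sigma> j))"
| "num_under (Ty k) \<sigma> = \<sigma>"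

fun set_under :: "ty \<Rightarrow> (nat \<Rightarrow> nat \<Rightarrow> nat) \<Rightarrow> nat \<Rightarrow> nat \<Rightarrow> nat" where
  "set_under Omega \<rho> = \<rho>"
| "set_under (Ty k) \<rho> = \<rho>(k := (\<lambda>i. case i of 0 \<Rightarrow> 0 | Suc j \<Rightarrow> Suc (\<rho> k j)))"

primrec ssub :: "(nat \<Rightarrow> stm) \<Rightarrow> (nat \<Rightarrow> nat \<Rightarrow> nat) \<Rightarrow> sfm \<Rightarrow> sfm" where
  "ssub \<sigma> \<rho> (Atom a) = Atom (sasub \<sigma> \<rho> a)"
| "ssub \<sigma> \<rho> Bot = Bot"
| "ssub \<sigma> \<rho> (\<phi> \<^bold>\<and> \<psi>) = (ssub \<sigma> \<rho> \<phi> \<^bold>\<and> ssub \<sigma> \<rho> \<psi>)"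
| "ssub \<sigma> \<rho> (\<phi> \<^bold>\<or> \<psi>) = (ssub \<sigma> \<rho> \<phi> \<^bold>\<or> ssub \<sigma> \<rho> \<psi>)"
| "ssub \<sigma> \<rho> (\<phi> \<^bold>\<longrightarrow> \<psi>) = (ssub \<sigma> \<rho> \<phi> \<^bold>\<longrightarrow> ssub \<sigma> \<rho> \<psi>)"
| "ssub \<sigma> \<rho> (All T \<phi>) = All T (ssub (num_under T \<sigma>) (set_under T \<rho>) \<phi>)"
| "ssub \<sigma> \<rho> (Ex T \<phi>) = Ex T (ssub (num_under T \<sigma>) (set_under T \<rho>) \<phi>)"

abbreviation nsub :: "(nat \<Rightarrow> stm) \<Rightarrow> sfm \<Rightarrow> sfm" where
  "nsub \<sigma> \<equiv> ssub \<sigma> (\<lambda>k i. i)"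

abbreviation set_ren :: "nat \<Rightarrow> (nat \<Rightarrow> nat) \<Rightarrow> sfm \<Rightarrow> sfm" where
  "set_ren k r \<equiv> ssub SVar ((\<lambda>k i. i)(k := r))"

fun slift :: "ty \<Rightarrow> sfm \<Rightarrow> sfm" where
  "slift Omega \<phi> = nsub (\<lambda>i. SVar (Suc i)) \<phi>"
| "slift (Ty k) \<phi> = set_ren k Suc \<phi>"

definition ninst :: "stm \<Rightarrow> nat \<Rightarrow> stm" where
  "ninst t i = (case i of 0 \<Rightarrow> t | Suc j \<Rightarrow> SVar j)"

definition set_inst :: "nat \<Rightarrow> nat \<Rightarrow> nat" where
  "set_inst y i = (case i of 0 \<Rightarrow> y | Suc j \<Rightarrow> j)"

primrec stm_vars :: "stm \<Rightarrow> nat list" where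
  "stm_vars (SVar i) = [i]"
| "stm_vars S0 = []"
| "stm_vars S1 = []"
| "stm_vars (SAdd t u) = stm_vars t @ stm_vars u"
| "stm_vars (SMul t u) = stm_vars t @ stm_vars u"

primrec satom_vars :: "satom \<Rightarrow> (ty \<times> nat) list" where
  "satom_vars (SEqA t u) = map (Pair Omega) (stm_vars t @ stm_vars u)"
| "satom_vars (SInA k t i) = map (Pair Omega) (stm_vars t) @ [(Ty k, i)]"

definition outer_list :: "ty \<Rightarrow> (ty \<times> nat) list \<Rightarrow> (ty \<times> nat) list" where
  "outer_list T xs =
    map (\<lambda>(T', i). (T', if T' = T then i - 1 else i)) (filter (\<lambda>x. x \<noteq> (T, 0)) xs)"

primrec free_list :: "sfm \<Rightarrow> (ty \<times> nat) list" where
  "free_list (Atom a) = satom_vars a"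
| "free_list Bot = []"
| "free_list (\<phi> \<^bold>\<and> \<psi>) = free_list \<phi> @ free_list \<psi>"
| "free_list (\<phi> \<^bold>\<or> \<psi>) = free_list \<phi> @ free_list \<psi>"
| "free_list (\<phi> \<^bold>\<longrightarrow> \<psi>) = free_list \<phi> @ free_list \<psi>"
| "free_list (All T \<phi>) = outer_list T (free_list \<phi>)"
| "free_list (Ex T \<phi>) = outer_list T (free_list \<phi>)"

text \<open>Universal quantification over a given free variable, as with named variables.\<close>

fun all_var :: "ty \<times> nat \<Rightarrow> sfm \<Rightarrow> sfm" where
  "all_var (Omega, i) \<phi> = All Omega (nsub (\<lambda>j. SVar (if j = i then 0 else Suc j)) \<phi>)"
| "all_var (Ty k, i) \<phi> = All (Ty k) (set_ren k (\<lambda>j. if j = i then 0 else Suc j) \<phi>)"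

definition universal_closure :: "sfm \<Rightarrow> sfm" where
  "universal_closure \<psi> = foldr all_var (remdups (free_list \<psi>)) \<psi>"

subsection \<open>Axioms and derivability\<close>

abbreviation SSuc :: "stm \<Rightarrow> stm" where "SSuc t \<equiv> SAdd t S1"

text \<open>An injective pairing given by a term of the language: \<open>(n + m)\<^sup>2 + n\<close>.\<close>

definition spair :: "stm \<Rightarrow> stm \<Rightarrow> stm" where
  "spair n m = SAdd (SMul (SAdd n m) (SAdd n m)) n"

text \<open>Unique existence for sets of sort \<open>k\<close>, equality of sets being coextensionality.\<close>

definition ex_unique :: "nat \<Rightarrow> sfm \<Rightarrow> sfm" where
  "ex_unique k \<phi> = (Ex (Ty k) \<phi> \<^bold>\<and>
    All (Ty k) (All (Ty k)
      (set_ren k Suc \<phi> \<^bold>\<and> set_ren k (\<lambda>i. case i of 0 \<Rightarrow> 0 | Suc j \<Rightarrow> Suc (Suc j)) \<phi> \<^bold>\<longrightarrow>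
       All Omega (SIn k (SVar 0) 1 \<^bold>\<longleftrightarrow> SIn k (SVar 0) 0))))"

text \<open>In \<open>comprehension\<close> and \<open>choice\<close> the numerical variable \<open>n\<close> of \<open>\<phi>\<close> is index 0, and in
  \<open>choice\<close> the set variable \<open>x\<close> of \<open>\<phi>\<close> is index 0 of sort \<open>k\<close>; no shift for the quantifier of
  sort \<open>k + 1\<close> is needed there, since a \<open>k\<close>-simple formula contains no variables of that sort.\<close>

inductive SA_axiom :: "sfm \<Rightarrow> bool" where
  eq_refl: "SA_axiom (SEq t t)"
| eq_subst: "SA_axiom (SEq t u \<^bold>\<longrightarrow> nsub (ninst t) \<phi> \<^bold>\<longrightarrow> nsub (ninst u) \<phi>)"
| succ_not_0: "SA_axiom (Neg (SEq (SSuc (SVar n)) S0))"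
| succ_inject: "SA_axiom (SEq (SSuc (SVar n)) (SSuc (SVar m)) \<^bold>\<longrightarrow> SEq (SVar n) (SVar m))"
| add_0: "SA_axiom (SEq (SAdd (SVar n) S0) (SVar n))"
| add_succ: "SA_axiom (SEq (SAdd (SVar n) (SSuc (SVar m))) (SSuc (SAdd (SVar n) (SVar m))))"
| mul_0: "SA_axiom (SEq (SMul (SVar n) S0) S0)"
| mul_succ: "SA_axiom
    (SEq (SMul (SVar n) (SSuc (SVar m))) (SAdd (SMul (SVar n) (SVar m)) (SVar n)))"
| induction: "SA_axiom (nsub (ninst S0) \<phi> \<^bold>\<and>
    All Omega (\<phi> \<^bold>\<longrightarrow> nsub (\<lambda>i. case i of 0 \<Rightarrow> SSuc (SVar 0) | Suc j \<Rightarrow> SVar (Suc j)) \<phi>) \<^bold>\<longrightarrow>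
    All Omega \<phi>)"
| comprehension: "simple k \<phi> \<Longrightarrow>
    SA_axiom (Ex (Ty k) (All Omega (SIn k (SVar 0) 0 \<^bold>\<longleftrightarrow> slift (Ty k) \<phi>)))"
| choice: "simple k \<phi> \<Longrightarrow>
    SA_axiom (All Omega (ex_unique k \<phi>) \<^bold>\<longrightarrow>
      Ex (Ty (Suc k)) (All Omega (Ex (Ty k) (\<phi> \<^bold>\<and>
        All Omega (SIn k (SVar 0) 0 \<^bold>\<longleftrightarrow> SIn (Suc k) (spair (SVar 1) (SVar 0)) 0)))))"

inductive SA :: "nat \<Rightarrow> sfm \<Rightarrow> bool" for s :: nat where
  propositional: "ipl_axiom \<phi> \<Longrightarrow> swff s \<phi> \<Longrightarrow> SA s \<phi>"
| classical: "swff s \<phi> \<Longrightarrow> SA s (\<phi> \<^bold>\<or> Neg \<phi>)"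
| all_num_elim: "swff s (All Omega \<phi>) \<Longrightarrow> SA s (All Omega \<phi> \<^bold>\<longrightarrow> nsub (ninst t) \<phi>)"
| ex_num_intro: "swff s (Ex Omega \<phi>) \<Longrightarrow> SA s (nsub (ninst t) \<phi> \<^bold>\<longrightarrow> Ex Omega \<phi>)"
| all_set_elim: "swff s (All (Ty k) \<phi>) \<Longrightarrow>
    SA s (All (Ty k) \<phi> \<^bold>\<longrightarrow> set_ren k (set_inst y) \<phi>)"
| ex_set_intro: "swff s (Ex (Ty k) \<phi>) \<Longrightarrow>
    SA s (set_ren k (set_inst y) \<phi> \<^bold>\<longrightarrow> Ex (Ty k) \<phi>)"
| axiom: "SA_axiom \<phi> \<Longrightarrow> swff s \<phi> \<Longrightarrow> SA s \<phi>"
| mp: "SA s (\<phi> \<^bold>\<longrightarrow> \<psi>) \<Longrightarrow> SA s \<phi> \<Longrightarrow> SA s \<psi>"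
| all_intro: "SA s (slift T \<phi> \<^bold>\<longrightarrow> \<psi>) \<Longrightarrow> sort_ok s T \<Longrightarrow> SA s (\<phi> \<^bold>\<longrightarrow> All T \<psi>)"
| ex_elim: "SA s (\<psi> \<^bold>\<longrightarrow> slift T \<phi>) \<Longrightarrow> sort_ok s T \<Longrightarrow> SA s (Ex T \<psi> \<^bold>\<longrightarrow> \<phi>)"


section \<open>Arithmetic in BT\<close>

text \<open>Bracket abstraction over a type-0 variable.\<close>

primrec lam :: "nat \<Rightarrow> ext \<Rightarrow> ext" where
  "lam i (At a) = (if a = v0 i then At CS \<^bold>\<cdot> At CK \<^bold>\<cdot> At CK else At CK \<^bold>\<cdot> At a)"
| "lam i (t \<^bold>\<cdot> u) = At CS \<^bold>\<cdot> lam i t \<^bold>\<cdot> lam i u"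

text \<open>\<open>fixpoint f \<down>\<close> and \<open>fixpoint f x \<cong> f (fixpoint f) x\<close>.\<close>

definition fixpoint :: ext where
  "fixpoint =
    (let f = At (v0 0); y = At (v0 1); x = At (v0 2);
         w = lam 1 (lam 2 (f \<^bold>\<cdot> (y \<^bold>\<cdot> y) \<^bold>\<cdot> x))
     in lam 0 (w \<^bold>\<cdot> w))"

text \<open>Primitive recursion: \<open>recursor a g 0 \<simeq> a\<close> and
  \<open>recursor a g (n + 1) \<cong> g n (recursor a g n)\<close>. The predecessor is the first projection; the two
  cases are abstracted so that only the selected one is evaluated.\<close>

definition recursor :: ext where
  "recursor =
    (let r = At (v0 0); a = At (v0 1); g = At (v0 2); n = At (v0 3);
         m = At CP1 \<^bold>\<cdot> n
     in fixpoint \<^bold>\<cdot> lam 0 (lam 1 (lam 2 (lam 3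
          (At CD \<^bold>\<cdot> lam 4 a \<^bold>\<cdot> lam 4 (g \<^bold>\<cdot> m \<^bold>\<cdot> (r \<^bold>\<cdot> a \<^bold>\<cdot> g \<^bold>\<cdot> m)) \<^bold>\<cdot> n \<^bold>\<cdot> At Zero \<^bold>\<cdot> At Zero)))))"

definition addition :: ext where
  "addition = lam 0 (lam 1
    (recursor \<^bold>\<cdot> At (v0 0) \<^bold>\<cdot> lam 2 (lam 3 (pair (At (v0 3)) (At Zero))) \<^bold>\<cdot> At (v0 1)))"

definition multiplication :: ext where
  "multiplication = lam 0 (lam 1
    (recursor \<^bold>\<cdot> At Zero \<^bold>\<cdot> lam 2 (lam 3 (addition \<^bold>\<cdot> At (v0 3) \<^bold>\<cdot> At (v0 0))) \<^bold>\<cdot> At (v0 1)))"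

primrec arith_tm :: "stm \<Rightarrow> ext" where
  "arith_tm (SVar i) = At (vN i)"
| "arith_tm S0 = At Zero"
| "arith_tm S1 = pair (At Zero) (At Zero)"
| "arith_tm (SAdd t u) = addition \<^bold>\<cdot> arith_tm t \<^bold>\<cdot> arith_tm u"
| "arith_tm (SMul t u) = multiplication \<^bold>\<cdot> arith_tm t \<^bold>\<cdot> arith_tm u"

text \<open>An arithmetical formula as a formula of BT; the value \<open>Bot\<close> for formulas
  with set variables is a dummy.\<close>

fun arith_fm :: "sfm \<Rightarrow> bfm" where
  "arith_fm (Atom (SEqA t u)) = sim (arith_tm t) (arith_tm u)"
| "arith_fm (Atom (SInA k t i)) = Bot"
| "arith_fm Bot = Bot"
| "arith_fm (\<phi> \<^bold>\<and> \<psi>) = (arith_fm \<phi> \<^bold>\<and> arith_fm \<psi>)"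
| "arith_fm (\<phi> \<^bold>\<or> \<psi>) = (arith_fm \<phi> \<^bold>\<or> arith_fm \<psi>)"
| "arith_fm (\<phi> \<^bold>\<longrightarrow> \<psi>) = (arith_fm \<phi> \<^bold>\<longrightarrow> arith_fm \<psi>)"
| "arith_fm (All Omega \<phi>) = All Omega (arith_fm \<phi>)"
| "arith_fm (Ex Omega \<phi>) = Ex Omega (arith_fm \<phi>)"
| "arith_fm (All (Ty k) \<phi>) = Bot"
| "arith_fm (Ex (Ty k) \<phi>) = Bot"


section \<open>The translation of SA into BT\<close>

text \<open>The constant that comprehension provides for \<open>Z. X. Z = X\<close> with \<open>Z\<close>, \<open>X\<close> of type \<open>k\<close>; the
  parameter \<open>X\<close> has index 0 outside and hence index 1 inside the scope of \<open>Z\<close>.\<close>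

definition singleton :: "nat \<Rightarrow> ext" where
  "singleton k = At (CC (gn k [(Ty k, 0)] (sim (At (vT k 0)) (At (vT k 1)))))"

primrec iter_singleton :: "nat \<Rightarrow> ext \<Rightarrow> ext" where
  "iter_singleton 0 t = t"
| "iter_singleton (Suc k) t = singleton k \<^bold>\<cdot> iter_singleton k t"

text \<open>\<open>MM k i\<close> says, for \<open>k \<ge> 1\<close>, that all elements of the variable \<open>i\<close> of type \<open>k\<close> are iterated
  singletons of numbers.\<close>

definition MM :: "nat \<Rightarrow> nat \<Rightarrow> bfm" where
  "MM k i = All (Ty (k - 1)) (In (k - 1) (vT (k - 1) 0) (vT k i) \<^bold>\<longrightarrow>
    Ex Omega (sim (iter_singleton (k - 1) (At (vN 0))) (At (vT (k - 1) 0))))"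

fun star :: "sfm \<Rightarrow> bfm" where
  "star (Atom (SEqA t u)) = sim (arith_tm t) (arith_tm u)"
| "star (Atom (SInA k t i)) = ext_in (k - 1) (iter_singleton (k - 1) (arith_tm t)) (vT k i)"
| "star Bot = Bot"
| "star (\<phi> \<^bold>\<and> \<psi>) = (star \<phi> \<^bold>\<and> star \<psi>)"
| "star (\<phi> \<^bold>\<or> \<psi>) = (star \<phi> \<^bold>\<or> star \<psi>)"
| "star (\<phi> \<^bold>\<longrightarrow> \<psi>) = (star \<phi> \<^bold>\<longrightarrow> star \<psi>)"
| "star (All Omega \<phi>) = All Omega (star \<phi>)"
| "star (Ex Omega \<phi>) = Ex Omega (star \<phi>)"
| "star (All (Ty k) \<phi>) = All (Ty k) (MM k 0 \<^bold>\<longrightarrow> star \<phi>)"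
| "star (Ex (Ty k) \<phi>) = Ex (Ty k) (MM k 0 \<^bold>\<and> star \<phi>)"

end

(* Both theories are handled through their models. A Henkin construction shows that BT with classical
   logic proves every formula valid in all its models, and these may be taken normalised: every
   object lies in the universe of type 0 and all equality predicates are the identity. It then
   suffices to read off from an arbitrary model of BT a model of SA: the numbers with the operations
   computed by the recursor, and at sort k the objects of type k all of whose elements are iterated
   singletons of numbers. Comprehension in SA is comprehension in BT for the set of singletons of the
   numbers in question, and so is choice, given that the pairing is injective, which takes a little
   arithmetic inside the model. *)

theory Submission
  imports Defs
begin

section \<open>Substitution\<close>

text \<open>Application is partial, so derivations about the recursor would be long; in a model an
  external term just has an optional value. Several obstacles shape the details. A model satisfies
  all theorems of BT, but induction is a rule, so the schema with hypotheses about parameters is not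
  given outright; it is recovered by deriving, through completeness itself, one formula that carries
  these hypotheses. The numbers of a model may be nonstandard, so the recursion equations alone do
  not make addition and multiplication total, and every arithmetical fact needs an induction over a
  formula. An open theorem of SA is guaranteed only when its set variables denote sets of iterated
  singletons; assignments in a model of BT are not restricted in this way, which the universal
  closure repairs. Choice raises the sort by one because the set of coded pairs is defined with a
  quantifier over type k, which comprehension for objects of type k + 1 permits.\<close>

definition type_pres :: "(ty \<Rightarrow> nat \<Rightarrow> tm) \<Rightarrow> bool" where
  "type_pres \<sigma> \<longleftrightarrow> (\<forall>T i. type_of (\<sigma> T i) = T)"

lemma type_presD [simp]: "type_pres \<sigma> \<Longrightarrow> type_of (\<sigma> T i) = T"
  by (simp add: type_pres_def)

lemma type_of_tsub [simp]: "type_pres \<sigma> \<Longrightarrow> type_of (tsub \<sigma> t) = type_of t"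
  by (cases t) auto

lemma type_pres_Var [simp]: "type_pres Var"
  and type_pres_shift [simp]: "type_pres (shift T)"
  and type_pres_inst [simp]: "type_pres (inst T t) \<longleftrightarrow> type_of t = T"
  and type_pres_repl [simp]: "type_of t = T \<Longrightarrow> type_pres (repl T i t)"
  and type_pres_bind [simp]: "type_pres (bind T i)"
  by (auto simp: type_pres_def shift_def inst_def repl_def bind_def split: nat.split)

lemma type_pres_under [simp]: "type_pres \<sigma> \<Longrightarrow> type_pres (under T \<sigma>)"
  by (auto simp: type_pres_def under_def type_of_tsub[unfolded type_pres_def]
      type_pres_shift[unfolded type_pres_def] split: nat.split)

lemma type_pres_comp [simp]:
  "type_pres \<sigma> \<Longrightarrow> type_pres \<tau> \<Longrightarrow> type_pres (\<lambda>T i. tsub \<sigma> (\<tau> T i))"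
  by (simp add: type_pres_def type_of_tsub[unfolded type_pres_def])

lemma tsub_tsub [simp]: "tsub \<sigma> (tsub \<tau> t) = tsub (\<lambda>T i. tsub \<sigma> (\<tau> T i)) t"
  by (cases t) auto

lemma tsub_Var [simp]: "tsub Var t = t"
  by (cases t) auto

lemma tsub_cong: "(\<And>T i. (T, i) \<in> fv_tm t \<Longrightarrow> \<sigma> T i = \<tau> T i) \<Longrightarrow> tsub \<sigma> t = tsub \<tau> t"
  by (cases t) auto

lemma asub_asub [simp]: "asub \<sigma> (asub \<tau> a) = asub (\<lambda>T i. tsub \<sigma> (\<tau> T i)) a"
  by (cases a) auto

lemma asub_cong: "(\<And>T i. (T, i) \<in> fv_atom a \<Longrightarrow> \<sigma> T i = \<tau> T i) \<Longrightarrow> asub \<sigma> a = asub \<tau> a"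
  by (cases a) (auto intro!: tsub_cong)

lemma under_comp: "(\<lambda>T' i. tsub (under T \<sigma>) (under T \<tau> T' i)) = under T (\<lambda>T i. tsub \<sigma> (\<tau> T i))"
proof (intro ext)
  fix T' i
  have *: "(\<lambda>T' i. tsub (under T \<sigma>) (shift T T' i)) = (\<lambda>T' i. tsub (shift T) (\<sigma> T' i))"
    by (intro ext) (auto simp: under_def shift_def)
  show "tsub (under T \<sigma>) (under T \<tau> T' i) = under T (\<lambda>T i. tsub \<sigma> (\<tau> T i)) T' i"
    by (auto simp: under_def[of T \<tau>] under_def[of T "\<lambda>T i. tsub \<sigma> (\<tau> T i)"] *
        under_def[of T \<sigma> T 0] split: nat.split)
qed

lemma fsub_fsub [simp]: "fsub \<sigma> (fsub \<tau> \<phi>) = fsub (\<lambda>T i. tsub \<sigma> (\<tau> T i)) \<phi>"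
  by (induction \<phi> arbitrary: \<sigma> \<tau>) (auto simp: under_comp)

lemma under_Var [simp]: "under T Var = Var"
  by (intro ext) (auto simp: under_def shift_def split: nat.split)

lemma asub_Var [simp]: "asub Var a = a"
  by (cases a) auto

lemma fsub_Var [simp]: "fsub Var \<phi> = \<phi>"
  by (induction \<phi>) auto

lemma under_cong:
  assumes "\<And>T' i. (T', i) \<in> outer_vars T A \<Longrightarrow> \<sigma> T' i = \<tau> T' i" and "(T', i) \<in> A"
  shows "under T \<sigma> T' i = under T \<tau> T' i"
proof -
  have "T' \<noteq> T \<Longrightarrow> \<sigma> T' i = \<tau> T' i" and "T' = T \<Longrightarrow> i = Suc j \<Longrightarrow> \<sigma> T j = \<tau> T j" for j
    using assms by (auto simp: outer_vars_def)
  then show ?thesis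
    by (auto simp: under_def split: nat.split)
qed

lemma fsub_cong: "(\<And>T i. (T, i) \<in> fv \<phi> \<Longrightarrow> \<sigma> T i = \<tau> T i) \<Longrightarrow> fsub \<sigma> \<phi> = fsub \<tau> \<phi>"
proof (induction \<phi> arbitrary: \<sigma> \<tau>)
  case (Atom a)
  then show ?case by (auto intro: asub_cong)
next
  case (And \<phi> \<psi>)
  from And.IH(1)[OF And.prems] And.IH(2)[OF And.prems] show ?case by simp
next
  case (Or \<phi> \<psi>)
  from Or.IH(1)[OF Or.prems] Or.IH(2)[OF Or.prems] show ?case by simp
next
  case (Imp \<phi> \<psi>)
  from Imp.IH(1)[OF Imp.prems] Imp.IH(2)[OF Imp.prems] show ?case by simp
next
  case (All T \<phi>)
  have "fsub (under T \<sigma>) \<phi> = fsub (under T \<tau>) \<phi>"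
    by (rule All.IH, rule under_cong[of T "fv \<phi>"], rule All.prems) simp_all
  then show ?case by simp
next
  case (Ex T \<phi>)
  have "fsub (under T \<sigma>) \<phi> = fsub (under T \<tau>) \<phi>"
    by (rule Ex.IH, rule under_cong[of T "fv \<phi>"], rule Ex.prems) simp_all
  then show ?case by simp
qed simp

lemma fsub_Neg [simp]: "fsub \<sigma> (Neg \<phi>) = Neg (fsub \<sigma> \<phi>)"
  and fsub_Iff [simp]: "fsub \<sigma> (\<phi> \<^bold>\<longleftrightarrow> \<psi>) = (fsub \<sigma> \<phi> \<^bold>\<longleftrightarrow> fsub \<sigma> \<psi>)"
  and wff_Neg [simp]: "wff n (Neg \<phi>) \<longleftrightarrow> wff n \<phi>"
  and wff_Iff [simp]: "wff n (\<phi> \<^bold>\<longleftrightarrow> \<psi>) \<longleftrightarrow> wff n \<phi> \<and> wff n \<psi>"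
  by (auto simp: Neg_def Iff_def)

lemma wf_atom_asub [simp]: "type_pres \<sigma> \<Longrightarrow> wf_atom n (asub \<sigma> a) \<longleftrightarrow> wf_atom n a"
  by (cases a) auto

lemma wff_fsub [simp]: "type_pres \<sigma> \<Longrightarrow> wff n (fsub \<sigma> \<phi>) \<longleftrightarrow> wff n \<phi>"
  by (induction \<phi> arbitrary: \<sigma>) auto

text \<open>Collapses the instantiation of a substituted quantifier body to one substitution, in the
  shape that matches an assignment extended by \<open>push\<close>.\<close>

lemma inst_under: "(\<lambda>T' i. tsub (inst T t) (under T \<sigma> T' i)) =
    (\<lambda>T' i. if T' = T then (case i of 0 \<Rightarrow> t | Suc j \<Rightarrow> \<sigma> T j) else \<sigma> T' i)"
proof -
  have "(\<lambda>T' i. tsub (inst T t) (shift T T' i)) = Var"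
    by (intro ext) (auto simp: inst_def shift_def)
  then show ?thesis
    by (intro ext) (auto simp: under_def inst_def split: nat.split)
qed

lemma inst_under_shift: "fsub (inst T (Var T 0)) (fsub (under T (shift T)) \<phi>) = \<phi>"
proof -
  have "(\<lambda>T' i. if T' = T then (case i of 0 \<Rightarrow> Var T 0 | Suc j \<Rightarrow> shift T T j) else shift T T' i) = Var"
    by (intro ext) (auto simp: shift_def split: nat.split)
  then show ?thesis by (simp add: inst_under)
qed

lemma finite_outer_vars: "finite A \<Longrightarrow> finite (outer_vars T A)"
proof -
  assume "finite A"
  moreover have "inj (\<lambda>(T', i). (T', if T' = T then Suc i else i))"
    by (auto simp: inj_on_def split: if_splits)
  moreover have "outer_vars T A = (\<lambda>(T', i). (T', if T' = T then Suc i else i)) -` A"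
    by (auto simp: outer_vars_def)
  ultimately show ?thesis by (simp add: finite_vimageI)
qed

lemma finite_fv [simp]: "finite (fv \<phi>)"
proof (induction \<phi>)
  case (Atom a)
  have "finite (fv_tm t)" for t by (cases t) auto
  then show ?case by (cases a) auto
qed (auto intro: finite_outer_vars)

lemma ty_le_fv: "wff n \<phi> \<Longrightarrow> (T, i) \<in> fv \<phi> \<Longrightarrow> ty_le T n"
proof (induction \<phi> arbitrary: T i)
  case (Atom a)
  have "(T, i) \<in> fv_tm t \<Longrightarrow> type_of t = T" for t by (cases t) auto
  with Atom show ?case by (cases a) auto
qed (auto simp: outer_vars_def)


section \<open>Derivability in classical BT\<close>

lemma BT_wff: "BT cl s \<phi> \<Longrightarrow> wff s \<phi>"
  by (induction rule: BT.induct) auto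

lemma BT_triv: assumes "wff s \<phi>" shows "BT cl s (\<phi> \<^bold>\<longrightarrow> \<phi>)"
proof -
  let ?a = "\<phi> \<^bold>\<longrightarrow> \<phi>"
  have "BT cl s ((\<phi> \<^bold>\<longrightarrow> ?a \<^bold>\<longrightarrow> \<phi>) \<^bold>\<longrightarrow> (\<phi> \<^bold>\<longrightarrow> ?a) \<^bold>\<longrightarrow> \<phi> \<^bold>\<longrightarrow> \<phi>)"
    and "BT cl s (\<phi> \<^bold>\<longrightarrow> ?a \<^bold>\<longrightarrow> \<phi>)" and "BT cl s (\<phi> \<^bold>\<longrightarrow> ?a)"
    by (rule BT.propositional, auto intro: ipl_axiom.intros simp: assms)+
  then show ?thesis by (rule BT.mp[OF BT.mp])
qed

lemma BT_weaken: assumes "BT cl s \<phi>" "wff s \<theta>" shows "BT cl s (\<theta> \<^bold>\<longrightarrow> \<phi>)"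
  by (rule BT.mp[OF BT.propositional assms(1)])
    (auto intro: ipl_axiom.intros simp: assms BT_wff[OF assms(1)])

lemma BT_mp: assumes "BT cl s (\<theta> \<^bold>\<longrightarrow> \<phi> \<^bold>\<longrightarrow> \<psi>)" "BT cl s (\<theta> \<^bold>\<longrightarrow> \<phi>)" shows "BT cl s (\<theta> \<^bold>\<longrightarrow> \<psi>)"
  by (rule BT.mp[OF BT.mp[OF BT.propositional assms(1)] assms(2)])
    (use BT_wff[OF assms(1)] in \<open>auto intro: ipl_axiom.intros\<close>)

lemma BT_trans: assumes "BT cl s (\<theta> \<^bold>\<longrightarrow> \<phi>)" "BT cl s (\<phi> \<^bold>\<longrightarrow> \<psi>)" shows "BT cl s (\<theta> \<^bold>\<longrightarrow> \<psi>)"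
proof -
  have "wff s \<theta>" using BT_wff[OF assms(1)] by simp
  from BT_mp[OF BT_weaken[OF assms(2) this] assms(1)] show ?thesis .
qed

lemma BT_conjI:
  assumes "BT cl s (\<theta> \<^bold>\<longrightarrow> \<phi>)" "BT cl s (\<theta> \<^bold>\<longrightarrow> \<psi>)" shows "BT cl s (\<theta> \<^bold>\<longrightarrow> (\<phi> \<^bold>\<and> \<psi>))"
proof -
  have w: "wff s \<theta>" "wff s \<phi>" "wff s \<psi>" using BT_wff[OF assms(1)] BT_wff[OF assms(2)] by auto
  have "BT cl s (\<phi> \<^bold>\<longrightarrow> \<psi> \<^bold>\<longrightarrow> (\<phi> \<^bold>\<and> \<psi>))"
    by (rule BT.propositional) (auto intro: ipl_axiom.intros simp: w)
  from BT_mp[OF BT_trans[OF assms(1) this] assms(2)] show ?thesis .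
qed

lemma BT_conjE:
  assumes "wff s \<phi>" "wff s \<psi>"
  shows "BT cl s ((\<phi> \<^bold>\<and> \<psi>) \<^bold>\<longrightarrow> \<phi>)" "BT cl s ((\<phi> \<^bold>\<and> \<psi>) \<^bold>\<longrightarrow> \<psi>)"
  by (rule BT.propositional, auto intro: ipl_axiom.intros simp: assms)+

lemma BT_curry: assumes "BT cl s ((\<theta> \<^bold>\<and> \<phi>) \<^bold>\<longrightarrow> \<psi>)" shows "BT cl s (\<theta> \<^bold>\<longrightarrow> \<phi> \<^bold>\<longrightarrow> \<psi>)"
proof -
  have w: "wff s \<theta>" "wff s \<phi>" "wff s \<psi>" using BT_wff[OF assms(1)] by auto
  have "BT cl s (\<theta> \<^bold>\<longrightarrow> (\<phi> \<^bold>\<longrightarrow> (\<theta> \<^bold>\<and> \<phi>)))"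
    by (rule BT.propositional) (auto intro: ipl_axiom.intros simp: w)
  moreover have "BT cl s ((\<phi> \<^bold>\<longrightarrow> (\<theta> \<^bold>\<and> \<phi>) \<^bold>\<longrightarrow> \<psi>) \<^bold>\<longrightarrow> (\<phi> \<^bold>\<longrightarrow> (\<theta> \<^bold>\<and> \<phi>)) \<^bold>\<longrightarrow> \<phi> \<^bold>\<longrightarrow> \<psi>)"
    by (rule BT.propositional) (auto intro: ipl_axiom.intros simp: w)
  ultimately show ?thesis
    using BT.mp[OF _ BT_weaken[OF assms w(2)]] BT_trans by blast
qed

lemma BT_gen: assumes "BT cl s \<phi>" "ty_le T s" shows "BT cl s (All T \<phi>)"
proof -
  \<comment> \<open>The rule introduces a quantifier only in the conclusion of an implication, so a
    derivable dummy premise is supplied.\<close>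
  have "BT cl s (lift T (Bot \<^bold>\<longrightarrow> Bot) \<^bold>\<longrightarrow> \<phi>)"
    by (rule BT_weaken) (auto simp: assms)
  from BT.all_intro[OF this assms(2)] show ?thesis
    by (rule BT.mp) (rule BT_triv, simp)
qed

lemma BT_inst:
  assumes "BT cl s \<phi>" "ty_le T s" "type_of t = T" shows "BT cl s (fsub (inst T t) \<phi>)"
  by (rule BT.mp[OF BT.all_elim BT_gen]) (use assms BT_wff in auto)

text \<open>A simultaneous substitution in the variables of one type is a composition of
  instantiations, because a term of type \<open>T\<close> contains no variables of other types.\<close>

lemma BT_fsub_type:
  assumes "ty_le T s" "type_pres \<sigma>" "\<And>T' i. T' \<noteq> T \<Longrightarrow> \<sigma> T' i = Var T' i"
    and "\<And>i. N \<le> i \<Longrightarrow> \<sigma> T i = Var T (i - N)" and "BT cl s \<phi>"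
  shows "BT cl s (fsub \<sigma> \<phi>)"
  using assms(2-)
proof (induction N arbitrary: \<sigma> \<phi>)
  case 0
  then have "\<sigma> = Var"
    by (intro ext) (metis diff_zero le0)
  then show ?case using 0 by simp
next
  case (Suc N)
  define \<tau> where "\<tau> = (\<lambda>T' i. if T' = T then \<sigma> T (Suc i) else Var T' i)"
  \<comment> \<open>Afterwards \<tau> lowers indices from N on by N. Raising the index of the
    variable \<sigma> T 0 by N beforehand cancels this.\<close>
  define t where "t = (case \<sigma> T 0 of Var T' j \<Rightarrow> Var T' (j + N) | c \<Rightarrow> c)"
  have ty: "type_of (\<sigma> T 0) = T" using Suc.prems by simp
  then have "type_of t = T"
    by (cases "\<sigma> T 0") (auto simp: t_def)
  then have "BT cl s (fsub (inst T t) \<phi>)"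
    using Suc.prems BT_inst assms(1) by blast
  moreover have "type_pres \<tau>"
    using Suc.prems by (auto simp: \<tau>_def type_pres_def)
  ultimately have *: "BT cl s (fsub \<tau> (fsub (inst T t) \<phi>))"
    using Suc.prems by (intro Suc.IH[of \<tau> "fsub (inst T t) \<phi>"]) (auto simp: \<tau>_def)
  have "tsub \<tau> t = \<sigma> T 0"
    using ty Suc.prems(3)[of "Suc (_ + N)"]
    by (cases "\<sigma> T 0") (auto simp: t_def \<tau>_def)
  then have "(\<lambda>T' i. tsub \<tau> (inst T t T' i)) = \<sigma>"
    using Suc.prems(2) by (intro ext) (auto simp: inst_def \<tau>_def split: nat.split)
  with * show ?case by simp
qed

text \<open>Axioms are stated for variables, while the term model evaluates formulas under
  substitutions into terms; closure under type-preserving substitution connects the two. The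
  finitely many types that occur free in \<phi> are treated one after another.\<close>

lemma BT_fsub:
  assumes "type_pres \<sigma>" "BT cl s \<phi>" shows "BT cl s (fsub \<sigma> \<phi>)"
proof -
  obtain N where N: "\<And>T i. (T, i) \<in> fv \<phi> \<Longrightarrow> i < N"
  proof -
    have "finite (snd ` fv \<phi>)" by simp
    then obtain N where "\<forall>i\<in>snd ` fv \<phi>. i < N"
      by (metis finite_nat_set_iff_bounded)
    then show ?thesis using that by (metis image_eqI snd_conv)
  qed
  \<comment> \<open>All free indices of \<phi> are below N, so the values from N on do not affect
    \<phi>; they are chosen to fit the hypothesis of \<open>BT_fsub_type\<close>.\<close>
  define \<rho> where "\<rho> A = (\<lambda>T i. if T \<in> A then (if i < N then \<sigma> T i else Var T (i - N)) else Var T i)" for A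
  have tp: "type_pres (\<rho> A)" for A
    using assms(1) by (auto simp: \<rho>_def type_pres_def)
  have "finite A \<Longrightarrow> (\<And>T. T \<in> A \<Longrightarrow> ty_le T s) \<Longrightarrow> BT cl s (fsub (\<rho> A) \<phi>)" for A
  proof (induction A rule: finite_induct)
    case empty
    have "\<rho> {} = Var" by (simp add: \<rho>_def)
    then show ?case using assms(2) by simp
  next
    case (insert T A)
    have "BT cl s (fsub (\<rho> {T}) (fsub (\<rho> A) \<phi>))"
      using insert tp[of "{T}", unfolded \<rho>_def]
      by (intro BT_fsub_type[where N = N and T = T and \<sigma> = "\<rho> {T}" and \<phi> = "fsub (\<rho> A) \<phi>"])
        (auto simp: \<rho>_def[of "{T}" for T])
    moreover have "tsub (\<rho> {T}) (\<rho> A T' i) = \<rho> (insert T A) T' i" for T' i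
    proof (cases "T' = T")
      case True
      then have "\<rho> A T' i = Var T i" using insert by (simp add: \<rho>_def)
      then show ?thesis using True by (simp add: \<rho>_def)
    next
      case False
      then have "type_of (\<rho> A T' i) \<noteq> T" using tp by simp
      then have "tsub (\<rho> {T}) (\<rho> A T' i) = \<rho> A T' i"
        by (cases "\<rho> A T' i") (auto simp: \<rho>_def)
      then show ?thesis using False by (simp add: \<rho>_def)
    qed
    ultimately show ?case by simp
  qed
  from this[of "fst ` fv \<phi>"] have "BT cl s (fsub (\<rho> (fst ` fv \<phi>)) \<phi>)"
    using ty_le_fv[OF BT_wff[OF assms(2)]] by fastforce
  moreover have "fsub (\<rho> (fst ` fv \<phi>)) \<phi> = fsub \<sigma> \<phi>"
    by (rule fsub_cong) (auto simp: \<rho>_def N intro: image_eqI[rotated])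
  ultimately show ?thesis by simp
qed

text \<open>The rule with a named eigenvariable: renaming y to the bound index by
  \<open>bind\<close> undoes the instantiation in \<psi> and acts as a shift on \<phi>, since y is
  fresh for both.\<close>

lemma BT_ex_elim_fresh:
  assumes "BT cl s (fsub (inst T (Var T y)) \<psi> \<^bold>\<longrightarrow> \<phi>)" "ty_le T s"
    and "(T, y) \<notin> fv (Ex T \<psi>)" "(T, y) \<notin> fv \<phi>"
  shows "BT cl s (Ex T \<psi> \<^bold>\<longrightarrow> \<phi>)"
proof -
  have "fsub (bind T y) \<phi> = lift T \<phi>"
    using assms(4) by (intro fsub_cong) (auto simp: bind_def shift_def)
  moreover have "fsub (bind T y) (fsub (inst T (Var T y)) \<psi>) = fsub Var \<psi>"
    unfolding fsub_fsub
    using assms(3) by (intro fsub_cong) (auto simp: bind_def inst_def outer_vars_def split: nat.split)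
  ultimately have "BT cl s (\<psi> \<^bold>\<longrightarrow> lift T \<phi>)"
    using BT_fsub[OF type_pres_bind assms(1), of T y] by simp
  then show ?thesis using assms(2) by (rule BT.ex_elim)
qed

section \<open>Completeness\<close>

lemma BT_dne: assumes "wff s \<phi>" shows "BT True s (Neg (Neg \<phi>) \<^bold>\<longrightarrow> \<phi>)"
proof -
  let ?n = "Neg (Neg \<phi>)"
  have 1: "BT True s (\<phi> \<^bold>\<longrightarrow> ?n \<^bold>\<longrightarrow> \<phi>)"
    by (rule BT.propositional) (auto intro: ipl_axiom.intros simp: assms)
  have w: "wff s (Neg \<phi>)" "wff s ?n" using assms by auto
  have "BT True s ((Neg \<phi> \<^bold>\<and> ?n) \<^bold>\<longrightarrow> Bot)"
    using BT_mp[OF BT_conjE(2)[OF w, unfolded Neg_def[of "Neg \<phi>"]]]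
      BT_conjE(1)[OF w] unfolding Neg_def[of "Neg \<phi>"] by blast
  moreover have "BT True s (Bot \<^bold>\<longrightarrow> \<phi>)"
    by (rule BT.propositional) (auto intro: ipl_axiom.intros simp: assms)
  ultimately have 2: "BT True s (Neg \<phi> \<^bold>\<longrightarrow> ?n \<^bold>\<longrightarrow> \<phi>)"
    by (rule BT_curry[OF BT_trans])
  have "BT True s ((\<phi> \<^bold>\<longrightarrow> ?n \<^bold>\<longrightarrow> \<phi>) \<^bold>\<longrightarrow> (Neg \<phi> \<^bold>\<longrightarrow> ?n \<^bold>\<longrightarrow> \<phi>) \<^bold>\<longrightarrow> (\<phi> \<^bold>\<or> Neg \<phi>) \<^bold>\<longrightarrow> ?n \<^bold>\<longrightarrow> \<phi>)"
    by (rule BT.propositional) (auto intro: ipl_axiom.intros simp: assms)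
  from BT.mp[OF BT.mp[OF BT.mp[OF this 1] 2] BT.classical] show ?thesis using assms by simp
qed

text \<open>Reduces the universal quantifier to the existential one, so that Henkin sets need
  witnesses for existential formulas only.\<close>

lemma BT_not_ex: assumes "wff s (All T \<eta>)"
  shows "BT True s (Neg (Ex T (Neg \<eta>)) \<^bold>\<longrightarrow> All T \<eta>)"
proof (rule BT.all_intro)
  let ?E = "lift T (Ex T (Neg \<eta>))"
  have w: "wff s ?E" "wff s \<eta>" "ty_le T s" using assms by auto
  have "wff s (Ex T (fsub (under T (shift T)) (Neg \<eta>)))" using w by simp
  from BT.ex_intro[OF this, of "Var T 0" True]
  have 1: "BT True s (Neg \<eta> \<^bold>\<longrightarrow> ?E)" by (simp only: inst_under_shift fsub.simps type_of.simps)
  have w': "wff s (Neg ?E)" "wff s (Neg \<eta>)" using w by auto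
  have "BT True s ((Neg ?E \<^bold>\<and> Neg \<eta>) \<^bold>\<longrightarrow> Bot)"
    using BT_mp[OF BT_conjE(1)[OF w', unfolded Neg_def[of ?E]]]
      BT_trans[OF BT_conjE(2)[OF w'] 1] unfolding Neg_def[of ?E] by blast
  then have "BT True s (Neg ?E \<^bold>\<longrightarrow> Neg (Neg \<eta>))"
    unfolding Neg_def[of "Neg \<eta>"] by (rule BT_curry)
  then have "BT True s (Neg ?E \<^bold>\<longrightarrow> \<eta>)"
    by (rule BT_trans) (rule BT_dne, rule w)
  then show "BT True s (lift T (Neg (Ex T (Neg \<eta>))) \<^bold>\<longrightarrow> \<eta>)" by simp
qed (use assms in auto)

subsection \<open>Henkin sets\<close>

text \<open>Witnesses are variables rather than new constants: each formula has finitely many free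
  variables, so fresh ones never run out and the language stays fixed.\<close>

locale henkin =
  fixes s :: nat and H :: "bfm set"
  assumes H_wff: "\<chi> \<in> H \<Longrightarrow> wff s \<chi>"
    and H_thm: "BT True s \<chi> \<Longrightarrow> \<chi> \<in> H"
    and H_mp: "(\<phi> \<^bold>\<longrightarrow> \<psi>) \<in> H \<Longrightarrow> \<phi> \<in> H \<Longrightarrow> \<psi> \<in> H"
    and H_Bot: "Bot \<notin> H"
    and H_max: "wff s \<chi> \<Longrightarrow> \<chi> \<in> H \<or> Neg \<chi> \<in> H"
    and H_wit: "Ex T \<eta> \<in> H \<Longrightarrow> \<exists>y. fsub (inst T (Var T y)) \<eta> \<in> H"
begin

lemma H_ax: "ipl_axiom \<phi> \<Longrightarrow> wff s \<phi> \<Longrightarrow> \<phi> \<in> H"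
  by (rule H_thm, rule BT.propositional)

lemma H_Neg: "wff s \<phi> \<Longrightarrow> Neg \<phi> \<in> H \<longleftrightarrow> \<phi> \<notin> H"
  using H_mp[of \<phi> Bot] H_Bot H_max[of \<phi>] by (auto simp: Neg_def)

lemma H_And: "(\<phi> \<^bold>\<and> \<psi>) \<in> H \<longleftrightarrow> \<phi> \<in> H \<and> \<psi> \<in> H"
proof
  assume *: "(\<phi> \<^bold>\<and> \<psi>) \<in> H"
  then have "wff s \<phi>" "wff s \<psi>" using H_wff by fastforce+
  then show "\<phi> \<in> H \<and> \<psi> \<in> H"
    using H_mp[OF H_thm *] BT_conjE by blast
next
  assume *: "\<phi> \<in> H \<and> \<psi> \<in> H"
  have "(\<phi> \<^bold>\<longrightarrow> \<psi> \<^bold>\<longrightarrow> (\<phi> \<^bold>\<and> \<psi>)) \<in> H"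
    by (rule H_ax) (use * H_wff in \<open>auto intro: ipl_axiom.intros\<close>)
  then show "(\<phi> \<^bold>\<and> \<psi>) \<in> H" using * H_mp by blast
qed

lemma H_Imp: assumes "wff s (\<phi> \<^bold>\<longrightarrow> \<psi>)" shows "(\<phi> \<^bold>\<longrightarrow> \<psi>) \<in> H \<longleftrightarrow> (\<phi> \<in> H \<longrightarrow> \<psi> \<in> H)"
proof
  assume *: "\<phi> \<in> H \<longrightarrow> \<psi> \<in> H"
  have w: "wff s \<phi>" "wff s \<psi>" using assms by auto
  show "(\<phi> \<^bold>\<longrightarrow> \<psi>) \<in> H"
  proof (cases "\<phi> \<in> H")
    case True
    have "(\<psi> \<^bold>\<longrightarrow> \<phi> \<^bold>\<longrightarrow> \<psi>) \<in> H"
      by (rule H_ax) (use w in \<open>auto intro: ipl_axiom.intros\<close>)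
    then show ?thesis using True * H_mp by blast
  next
    case False
    then have "Neg \<phi> \<in> H" using w by (simp add: H_Neg)
    moreover have "BT True s (Neg \<phi> \<^bold>\<longrightarrow> \<phi> \<^bold>\<longrightarrow> \<psi>)"
    proof (rule BT_curry, rule BT_trans)
      have "wff s (Neg \<phi>)" using w by simp
      from BT_mp[OF BT_conjE(1)[OF this w(1), unfolded Neg_def] BT_conjE(2)[OF this[unfolded Neg_def] w(1)]]
      show "BT True s ((Neg \<phi> \<^bold>\<and> \<phi>) \<^bold>\<longrightarrow> Bot)" by (simp add: Neg_def)
      show "BT True s (Bot \<^bold>\<longrightarrow> \<psi>)"
        by (rule BT.propositional) (use w in \<open>auto intro: ipl_axiom.intros\<close>)
    qed
    ultimately show ?thesis using H_mp H_thm by blast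
  qed
qed (use H_mp in blast)

lemma H_Or: assumes "wff s (\<phi> \<^bold>\<or> \<psi>)" shows "(\<phi> \<^bold>\<or> \<psi>) \<in> H \<longleftrightarrow> \<phi> \<in> H \<or> \<psi> \<in> H"
proof
  have w: "wff s \<phi>" "wff s \<psi>" using assms by auto
  {
    assume "\<phi> \<in> H \<or> \<psi> \<in> H"
    moreover have "(\<phi> \<^bold>\<longrightarrow> (\<phi> \<^bold>\<or> \<psi>)) \<in> H" "(\<psi> \<^bold>\<longrightarrow> (\<phi> \<^bold>\<or> \<psi>)) \<in> H"
      by (rule H_ax; use w in \<open>auto intro: ipl_axiom.intros\<close>)+
    ultimately show "(\<phi> \<^bold>\<or> \<psi>) \<in> H" using H_mp by blast
  }
  assume *: "(\<phi> \<^bold>\<or> \<psi>) \<in> H"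
  show "\<phi> \<in> H \<or> \<psi> \<in> H"
  proof (rule ccontr)
    assume "\<not> ?thesis"
    then have "(\<phi> \<^bold>\<longrightarrow> Bot) \<in> H" "(\<psi> \<^bold>\<longrightarrow> Bot) \<in> H" using w by (simp_all add: H_Imp)
    moreover have "((\<phi> \<^bold>\<longrightarrow> Bot) \<^bold>\<longrightarrow> (\<psi> \<^bold>\<longrightarrow> Bot) \<^bold>\<longrightarrow> (\<phi> \<^bold>\<or> \<psi>) \<^bold>\<longrightarrow> Bot) \<in> H"
      by (rule H_ax) (use w in \<open>auto intro: ipl_axiom.intros\<close>)
    ultimately show False using * H_mp H_Bot by blast
  qed
qed

lemma H_Ex: assumes "wff s (Ex T \<eta>)"
  shows "Ex T \<eta> \<in> H \<longleftrightarrow> (\<exists>t. type_of t = T \<and> fsub (inst T t) \<eta> \<in> H)"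
proof
  show "\<exists>t. type_of t = T \<and> fsub (inst T t) \<eta> \<in> H" if "Ex T \<eta> \<in> H"
    using H_wit[OF that] type_of.simps(1) by blast
  show "Ex T \<eta> \<in> H" if "\<exists>t. type_of t = T \<and> fsub (inst T t) \<eta> \<in> H"
    using that H_mp[OF H_thm[OF BT.ex_intro[OF assms]]] by blast
qed

lemma H_All: assumes "wff s (All T \<eta>)"
  shows "All T \<eta> \<in> H \<longleftrightarrow> (\<forall>t. type_of t = T \<longrightarrow> fsub (inst T t) \<eta> \<in> H)"
proof
  assume "All T \<eta> \<in> H"
  then show "\<forall>t. type_of t = T \<longrightarrow> fsub (inst T t) \<eta> \<in> H"
    using H_mp[OF H_thm[OF BT.all_elim[OF assms]]] by fastforce
next
  assume *: "\<forall>t. type_of t = T \<longrightarrow> fsub (inst T t) \<eta> \<in> H"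
  have w: "wff s (Ex T (Neg \<eta>))" using assms by simp
  have "Ex T (Neg \<eta>) \<notin> H"
    using * w by (subst H_Ex) (auto simp: H_Neg)
  then have "Neg (Ex T (Neg \<eta>)) \<in> H" using w by (simp add: H_Neg)
  then show "All T \<eta> \<in> H" using H_mp H_thm BT_not_ex[OF assms] by blast
qed

end

definition consistent :: "nat \<Rightarrow> bfm \<Rightarrow> bool" where
  "consistent s \<theta> \<longleftrightarrow> wff s \<theta> \<and> \<not> BT True s (Neg \<theta>)"

text \<open>A stage of the Lindenbaum construction is a single formula, so that derivability from a
  stage is derivability of an implication and no deduction theorem is needed. An existential formula
  is added together with its witness; ill-formed formulas are skipped because
  \<open>consistent\<close> includes well-formedness.\<close>

definition extend :: "nat \<Rightarrow> bfm \<Rightarrow> bfm \<Rightarrow> bfm" where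
  "extend s \<theta> \<chi> = (if consistent s (\<theta> \<^bold>\<and> \<chi>) then
     (case \<chi> of Ex T \<eta> \<Rightarrow>
        \<theta> \<^bold>\<and> \<chi> \<^bold>\<and> fsub (inst T (Var T (SOME y. (T, y) \<notin> fv \<theta> \<union> fv \<chi>))) \<eta>
      | _ \<Rightarrow> \<theta> \<^bold>\<and> \<chi>)
     else \<theta>)"

text \<open>If the stage with the witness \<eta>' were refutable, \<eta>' would imply the negation
  of \<theta> and \<chi>. As y is fresh, already \<chi> would imply it, and the conjunction of
  \<theta> and \<chi> would be refutable.\<close>

lemma consistent_extend: assumes "consistent s \<theta>" shows "consistent s (extend s \<theta> \<chi>)"
proof (cases "consistent s (\<theta> \<^bold>\<and> \<chi>) \<and> (\<exists>T \<eta>. \<chi> = Ex T \<eta>)")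
  case False
  then show ?thesis using assms by (auto simp: extend_def split: fm.split)
next
  case True
  then obtain T \<eta> where \<chi>: "\<chi> = Ex T \<eta>" and c: "consistent s (\<theta> \<^bold>\<and> \<chi>)" by blast
  define y where "y = (SOME y. (T, y) \<notin> fv \<theta> \<union> fv \<chi>)"
  define \<eta>' where "\<eta>' = fsub (inst T (Var T y)) \<eta>"
  have "finite (Pair T -` (fv \<theta> \<union> fv \<chi>))" by (intro finite_vimageI) (auto simp: inj_on_def)
  then have "\<exists>y. y \<notin> Pair T -` (fv \<theta> \<union> fv \<chi>)" by (rule ex_new_if_finite[OF infinite_UNIV_nat])
  then have y: "(T, y) \<notin> fv \<theta> \<union> fv \<chi>" unfolding y_def by (metis (no_types, lifting) someI vimageI)
  have w: "wff s \<theta>" "wff s \<chi>" "wff s \<eta>'" "ty_le T s"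
    using c by (auto simp: consistent_def \<chi> \<eta>'_def)
  have e: "extend s \<theta> \<chi> = (\<theta> \<^bold>\<and> \<chi> \<^bold>\<and> \<eta>')"
    using c by (simp add: extend_def \<chi> y_def \<eta>'_def)
  have "\<not> BT True s (Neg (\<theta> \<^bold>\<and> \<chi> \<^bold>\<and> \<eta>'))"
  proof
    assume n: "BT True s (Neg (\<theta> \<^bold>\<and> \<chi> \<^bold>\<and> \<eta>'))"
    have w': "wff s (\<theta> \<^bold>\<and> \<chi>)" using w by simp
    note c = BT_conjE[OF w(3) w']
    have "BT True s ((\<eta>' \<^bold>\<and> \<theta> \<^bold>\<and> \<chi>) \<^bold>\<longrightarrow> (\<theta> \<^bold>\<and> \<chi> \<^bold>\<and> \<eta>'))"
      using c(1) BT_trans[OF c(2) BT_conjE(1)[OF w(1,2)]] BT_trans[OF c(2) BT_conjE(2)[OF w(1,2)]]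
      by (intro BT_conjI)
    from BT_curry[OF BT_trans[OF this n[unfolded Neg_def]]]
    have "BT True s (\<eta>' \<^bold>\<longrightarrow> Neg (\<theta> \<^bold>\<and> \<chi>))" unfolding Neg_def .
    then have "BT True s (\<chi> \<^bold>\<longrightarrow> Neg (\<theta> \<^bold>\<and> \<chi>))"
      unfolding \<chi> \<eta>'_def by (rule BT_ex_elim_fresh) (use w y \<chi> in \<open>auto simp: Neg_def\<close>)
    from BT_trans[OF BT_conjE(2)[OF w(1,2)] this[unfolded Neg_def]]
    have "BT True s (Neg (\<theta> \<^bold>\<and> \<chi>))"
      unfolding Neg_def by (rule BT_mp) (rule BT_triv[OF w'])
    then show False using \<open>consistent s (\<theta> \<^bold>\<and> \<chi>)\<close> by (simp add: consistent_def)
  qed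
  then show ?thesis using w by (simp add: e consistent_def)
qed

text \<open>The Goedel numbering serves as enumeration of all formulas. At numbers that code no
  formula \<open>inv\<close> returns an arbitrary one, which \<open>extend\<close> may process
  without harm.\<close>

primrec chain :: "nat \<Rightarrow> bfm \<Rightarrow> nat \<Rightarrow> bfm" where
  "chain s \<theta> 0 = \<theta>"
| "chain s \<theta> (Suc n) = extend s (chain s \<theta> n) (inv gn_fm n)"

text \<open>H consists of the consequences of the stages. Later stages imply earlier ones, so any
  two premises are available at a common stage.\<close>

lemma henkin_extension:
  assumes "consistent s \<theta>"
  obtains H where "henkin s H" "\<theta> \<in> H"
proof -
  have c: "consistent s (chain s \<theta> n)" for n
    by (induction n) (auto intro: assms consistent_extend)
  then have w: "wff s (chain s \<theta> n)" for n by (auto simp: consistent_def)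
  have ext: "BT True s (extend s \<phi> \<chi> \<^bold>\<longrightarrow> \<phi>)" if "consistent s \<phi>" for \<phi> \<chi>
  proof (cases "consistent s (\<phi> \<^bold>\<and> \<chi>)")
    case False
    then show ?thesis using that BT_triv by (auto simp: extend_def consistent_def)
  next
    case True
    then have "\<exists>\<psi>. extend s \<phi> \<chi> = (\<phi> \<^bold>\<and> \<psi>)" by (auto simp: extend_def split: fm.split)
    moreover have "wff s (extend s \<phi> \<chi>)"
      using consistent_extend[OF that] by (simp add: consistent_def)
    ultimately show ?thesis by (auto intro!: BT_conjE)
  qed
  have mono: "BT True s (chain s \<theta> n \<^bold>\<longrightarrow> chain s \<theta> m)" if "m \<le> n" for m n
    using that
  proof (induction n rule: dec_induct)
    case base
    show ?case by (rule BT_triv) (rule w)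
  next
    case (step n)
    then show ?case using BT_trans[OF ext[OF c]] by simp
  qed
  define H where "H = {\<chi>. \<exists>n. BT True s (chain s \<theta> n \<^bold>\<longrightarrow> \<chi>)}"
  have inv: "inv gn_fm (gn_fm \<chi>) = \<chi>" for \<chi>
    by (rule inv_f_f) (simp add: inj_def)
  have Bot: "Bot \<notin> H"
    using c by (auto simp: H_def consistent_def Neg_def)
  have mp: "\<psi> \<in> H" if in_H: "(\<phi> \<^bold>\<longrightarrow> \<psi>) \<in> H" "\<phi> \<in> H" for \<phi> \<psi>
  proof -
    obtain m n where *: "BT True s (chain s \<theta> m \<^bold>\<longrightarrow> \<phi> \<^bold>\<longrightarrow> \<psi>)" "BT True s (chain s \<theta> n \<^bold>\<longrightarrow> \<phi>)"
      using in_H by (auto simp: H_def)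
    have "BT True s (chain s \<theta> (max m n) \<^bold>\<longrightarrow> \<psi>)"
      by (rule BT_mp; rule BT_trans[OF mono]; (rule *)?; simp)
    then show ?thesis by (auto simp: H_def)
  qed
  \<comment> \<open>The formula with number n is treated in passing from stage n to stage n + 1:
    either it is added, with its witness if existential, or the stage already refutes it.\<close>
  have decide: "BT True s (chain s \<theta> (Suc (gn_fm \<chi>)) \<^bold>\<longrightarrow> \<chi>) \<and>
      (\<forall>T \<eta>. \<chi> = Ex T \<eta> \<longrightarrow> (\<exists>y. fsub (inst T (Var T y)) \<eta> \<in> H)) \<or> Neg \<chi> \<in> H" if "wff s \<chi>" for \<chi>
  proof -
    let ?c = "chain s \<theta> (gn_fm \<chi>)"
    show ?thesis
    proof (cases "consistent s (?c \<^bold>\<and> \<chi>)")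
      case False
      then have "BT True s (?c \<^bold>\<longrightarrow> Neg \<chi>)"
        using that w unfolding consistent_def Neg_def by (auto intro: BT_curry)
      then show ?thesis by (auto simp: H_def)
    next
      case True
      have wn: "wff s (chain s \<theta> (Suc (gn_fm \<chi>)))" by (rule w)
      show ?thesis
      proof (cases "\<exists>T \<eta>. \<chi> = Ex T \<eta>")
        case False
        then have "chain s \<theta> (Suc (gn_fm \<chi>)) = (?c \<^bold>\<and> \<chi>)"
          using True unfolding chain.simps inv by (auto simp: extend_def split: fm.split)
        then show ?thesis using False wn by (auto intro: BT_conjE)
      next
        case ex: True
        then obtain T \<eta> where \<chi>: "\<chi> = Ex T \<eta>" by blast
        have "\<exists>y. extend s ?c \<chi> = (?c \<^bold>\<and> \<chi> \<^bold>\<and> fsub (inst T (Var T y)) \<eta>)"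
          using True by (auto simp: extend_def \<chi>)
        then obtain y where e: "\<chi> = Ex T \<eta>"
          "chain s \<theta> (Suc (gn_fm \<chi>)) = (?c \<^bold>\<and> \<chi> \<^bold>\<and> fsub (inst T (Var T y)) \<eta>)"
          using \<chi> unfolding chain.simps inv by blast
        let ?i = "fsub (inst T (Var T y)) \<eta>"
        have ww: "wff s ?c" "wff s (\<chi> \<^bold>\<and> ?i)" "wff s \<chi>" "wff s ?i" using wn unfolding e(2) by auto
        have "BT True s (chain s \<theta> (Suc (gn_fm \<chi>)) \<^bold>\<longrightarrow> \<chi>)"
          "BT True s (chain s \<theta> (Suc (gn_fm \<chi>)) \<^bold>\<longrightarrow> ?i)"
          unfolding e(2) by (rule BT_trans[OF BT_conjE(2)[OF ww(1,2)]], rule BT_conjE, rule ww, rule ww)+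
        then show ?thesis using e(1) unfolding H_def by blast
      qed
    qed
  qed
  have "henkin s H"
  proof
    show "wff s \<chi>" if "\<chi> \<in> H" for \<chi> using that BT_wff by (force simp: H_def)
    show "\<chi> \<in> H" if "BT True s \<chi>" for \<chi> using BT_weaken[OF that w] by (auto simp: H_def)
    show "\<psi> \<in> H" if "(\<phi> \<^bold>\<longrightarrow> \<psi>) \<in> H" "\<phi> \<in> H" for \<phi> \<psi> using that by (rule mp)
    show "Bot \<notin> H" by (rule Bot)
    show "\<chi> \<in> H \<or> Neg \<chi> \<in> H" if "wff s \<chi>" for \<chi>
      using decide[OF that] unfolding H_def by blast
    show "\<exists>y. fsub (inst T (Var T y)) \<eta> \<in> H" if "Ex T \<eta> \<in> H" for T \<eta>
    proof -
      have "wff s (Ex T \<eta>)" using that BT_wff by (force simp: H_def)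
      moreover have "Neg (Ex T \<eta>) \<notin> H" using that mp Bot unfolding Neg_def by blast
      ultimately show ?thesis using decide by blast
    qed
  qed
  moreover have "\<theta> \<in> H"
    using BT_triv[OF w[of 0], of True] by (auto simp: H_def intro!: exI[of _ 0])
  ultimately show thesis by (rule that)
qed


subsection \<open>Structures\<close>

text \<open>Structures are normalised: objects of all types lie in the universe \<open>carr M (Ty 0)\<close>,
  and all equality predicates are interpreted by identity.\<close>

record 'u struct =
  carr :: "ty \<Rightarrow> 'u set"
  cst :: "tm \<Rightarrow> 'u"
  app :: "'u \<Rightarrow> 'u \<Rightarrow> 'u option"
  mbr :: "nat \<Rightarrow> 'u \<Rightarrow> 'u \<Rightarrow> bool"

definition push :: "ty \<Rightarrow> 'u \<Rightarrow> (ty \<Rightarrow> nat \<Rightarrow> 'u) \<Rightarrow> ty \<Rightarrow> nat \<Rightarrow> 'u" where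
  "push T a e T' i = (if T' = T then (case i of 0 \<Rightarrow> a | Suc j \<Rightarrow> e T j) else e T' i)"

definition den :: "'u struct \<Rightarrow> (ty \<Rightarrow> nat \<Rightarrow> 'u) \<Rightarrow> tm \<Rightarrow> 'u" where
  "den M e t = (case t of Var T i \<Rightarrow> e T i | _ \<Rightarrow> cst M t)"

primrec asat :: "'u struct \<Rightarrow> (ty \<Rightarrow> nat \<Rightarrow> 'u) \<Rightarrow> atom \<Rightarrow> bool" where
  "asat M e (ApA f x y) \<longleftrightarrow> app M (den M e f) (den M e x) = Some (den M e y)"
| "asat M e (EqA T x a) \<longleftrightarrow> den M e x = den M e a"
| "asat M e (InA k X Y) \<longleftrightarrow> mbr M k (den M e X) (den M e Y)"

primrec sat :: "'u struct \<Rightarrow> (ty \<Rightarrow> nat \<Rightarrow> 'u) \<Rightarrow> bfm \<Rightarrow> bool" where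
  "sat M e (Atom a) \<longleftrightarrow> asat M e a"
| "sat M e Bot \<longleftrightarrow> False"
| "sat M e (\<phi> \<^bold>\<and> \<psi>) \<longleftrightarrow> sat M e \<phi> \<and> sat M e \<psi>"
| "sat M e (\<phi> \<^bold>\<or> \<psi>) \<longleftrightarrow> sat M e \<phi> \<or> sat M e \<psi>"
| "sat M e (\<phi> \<^bold>\<longrightarrow> \<psi>) \<longleftrightarrow> (sat M e \<phi> \<longrightarrow> sat M e \<psi>)"
| "sat M e (All T \<phi>) \<longleftrightarrow> (\<forall>a\<in>carr M T. sat M (push T a e) \<phi>)"
| "sat M e (Ex T \<phi>) \<longleftrightarrow> (\<exists>a\<in>carr M T. sat M (push T a e) \<phi>)"

definition asgn :: "'u struct \<Rightarrow> (ty \<Rightarrow> nat \<Rightarrow> 'u) \<Rightarrow> bool" where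
  "asgn M e \<longleftrightarrow> (\<forall>T i. e T i \<in> carr M T)"

text \<open>Truth of all theorems is required, not just of the axioms, so soundness holds by
  definition. The conditions on carriers extend to types above s, because assignments are total
  functions on all types.\<close>

locale bt_model =
  fixes s :: nat and M :: "'u struct"
  assumes carr_ne: "carr M T \<noteq> {}"
    and carr_sub: "carr M T \<subseteq> carr M (Ty 0)"
    and cst_carr: "(\<And>T i. c \<noteq> Var T i) \<Longrightarrow> cst M c \<in> carr M (type_of c)"
    and app_carr: "f \<in> carr M (Ty 0) \<Longrightarrow> x \<in> carr M (Ty 0) \<Longrightarrow> app M f x = Some y \<Longrightarrow> y \<in> carr M (Ty 0)"
    and model: "BT True s \<phi> \<Longrightarrow> asgn M e \<Longrightarrow> sat M e \<phi>"

text \<open>Axioms speak about variables; such a finite substitution produces their instances for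
  arbitrary terms.\<close>

definition tm_asgn :: "((ty \<times> nat) \<times> tm) list \<Rightarrow> ty \<Rightarrow> nat \<Rightarrow> tm" where
  "tm_asgn l T i = (case map_of l (T, i) of Some t \<Rightarrow> t | None \<Rightarrow> Var T i)"

lemma type_pres_tm_asgn: "(\<forall>((T, i), t)\<in>set l. type_of t = T) \<Longrightarrow> type_pres (tm_asgn l)"
  by (auto simp: type_pres_def tm_asgn_def dest!: map_of_SomeD split: option.split)

section \<open>The term model of a Henkin set\<close>

context henkin
begin

lemma H_axiom: "BT_axiom \<phi> \<Longrightarrow> wff s \<phi> \<Longrightarrow> type_pres \<sigma> \<Longrightarrow> fsub \<sigma> \<phi> \<in> H"
  by (rule H_thm, rule BT_fsub, simp, rule BT.axiom)

lemma H_refl: "type_of u = Ty 0 \<Longrightarrow> Eq (Ty 0) u u \<in> H"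
  using H_axiom[OF BT_axiom.eq_refl[of 0], of "tm_asgn [((Ty 0, 0), u)]"]
  by (simp add: type_pres_tm_asgn tm_asgn_def)

lemma H_eq_types:
  assumes "Eq (Ty k) u X \<in> H" "Eq (Ty k) v X \<in> H" "Eq (Ty n) u Y \<in> H"
  shows "Eq (Ty n) v Y \<in> H"
proof -
  have t: "type_of u = Ty 0" "type_of v = Ty 0" "type_of X = Ty k" "type_of Y = Ty n" "k \<le> s" "n \<le> s"
    using H_wff[OF assms(1)] H_wff[OF assms(2)] H_wff[OF assms(3)] by auto
  have "(Eq (Ty k) u X \<^bold>\<and> Eq (Ty k) v X \<^bold>\<and> Eq (Ty n) u Y \<^bold>\<longrightarrow> Eq (Ty n) v Y) \<in> H"
    using H_axiom[OF BT_axiom.eq_types[of k 0 2 1 n 3],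
        of "tm_asgn [((Ty 0, 0), u), ((Ty 0, 1), v), ((Ty k, 2), X), ((Ty n, 3), Y)]"] t
    by (simp add: type_pres_tm_asgn tm_asgn_def)
  then show ?thesis using assms by (auto intro: H_mp simp: H_And)
qed

lemma H_eq_sym: "Eq (Ty 0) u v \<in> H \<Longrightarrow> Eq (Ty 0) v u \<in> H"
  using H_eq_types[of 0 u v v 0 u] H_refl H_wff[of "Eq (Ty 0) u v"] by auto

lemma H_eq_num:
  assumes "Eq Omega u m \<in> H" "Eq Omega v m \<in> H"
  shows "Eq (Ty 0) u v \<in> H"
proof -
  have t: "type_of u = Ty 0" "type_of v = Ty 0" "type_of m = Omega"
    using H_wff[OF assms(1)] H_wff[OF assms(2)] by auto
  have "(Eq Omega u m \<^bold>\<and> Eq Omega v m \<^bold>\<longrightarrow> Eq (Ty 0) u v) \<in> H"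
    using H_axiom[OF BT_axiom.eq_num[of 0 0 1],
        of "tm_asgn [((Ty 0, 0), u), ((Ty 0, 1), v), ((Omega, 0), m)]"] t
    by (simp add: type_pres_tm_asgn tm_asgn_def)
  then show ?thesis using assms by (auto intro: H_mp simp: H_And)
qed

lemma H_eq_num_trans:
  assumes "Eq Omega u m \<in> H" "Eq (Ty 0) u v \<in> H"
  shows "Eq Omega v m \<in> H"
proof -
  have t: "type_of u = Ty 0" "type_of v = Ty 0" "type_of m = Omega"
    using H_wff[OF assms(1)] H_wff[OF assms(2)] by auto
  have "(Eq Omega u m \<^bold>\<and> Eq (Ty 0) u v \<^bold>\<longrightarrow> Eq Omega v m) \<in> H"
    using H_axiom[OF BT_axiom.eq_num_trans[of 0 0 1],
        of "tm_asgn [((Ty 0, 0), u), ((Ty 0, 1), v), ((Omega, 0), m)]"] t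
    by (simp add: type_pres_tm_asgn tm_asgn_def)
  then show ?thesis using assms by (auto intro: H_mp simp: H_And)
qed

text \<open>An object of any type is represented by the set of its type-0 names, which places all
  types in one universe and turns mixed equality into identity. Types above s have no equality in
  the fragment; their terms share the class of \<open>v0 0\<close> as a default.\<close>

definition cls :: "tm \<Rightarrow> tm set" where
  "cls t = {u. (if ty_le (type_of t) s then Eq (type_of t) u t else Eq (Ty 0) u (v0 0)) \<in> H}"

text \<open>The axiom \<open>eq_types\<close> with one of its types set to 0 yields symmetry and the
  passage between names of t and names of u. It does not cover numbers, for which
  \<open>eq_num\<close> and \<open>eq_num_trans\<close> play the same part.\<close>

lemma cls_eq_iff:
  assumes "type_of u = Ty 0" "ty_le (type_of t) s"
  shows "cls u = cls t \<longleftrightarrow> Eq (type_of t) u t \<in> H"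
proof
  assume "cls u = cls t"
  moreover have "u \<in> cls u" using assms H_refl by (simp add: cls_def)
  ultimately show "Eq (type_of t) u t \<in> H" using assms by (simp add: cls_def)
next
  assume *: "Eq (type_of t) u t \<in> H"
  show "cls u = cls t"
  proof (cases "type_of t")
    case Omega
    then have "Eq Omega w t \<in> H \<longleftrightarrow> Eq (Ty 0) w u \<in> H" for w
      using * H_eq_num[of w t u] H_eq_num_trans[of u t w] H_eq_sym[of w u] by auto
    then show ?thesis using assms Omega by (simp add: cls_def)
  next
    case (Ty k)
    then have "Eq (Ty k) w t \<in> H \<longleftrightarrow> Eq (Ty 0) w u \<in> H" for w
      using * H_eq_types[of 0 u u w k t] H_eq_types[of k u t w 0 u] H_refl[OF assms(1)] by auto
    then show ?thesis using assms Ty by (simp add: cls_def)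
  qed
qed

lemma cls_eqD: "type_of u = Ty 0 \<Longrightarrow> type_of v = Ty 0 \<Longrightarrow> cls u = cls v \<Longrightarrow> Eq (Ty 0) u v \<in> H"
  using cls_eq_iff[of u v] by simp

text \<open>The axioms \<open>num_type_0\<close> and \<open>set_type_0\<close> give every object a
  type-0 name; in the model this becomes the inclusion of all carriers in that of type 0.\<close>

lemma ex_cls: "\<exists>u. type_of u = Ty 0 \<and> cls u = cls t"
proof (cases "ty_le (type_of t) s")
  case False
  then have "cls (v0 0) = cls t" by (simp add: cls_def)
  then show ?thesis by (intro exI[of _ "v0 0"]) simp
next
  case True
  have "Ex (Ty 0) (Eq (type_of t) (v0 0) (tsub (shift (Ty 0)) t)) \<in> H"
  proof (cases "type_of t")
    case Omega
    have "fsub (tm_asgn [((Omega, 0), t)]) (Ex (Ty 0) (Eq Omega (v0 0) (vN 0))) \<in> H"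
      using Omega by (intro H_axiom BT_axiom.num_type_0) (auto simp: type_pres_tm_asgn)
    then show ?thesis using Omega by (simp add: under_def tm_asgn_def)
  next
    case (Ty k)
    have "fsub (tm_asgn [((Ty k, 0), t)]) (Ex (Ty 0) (Eq (Ty k) (v0 0) (tsub (shift (Ty 0)) (vT k 0)))) \<in> H"
      using Ty True by (intro H_axiom BT_axiom.set_type_0) (auto simp: type_pres_tm_asgn)
    then show ?thesis using Ty by (cases k) (simp_all add: under_def tm_asgn_def shift_def)
  qed
  from H_wit[OF this] obtain y where "Eq (type_of t) (v0 y) (tsub (\<lambda>T' i. tsub (inst (Ty 0) (v0 y)) (shift (Ty 0) T' i)) t) \<in> H"
    by (auto simp: inst_def)
  moreover have "(\<lambda>T' i. tsub (inst (Ty 0) (v0 y)) (shift (Ty 0) T' i)) = Var"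
    by (intro ext) (auto simp: inst_def shift_def)
  ultimately show ?thesis using cls_eq_iff[of "v0 y" t] True by (intro exI[of _ "v0 y"]) simp
qed

text \<open>Equality of two objects of the same type is \<open>sim\<close>, the existence of a
  common type-0 name; \<open>ex_cls\<close> provides one.\<close>

lemma cls_eq_sim:
  assumes "type_of t = T" "type_of u = T" "ty_le T s" "cls t = cls u"
  shows "sim (At t) (At u) \<in> H"
proof -
  have w: "wff s (sim (At t) (At u))" using assms by (simp add: sim_def)
  obtain v where v: "type_of v = Ty 0" "cls v = cls t" using ex_cls by blast
  have "Eq T v t \<in> H" "Eq T v u \<in> H" using cls_eq_iff[OF v(1), of t] cls_eq_iff[OF v(1), of u] v(2) assms by auto
  moreover have "(\<lambda>T' i. tsub (inst (Ty 0) v) (shift (Ty 0) T' i)) = Var"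
    by (intro ext) (auto simp: inst_def shift_def)
  ultimately show ?thesis
    using v(1) assms w unfolding sim_def
    by (subst H_Ex) (auto intro!: exI[of _ v] simp: H_And inst_def)
qed

lemma fsub_sim_At:
  "type_pres \<sigma> \<Longrightarrow> fsub \<sigma> (sim (At t) (At u)) = sim (At (tsub \<sigma> t)) (At (tsub \<sigma> u))"
proof -
  have "(\<lambda>T' i. tsub (under T \<sigma>) (shift T T' i)) = (\<lambda>T' i. tsub (shift T) (\<sigma> T' i))" for T
    by (intro ext) (auto simp: under_def shift_def)
  moreover assume "type_pres \<sigma>"
  ultimately show ?thesis by (simp add: sim_def under_def[of _ _ _ 0])
qed

lemma wff_sim_At: "wff n (sim (At t) (At u)) \<longleftrightarrow> ty_le (type_of t) n \<and> ty_le (type_of u) n"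
  by (simp add: sim_def)

text \<open>Values of applications are picked by choice and membership refers to some
  representatives; \<open>app_term_model\<close> and \<open>mbr_term_model\<close> show that neither
  depends on them.\<close>

definition term_model :: "tm set struct" where
  "term_model = \<lparr>carr = \<lambda>T. cls ` {t. type_of t = T}, cst = cls,
    app = \<lambda>F X. (if \<exists>y f x. Ap f x y \<in> H \<and> F = cls f \<and> X = cls x
      then Some (cls (SOME y. \<exists>f x. Ap f x y \<in> H \<and> F = cls f \<and> X = cls x)) else None),
    mbr = \<lambda>k A B. \<exists>X Y. In k X Y \<in> H \<and> A = cls X \<and> B = cls Y\<rparr>"

lemma Ap_cong:
  assumes "Ap f x y \<in> H" "type_of g = Ty 0" "type_of u = Ty 0" "type_of v = Ty 0"
    and "cls f = cls g" "cls x = cls u" "cls y = cls v"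
  shows "Ap g u v \<in> H"
proof -
  have t: "type_of f = Ty 0" "type_of x = Ty 0" "type_of y = Ty 0"
    using H_wff[OF assms(1)] by auto
  have "(Ap f x y \<^bold>\<and> Eq (Ty 0) f g \<^bold>\<and> Eq (Ty 0) x u \<^bold>\<and> Eq (Ty 0) y v \<^bold>\<longrightarrow> Ap g u v) \<in> H"
    using H_axiom[OF BT_axiom.eq_Ap[of 0 1 2 3 4 5],
        of "tm_asgn [((Ty 0, 0), f), ((Ty 0, 1), x), ((Ty 0, 2), y), ((Ty 0, 3), g), ((Ty 0, 4), u), ((Ty 0, 5), v)]"]
      t assms
    by (simp add: type_pres_tm_asgn tm_asgn_def)
  moreover have "Eq (Ty 0) f g \<in> H" "Eq (Ty 0) x u \<in> H" "Eq (Ty 0) y v \<in> H"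
    using t assms by (simp_all add: cls_eqD)
  ultimately show ?thesis using assms(1) by (auto intro: H_mp simp: H_And)
qed

lemma Ap_unique: assumes "Ap f x y \<in> H" "Ap f x z \<in> H" shows "cls y = cls z"
proof -
  have t: "type_of f = Ty 0" "type_of x = Ty 0" "type_of y = Ty 0" "type_of z = Ty 0"
    using H_wff[OF assms(1)] H_wff[OF assms(2)] by auto
  have "(Ap f x y \<^bold>\<and> Ap f x z \<^bold>\<longrightarrow> Eq (Ty 0) y z) \<in> H"
    using H_axiom[OF BT_axiom.Ap_unique[of 0 1 2 3],
        of "tm_asgn [((Ty 0, 0), f), ((Ty 0, 1), x), ((Ty 0, 2), y), ((Ty 0, 3), z)]"] t
    by (simp add: type_pres_tm_asgn tm_asgn_def)
  then have "Eq (Ty 0) y z \<in> H" using assms H_mp H_And by blast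
  then show ?thesis using cls_eq_iff[of y z] t by simp
qed

lemma In_cong:
  assumes "In k X Y \<in> H" "type_of U = Ty k" "type_of Z = Ty (Suc k)" "cls X = cls U" "cls Y = cls Z"
  shows "In k U Z \<in> H"
proof -
  have t: "type_of X = Ty k" "type_of Y = Ty (Suc k)" "Suc k \<le> s"
    using H_wff[OF assms(1)] by auto
  have "(In k X Y \<^bold>\<and> sim (At X) (At U) \<^bold>\<and> sim (At Y) (At Z) \<^bold>\<longrightarrow> In k U Z) \<in> H"
    using H_axiom[OF BT_axiom.eq_In[of k 0 1 2 3],
        of "tm_asgn [((Ty k, 0), X), ((Ty (Suc k), 1), Y), ((Ty k, 2), U), ((Ty (Suc k), 3), Z)]"] t assms
    by (simp add: type_pres_tm_asgn fsub_sim_At wff_sim_At) (simp add: tm_asgn_def)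
  moreover have "sim (At X) (At U) \<in> H" "sim (At Y) (At Z) \<in> H"
    using t assms cls_eq_sim[of X "Ty k" U] cls_eq_sim[of Y "Ty (Suc k)" Z] by simp_all
  ultimately show ?thesis using assms(1) by (auto intro: H_mp simp: H_And)
qed

text \<open>The congruence axiom moves \<open>Ap\<close> to the representatives at hand, and
  uniqueness of values identifies the chosen result with any other.\<close>

lemma app_term_model:
  assumes "type_of f = Ty 0" "type_of x = Ty 0" "type_of y = Ty 0"
  shows "app term_model (cls f) (cls x) = Some (cls y) \<longleftrightarrow> Ap f x y \<in> H"
proof -
  let ?P = "\<lambda>y. \<exists>g u. Ap g u y \<in> H \<and> cls f = cls g \<and> cls x = cls u"
  have P: "cls z = cls y" if "?P z" "?P y" for z y
  proof -
    obtain g u g' u' where *: "Ap g u z \<in> H" "Ap g' u' y \<in> H"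
      "cls f = cls g" "cls x = cls u" "cls f = cls g'" "cls x = cls u'"
      using \<open>?P z\<close> \<open>?P y\<close> by blast
    have "Ap g u y \<in> H"
      using Ap_cong[OF *(2), of g u y] H_wff[OF *(1)] H_wff[OF *(2)] *(3-6) by simp
    from Ap_unique[OF *(1) this] show ?thesis .
  qed
  have iff: "Ap f x y \<in> H \<longleftrightarrow> (\<exists>z. ?P z \<and> cls z = cls y)"
  proof
    assume "\<exists>z. ?P z \<and> cls z = cls y"
    then obtain z g u where *: "Ap g u z \<in> H" "cls f = cls g" "cls x = cls u" "cls z = cls y" by blast
    from Ap_cong[OF *(1) assms] * show "Ap f x y \<in> H" by simp
  qed blast
  have app: "app term_model (cls f) (cls x) =
      (if \<exists>z. ?P z then Some (cls (SOME z. ?P z)) else None)"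
    by (simp only: term_model_def struct.simps)
  show ?thesis
  proof (cases "\<exists>z. ?P z")
    case True
    then have "?P (SOME z. ?P z)" by (rule someI_ex)
    then have "cls (SOME z. ?P z) = cls y \<longleftrightarrow> Ap f x y \<in> H"
      unfolding iff using P by blast
    then show ?thesis unfolding app using True by simp
  next
    case False
    then have "Ap f x y \<notin> H" unfolding iff by blast
    moreover have "app term_model (cls f) (cls x) = None" using app False by (simp only: if_False)
    ultimately show ?thesis by simp
  qed
qed

lemma mbr_term_model:
  assumes "type_of X = Ty k" "type_of Y = Ty (Suc k)"
  shows "mbr term_model k (cls X) (cls Y) \<longleftrightarrow> In k X Y \<in> H"
proof
  assume "mbr term_model k (cls X) (cls Y)"
  then obtain U Z where *: "In k U Z \<in> H" "cls X = cls U" "cls Y = cls Z"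
    by (auto simp: term_model_def)
  from In_cong[OF *(1) assms] * show "In k X Y \<in> H" by simp
qed (auto simp: term_model_def)

text \<open>An assignment into the term model is a substitution followed by \<open>cls\<close>. The
  quantifier cases therefore compare pushing a class with instantiating by a term, which is what
  \<open>H_All\<close> and \<open>H_Ex\<close> speak about.\<close>

lemma truth:
  "wff s \<phi> \<Longrightarrow> type_pres \<sigma> \<Longrightarrow> sat term_model (\<lambda>T i. cls (\<sigma> T i)) \<phi> \<longleftrightarrow> fsub \<sigma> \<phi> \<in> H"
proof (induction \<phi> arbitrary: \<sigma>)
  case (Atom a)
  have d: "den term_model (\<lambda>T i. cls (\<sigma> T i)) t = cls (tsub \<sigma> t)" for t
    by (cases t) (auto simp: den_def term_model_def)
  have "cls x = cls y \<longleftrightarrow> Eq T x y \<in> H" if "type_of x = Ty 0" "type_of y = T" "ty_le T s" for x y T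
    using cls_eq_iff[of x y] that by simp
  then show ?case using Atom
    by (cases a) (simp_all add: d app_term_model mbr_term_model)
next
  case Bot
  then show ?case using H_Bot by simp
next
  case (All T \<phi>)
  have "sat term_model (push T (cls t) (\<lambda>T i. cls (\<sigma> T i))) \<phi> \<longleftrightarrow>
      fsub (inst T t) (fsub (under T \<sigma>) \<phi>) \<in> H" if "type_of t = T" for t
  proof -
    let ?\<sigma> = "\<lambda>T' i. if T' = T then (case i of 0 \<Rightarrow> t | Suc j \<Rightarrow> \<sigma> T j) else \<sigma> T' i"
    have "push T (cls t) (\<lambda>T i. cls (\<sigma> T i)) = (\<lambda>T i. cls (?\<sigma> T i))"
      by (intro ext) (auto simp: push_def split: nat.split)
    moreover have "type_pres ?\<sigma>" using that All.prems by (auto simp: type_pres_def split: nat.split)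
    ultimately show ?thesis using All by (simp add: inst_under)
  qed
  then show ?case using All.prems by (auto simp: H_All term_model_def simp del: fsub_fsub)
next
  case (Ex T \<phi>)
  have "sat term_model (push T (cls t) (\<lambda>T i. cls (\<sigma> T i))) \<phi> \<longleftrightarrow>
      fsub (inst T t) (fsub (under T \<sigma>) \<phi>) \<in> H" if "type_of t = T" for t
  proof -
    let ?\<sigma> = "\<lambda>T' i. if T' = T then (case i of 0 \<Rightarrow> t | Suc j \<Rightarrow> \<sigma> T j) else \<sigma> T' i"
    have "push T (cls t) (\<lambda>T i. cls (\<sigma> T i)) = (\<lambda>T i. cls (?\<sigma> T i))"
      by (intro ext) (auto simp: push_def split: nat.split)
    moreover have "type_pres ?\<sigma>" using that Ex.prems by (auto simp: type_pres_def split: nat.split)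
    ultimately show ?thesis using Ex by (simp add: inst_under)
  qed
  then show ?case using Ex.prems by (auto simp: H_Ex term_model_def simp del: fsub_fsub)
qed (auto simp: H_And H_Or H_Imp)

lemma asgn_term_model:
  assumes "asgn term_model e"
  obtains \<sigma> where "type_pres \<sigma>" "e = (\<lambda>T i. cls (\<sigma> T i))"
proof -
  have "\<forall>T i. \<exists>t. type_of t = T \<and> e T i = cls t"
    using assms by (fastforce simp: asgn_def term_model_def)
  then obtain \<sigma> where "\<forall>T i. type_of (\<sigma> T i) = T \<and> e T i = cls (\<sigma> T i)" by metis
  then show thesis by (intro that[of \<sigma>] ext) (auto simp: type_pres_def)
qed

text \<open>Theorems hold under every assignment because derivability is closed under substitution
  and H contains all theorems.\<close>

lemma bt_model_term_model: "bt_model s term_model"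
proof
  show "carr term_model T \<noteq> {}" for T
    by (auto simp: term_model_def intro: exI[of _ "Var T 0"])
  show "carr term_model T \<subseteq> carr term_model (Ty 0)" for T
  proof
    fix A assume "A \<in> carr term_model T"
    then obtain t where "A = cls t" by (auto simp: term_model_def)
    with ex_cls[of t] show "A \<in> carr term_model (Ty 0)" by (auto simp: term_model_def)
  qed
  show "cst term_model c \<in> carr term_model (type_of c)" for c
    by (auto simp: term_model_def)
  show "y \<in> carr term_model (Ty 0)" if "app term_model f x = Some y" for f x y
  proof -
    let ?P = "\<lambda>z. \<exists>g u. Ap g u z \<in> H \<and> f = cls g \<and> x = cls u"
    define z where "z = (SOME z. ?P z)"
    have "(if \<exists>z. ?P z then Some (cls z) else None) = Some y"
      using that by (simp only: term_model_def struct.simps z_def)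
    then have ex: "\<exists>z. ?P z" and y: "y = cls z"
      by (metis option.distinct(1), metis option.distinct(1) option.inject)
    from ex have "?P z" unfolding z_def by (rule someI_ex)
    then obtain g u where "Ap g u z \<in> H" by blast
    from H_wff[OF this] show ?thesis using y by (simp add: term_model_def)
  qed
  show "sat term_model e \<phi>" if *: "BT True s \<phi>" and e: "asgn term_model e" for \<phi> e
  proof -
    obtain \<sigma> where \<sigma>: "type_pres \<sigma>" "e = (\<lambda>T i. cls (\<sigma> T i))" using asgn_term_model[OF e] .
    have "fsub \<sigma> \<phi> \<in> H" by (rule H_thm[OF BT_fsub[OF \<sigma>(1) *]])
    then show ?thesis using truth[OF BT_wff[OF *] \<sigma>(1)] \<sigma>(2) by simp
  qed
qed

end

text \<open>A formula that is not derivable has a consistent negation by double negation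
  elimination. The countermodel is a term model, so models on \<open>tm set\<close> suffice.\<close>

theorem completeness:
  assumes "wff s \<phi>"
    and "\<And>(M :: tm set struct) e. bt_model s M \<Longrightarrow> asgn M e \<Longrightarrow> sat M e \<phi>"
  shows "BT True s \<phi>"
proof (rule ccontr)
  assume *: "\<not> BT True s \<phi>"
  have "consistent s (Neg \<phi>)"
    using * BT.mp[OF BT_dne[OF assms(1)]] assms(1) by (auto simp: consistent_def)
  then obtain H where H: "henkin s H" "Neg \<phi> \<in> H" by (rule henkin_extension)
  interpret henkin s H by (rule H)
  have "asgn term_model (\<lambda>T i. cls (Var T i))"
    by (auto simp: asgn_def term_model_def)
  from assms(2)[OF bt_model_term_model this] have "\<phi> \<in> H"
    using truth[OF assms(1) type_pres_Var] by simp
  then show False using H(2) H_Neg[OF assms(1)] by simp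
qed

section \<open>Models of BT\<close>

lemma den_simps [simp]:
  "den M e (Var T i) = e T i" "den M e Zero = cst M Zero" "den M e CK = cst M CK"
  "den M e CS = cst M CS" "den M e CD = cst M CD" "den M e CP = cst M CP"
  "den M e CP1 = cst M CP1" "den M e CP2 = cst M CP2" "den M e (CC n) = cst M (CC n)"
  by (simp_all add: den_def)

lemma den_tsub [simp]: "den M e (tsub \<sigma> t) = den M (\<lambda>T i. den M e (\<sigma> T i)) t"
  by (cases t) auto

lemma push_simps [simp]:
  "push T a e T 0 = a" "push T a e T (Suc i) = e T i" "T' \<noteq> T \<Longrightarrow> push T a e T' i = e T' i"
  by (auto simp: push_def)

lemma den_shift [simp]: "(\<lambda>T' i. den M (push T a e) (shift T T' i)) = e"
  by (intro ext) (auto simp: push_def shift_def)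

lemma den_under: "(\<lambda>T' i. den M (push T a e) (under T \<sigma> T' i)) = push T a (\<lambda>T i. den M e (\<sigma> T i))"
  by (intro ext) (auto simp: push_def under_def split: nat.split)

lemma sat_fsub [simp]: "sat M e (fsub \<sigma> \<phi>) \<longleftrightarrow> sat M (\<lambda>T i. den M e (\<sigma> T i)) \<phi>"
proof (induction \<phi> arbitrary: e \<sigma>)
  case (Atom a)
  then show ?case by (cases a) auto
qed (auto simp: den_under)

lemma sat_Neg [simp]: "sat M e (Neg \<phi>) \<longleftrightarrow> \<not> sat M e \<phi>"
  and sat_Iff [simp]: "sat M e (\<phi> \<^bold>\<longleftrightarrow> \<psi>) \<longleftrightarrow> (sat M e \<phi> \<longleftrightarrow> sat M e \<psi>)"
  by (auto simp: Neg_def Iff_def)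

definition tail :: "ty \<Rightarrow> (ty \<Rightarrow> nat \<Rightarrow> 'u) \<Rightarrow> ty \<Rightarrow> nat \<Rightarrow> 'u" where
  "tail T e T' i = e T' (if T' = T then Suc i else i)"

lemma push_tail: "push T (e T 0) (tail T e) = e"
  by (intro ext) (auto simp: push_def tail_def split: nat.split)

section \<open>Partial evaluation of external terms\<close>

definition apo :: "'u struct \<Rightarrow> 'u option \<Rightarrow> 'u option \<Rightarrow> 'u option" where
  "apo M F X = Option.bind F (\<lambda>f. Option.bind X (app M f))"

lemma apo_simps [simp]:
  "apo M (Some f) (Some x) = app M f x" "apo M None X = None" "apo M F None = None"
  by (auto simp: apo_def split: bind_splits)

lemma apo_eq_Some: "apo M F X = Some y \<longleftrightarrow> (\<exists>f x. F = Some f \<and> X = Some x \<and> app M f x = Some y)"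
  by (auto simp: apo_def bind_eq_Some_conv)

primrec ev :: "'u struct \<Rightarrow> (ty \<Rightarrow> nat \<Rightarrow> 'u) \<Rightarrow> ext \<Rightarrow> 'u option" where
  "ev M e (At a) = Some (den M e a)"
| "ev M e (t \<^bold>\<cdot> u) = apo M (ev M e t) (ev M e u)"

lemma ev_esub [simp]: "ev M e (esub \<sigma> t) = ev M (\<lambda>T i. den M e (\<sigma> T i)) t"
  by (induction t) auto

primrec ext_ty_le :: "nat \<Rightarrow> ext \<Rightarrow> bool" where
  "ext_ty_le n (At a) \<longleftrightarrow> ty_le (type_of a) n"
| "ext_ty_le n (t \<^bold>\<cdot> u) \<longleftrightarrow> ext_ty_le n t \<and> ext_ty_le n u"

lemma ext_ty_le_esub [simp]: "type_pres \<sigma> \<Longrightarrow> ext_ty_le n (esub \<sigma> t) \<longleftrightarrow> ext_ty_le n t"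
  by (induction t) auto

lemma wff_val [simp]: "type_of x = Ty 0 \<Longrightarrow> wff n (val t x) \<longleftrightarrow> ext_ty_le n t"
  by (induction t x rule: val.induct) auto

lemma wff_sim [simp]: "wff n (sim t u) \<longleftrightarrow> ext_ty_le n t \<and> ext_ty_le n u"
  and wff_defined [simp]: "wff n (defined t) \<longleftrightarrow> ext_ty_le n t"
  and wff_cong [simp]: "wff n (cong t u) \<longleftrightarrow> ext_ty_le n t \<and> ext_ty_le n u"
  by (simp_all add: sim_def defined_def cong_def)

primrec ext_vars :: "ext \<Rightarrow> (ty \<times> nat) set" where
  "ext_vars (At a) = fv_tm a"
| "ext_vars (t \<^bold>\<cdot> u) = ext_vars t \<union> ext_vars u"

lemma ev_cong: "(\<And>T i. (T, i) \<in> ext_vars t \<Longrightarrow> e T i = e' T i) \<Longrightarrow> ev M e t = ev M e' t"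
proof (induction t)
  case (At a)
  then show ?case by (cases a) auto
next
  case (App t u)
  from App.IH(1)[OF App.prems] App.IH(2)[OF App.prems] show ?case by simp
qed

lemma ext_vars_lam [simp]: "ext_vars (lam i t) = ext_vars t - {(Ty 0, i)}"
proof (induction t)
  case (At a)
  then show ?case by (cases a) auto
qed auto

lemma ext_ty_le_lam [simp]: "ext_ty_le n (lam i t) \<longleftrightarrow> ext_ty_le n t"
  by (induction t) auto

lemma closed_fixpoint [simp]: "ext_vars fixpoint = {}" "ext_ty_le n fixpoint"
  by (auto simp: fixpoint_def Let_def)

lemma closed_recursor [simp]: "ext_vars recursor = {}" "ext_ty_le n recursor"
  by (auto simp: recursor_def Let_def)

lemma closed_addition [simp]: "ext_vars addition = {}" "ext_ty_le n addition"
  by (auto simp: addition_def)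

lemma closed_multiplication [simp]: "ext_vars multiplication = {}" "ext_ty_le n multiplication"
  by (auto simp: multiplication_def)

lemma ext_ty_le_arith_tm [simp]: "ext_ty_le n (arith_tm t)"
  by (induction t) auto

text \<open>\<open>lam\<close> names the variable that it abstracts and shifts nothing, so its
  semantics needs an update in place instead of \<open>push\<close>.\<close>

definition upd :: "nat \<Rightarrow> 'u \<Rightarrow> (ty \<Rightarrow> nat \<Rightarrow> 'u) \<Rightarrow> ty \<Rightarrow> nat \<Rightarrow> 'u" where
  "upd i a e = e(Ty 0 := (e (Ty 0))(i := a))"

lemma upd_simps [simp]:
  "upd i a e Omega j = e Omega j"
  "upd i a e (Ty 0) j = (if i = j then a else e (Ty 0) j)"
  by (auto simp: upd_def)

context bt_model
begin

abbreviation U :: "'u set" where "U \<equiv> carr M (Ty 0)"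
abbreviation N :: "'u set" where "N \<equiv> carr M Omega"

lemma carr_U: "a \<in> carr M T \<Longrightarrow> a \<in> U"
  using carr_sub by blast

lemma asgn_push [simp]: "asgn M e \<Longrightarrow> a \<in> carr M T \<Longrightarrow> asgn M (push T a e)"
  by (auto simp: asgn_def push_def split: nat.split)

lemma asgn_tail [simp]: "asgn M e \<Longrightarrow> asgn M (tail T e)"
  by (auto simp: asgn_def tail_def)

lemma asgn_upd [simp]: "asgn M e \<Longrightarrow> a \<in> U \<Longrightarrow> asgn M (upd i a e)"
  by (auto simp: asgn_def upd_def)

lemma asgn_carr [simp]: "asgn M e \<Longrightarrow> e T i \<in> carr M T"
  by (auto simp: asgn_def)

lemma cst_U [simp]: "cst M CK \<in> U" "cst M CS \<in> U" "cst M CD \<in> U" "cst M CP \<in> U"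
  "cst M CP1 \<in> U" "cst M CP2 \<in> U" "cst M (CC n) \<in> U" "cst M Zero \<in> N" "cst M Zero \<in> U"
  using cst_carr[of CK] cst_carr[of CS] cst_carr[of CD] cst_carr[of CP] cst_carr[of CP1]
    cst_carr[of CP2] cst_carr[of "CC n"] cst_carr[of Zero] carr_U[of _ Omega] by simp_all

lemma den_U [simp]: "asgn M e \<Longrightarrow> den M e t \<in> U"
  using carr_U[OF asgn_carr] by (cases t) auto

lemma apo_U: "apo M F X = Some y \<Longrightarrow> (\<And>f. F = Some f \<Longrightarrow> f \<in> U) \<Longrightarrow> (\<And>x. X = Some x \<Longrightarrow> x \<in> U) \<Longrightarrow> y \<in> U"
  by (auto simp: apo_eq_Some intro: app_carr)

lemma ev_U: "asgn M e \<Longrightarrow> ev M e t = Some y \<Longrightarrow> y \<in> U"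
  by (induction t arbitrary: y) (auto intro: apo_U)

text \<open>The quantifiers inside \<open>val\<close> range over type 0 only, and values of subterms
  of any type lie in that universe. Hence the formula expresses strict partial evaluation.\<close>

lemma sat_val [simp]: "asgn M e \<Longrightarrow> sat M e (val t x) \<longleftrightarrow> ev M e t = Some (den M e x)"
proof (induction t x arbitrary: e rule: val.induct)
  case (1 a x)
  then show ?case by auto
next
  case (2 t u x)
  then show ?case
    using ev_U[OF "2.prems", of t] ev_U[OF "2.prems", of u]
    by (auto simp: apo_eq_Some cong: bex_cong)
qed

declare val.simps [simp del] lam.simps [simp del]

lemma sat_sim [simp]:
  "asgn M e \<Longrightarrow> sat M e (sim t u) \<longleftrightarrow> (\<exists>x. ev M e t = Some x \<and> ev M e u = Some x)"
  unfolding sim_def by (auto simp: ev_U cong: bex_cong)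

lemma sat_defined [simp]: "asgn M e \<Longrightarrow> sat M e (defined t) \<longleftrightarrow> (\<exists>x. ev M e t = Some x)"
  unfolding defined_def by (auto simp: ev_U cong: bex_cong)

lemma sat_cong [simp]: "asgn M e \<Longrightarrow> sat M e (cong t u) \<longleftrightarrow> ev M e t = ev M e u"
proof -
  assume e: "asgn M e"
  have "sat M e (cong t u) \<longleftrightarrow> (\<forall>x\<in>U. ev M e t = Some x \<longleftrightarrow> ev M e u = Some x)"
    unfolding cong_def using e by (auto cong: ball_cong)
  also have "\<dots> \<longleftrightarrow> ev M e t = ev M e u"
    using ev_U[OF e] by (cases "ev M e t"; cases "ev M e u") auto
  finally show ?thesis .
qed

lemma sat_ext_in [simp]:
  "asgn M e \<Longrightarrow> sat M e (ext_in k t Y) \<longleftrightarrow>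
     (\<exists>X\<in>carr M (Ty k). ev M e t = Some X \<and> mbr M k X (den M e Y))"
  unfolding ext_in_def by (auto cong: bex_cong)

text \<open>The semantic counterpart of \<open>tm_asgn\<close>; variables that are not listed
  receive an arbitrary object of their type.\<close>

definition env :: "((ty \<times> nat) \<times> 'u) list \<Rightarrow> ty \<Rightarrow> nat \<Rightarrow> 'u" where
  "env l T i = (case map_of l (T, i) of Some a \<Rightarrow> a | None \<Rightarrow> (SOME a. a \<in> carr M T))"

lemma asgn_env: "(\<forall>((T, i), a)\<in>set l. a \<in> carr M T) \<Longrightarrow> asgn M (env l)"
  using carr_ne some_in_eq
  by (fastforce simp: asgn_def env_def dest!: map_of_SomeD split: option.split)

lemma axiom_env:
  "BT_axiom \<phi> \<Longrightarrow> wff s \<phi> \<Longrightarrow> (\<forall>((T, i), a)\<in>set l. a \<in> carr M T) \<Longrightarrow> sat M (env l) \<phi>"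
  by (rule model, rule BT.axiom) (auto intro: asgn_env)

subsection \<open>Combinators\<close>

lemma app_K: assumes "x \<in> U" "y \<in> U"
  obtains k where "k \<in> U" "app M (cst M CK) x = Some k" "app M k y = Some x"
  using axiom_env[OF BT_axiom.K[of 0 1], of "[((Ty 0, 0), x), ((Ty 0, 1), y)]"] assms
  by (auto simp: asgn_env env_def apo_eq_Some) (metis app_carr cst_U(1))

lemma app_S: assumes "x \<in> U" "y \<in> U"
  obtains f g where "f \<in> U" "g \<in> U" "app M (cst M CS) x = Some f" "app M f y = Some g"
    "\<And>z. z \<in> U \<Longrightarrow> app M g z = apo M (app M x z) (app M y z)"
proof -
  have "\<exists>f g. app M (cst M CS) x = Some f \<and> app M f y = Some g"
    using axiom_env[OF BT_axiom.S_defined[of 0 1], of "[((Ty 0, 0), x), ((Ty 0, 1), y)]"] assms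
    by (auto simp: asgn_env env_def apo_eq_Some)
  then obtain f g where fg: "app M (cst M CS) x = Some f" "app M f y = Some g" by blast
  moreover have "app M g z = apo M (app M x z) (app M y z)" if "z \<in> U" for z
    using axiom_env[OF BT_axiom.S[of 0 1 2], of "[((Ty 0, 0), x), ((Ty 0, 1), y), ((Ty 0, 2), z)]"]
      assms that fg
    by (auto simp: asgn_env env_def)
  moreover have "f \<in> U" using app_carr fg(1) assms cst_U by blast
  moreover from this have "g \<in> U" using app_carr fg(2) assms by blast
  ultimately show thesis using that by blast
qed

text \<open>The abstraction has a value even where t has none, because K applied to one argument and
  S applied to two are always defined.\<close>

lemma lam:
  assumes "asgn M e"
  obtains F where "F \<in> U" "ev M e (lam i t) = Some F" "\<And>a. a \<in> U \<Longrightarrow> app M F a = ev M (upd i a e) t"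
proof -
  have "\<exists>F. ev M e (lam i t) = Some F \<and> (\<forall>a\<in>U. app M F a = ev M (upd i a e) t)"
  proof (induction t)
    case (App t u)
    then obtain F G where FG: "ev M e (lam i t) = Some F" "\<forall>a\<in>U. app M F a = ev M (upd i a e) t"
      "ev M e (lam i u) = Some G" "\<forall>a\<in>U. app M G a = ev M (upd i a e) u" by blast
    have "F \<in> U" "G \<in> U" using ev_U[OF assms] FG by blast+
    then show ?case by (rule app_S) (simp add: FG lam.simps)
  next
    case (At a)
    show ?case
    proof (cases "a = v0 i")
      case True
      \<comment> \<open>The identity combinator SKK: for each z both occurrences of K yield the same
        k, and k applied to itself returns z.\<close>
      obtain g where g: "apo M (app M (cst M CS) (cst M CK)) (Some (cst M CK)) = Some g"
        "\<And>z. z \<in> U \<Longrightarrow> app M g z = apo M (app M (cst M CK) z) (app M (cst M CK) z)"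
        by (rule app_S[of "cst M CK" "cst M CK"]) auto
      have "app M g z = Some z" if z: "z \<in> U" for z
      proof -
        obtain k where k: "k \<in> U" "app M (cst M CK) z = Some k" using app_K[OF z z] by blast
        from app_K[OF z k(1)] k(2) have "app M k k = Some z" by force
        then show ?thesis using g(2)[OF z] k by simp
      qed
      then show ?thesis using True g by (simp add: lam.simps)
    next
      case False
      have d: "den M (upd i x e) a = den M e a" for x
        using False by (cases a) (auto simp: upd_def)
      have "den M e a \<in> U" using assms by simp
      then obtain k where k: "app M (cst M CK) (den M e a) = Some k" using app_K by blast
      have "app M k y = Some (den M e a)" if "y \<in> U" for y
        using app_K[OF \<open>den M e a \<in> U\<close> that] k by force
      then show ?thesis using False k by (simp add: d lam.simps)
    qed
  qed
  then show thesis using that ev_U[OF assms] by blast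
qed

text \<open>R is W applied to itself, where W y abstracts x from f (y y) x. The outer abstraction
  over x makes R defined even when g applied to R is not.\<close>

lemma fixpoint:
  assumes "asgn M e" "g \<in> U"
  obtains R where "R \<in> U" "apo M (ev M e fixpoint) (Some g) = Some R"
    "\<And>x. x \<in> U \<Longrightarrow> app M R x = apo M (app M g R) (Some x)"
proof -
  let ?f = "At (v0 0)" and ?y = "At (v0 1)" and ?x = "At (v0 2)"
  let ?b = "lam 2 (?f \<^bold>\<cdot> (?y \<^bold>\<cdot> ?y) \<^bold>\<cdot> ?x)"
  let ?w = "lam 1 ?b"
  obtain F where F: "ev M e fixpoint = Some F" "app M F g = ev M (upd 0 g e) (?w \<^bold>\<cdot> ?w)"
    unfolding fixpoint_def Let_def using lam[OF assms(1)] assms(2) by metis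
  have e: "asgn M (upd 0 g e)" using assms by simp
  obtain W where W: "W \<in> U" "ev M (upd 0 g e) ?w = Some W"
    "\<And>a. a \<in> U \<Longrightarrow> app M W a = ev M (upd 1 a (upd 0 g e)) ?b"
    using lam[OF e] by metis
  have e': "asgn M (upd 1 W (upd 0 g e))" using e W by simp
  obtain R where R: "R \<in> U" "ev M (upd 1 W (upd 0 g e)) ?b = Some R"
    "\<And>a. a \<in> U \<Longrightarrow> app M R a = ev M (upd 2 a (upd 1 W (upd 0 g e))) (?f \<^bold>\<cdot> (?y \<^bold>\<cdot> ?y) \<^bold>\<cdot> ?x)"
    using lam[OF e'] by metis
  have WW: "app M W W = Some R" using W R by simp
  show thesis
    by (rule that[of R]) (simp_all add: R F W WW del: One_nat_def)
qed

subsection \<open>Natural numbers\<close>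

abbreviation zero :: 'u where "zero \<equiv> cst M Zero"

definition suc :: "'u \<Rightarrow> 'u" where
  "suc n = the (apo M (app M (cst M CP) n) (Some zero))"

lemma pair_zero: assumes "n \<in> N"
  shows "apo M (app M (cst M CP) n) (Some zero) = Some (suc n)" and suc_N: "suc n \<in> N"
proof -
  have "\<exists>m\<in>N. apo M (app M (cst M CP) n) (Some zero) = Some m"
    using axiom_env[OF BT_axiom.succ_num[of 0], of "[((Omega, 0), n)]"] assms
    by (auto simp: asgn_env env_def cong: bex_cong)
  then show "apo M (app M (cst M CP) n) (Some zero) = Some (suc n)" "suc n \<in> N"
    by (auto simp: suc_def)
qed

lemma suc_ne_zero: assumes "n \<in> N" shows "suc n \<noteq> zero"
  using axiom_env[OF BT_axiom.P_not_0[of 0 1], of "[((Ty 0, 0), n), ((Ty 0, 1), zero)]"]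
    assms carr_U[OF assms] pair_zero[OF assms]
  by (auto simp: asgn_env env_def)

lemma pred_suc: assumes "n \<in> N" shows "app M (cst M CP1) (suc n) = Some n"
  using axiom_env[OF BT_axiom.P1[of 0 1], of "[((Ty 0, 0), n), ((Ty 0, 1), zero)]"]
    assms carr_U[OF assms] pair_zero[OF assms]
  by (auto simp: asgn_env env_def)

lemma suc_inject: "n \<in> N \<Longrightarrow> m \<in> N \<Longrightarrow> suc n = suc m \<longleftrightarrow> n = m"
  using pred_suc by (metis option.inject)

lemma app_D: assumes "x \<in> U" "y \<in> U" "n \<in> N" "m \<in> N"
  shows "apo M (apo M (apo M (app M (cst M CD) x) (Some y)) (Some n)) (Some m) =
    Some (if n = m then x else y)"
  using axiom_env[OF BT_axiom.D_eq[of 0 1 0 1], of "[((Ty 0, 0), x), ((Ty 0, 1), y), ((Omega, 0), n), ((Omega, 1), m)]"]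
    axiom_env[OF BT_axiom.D_neq[of 0 1 0 1], of "[((Ty 0, 0), x), ((Ty 0, 1), y), ((Omega, 0), n), ((Omega, 1), m)]"]
    assms
  by (auto simp: asgn_env env_def)

text \<open>The step equation is one of partial values: it does not say that h is defined at every
  number, which has to be shown by induction in each case.\<close>

lemma recursor:
  assumes e: "asgn M e" and a: "a \<in> U" and g: "g \<in> U"
  obtains h where "h \<in> U" "apo M (apo M (ev M e recursor) (Some a)) (Some g) = Some h"
    "app M h zero = Some a"
    "\<And>m. m \<in> N \<Longrightarrow> app M h (suc m) = apo M (app M g m) (app M h m)"
proof -
  let ?t = "At (v0 2) \<^bold>\<cdot> (At CP1 \<^bold>\<cdot> At (v0 3)) \<^bold>\<cdot> (At (v0 0) \<^bold>\<cdot> At (v0 1) \<^bold>\<cdot> At (v0 2) \<^bold>\<cdot> (At CP1 \<^bold>\<cdot> At (v0 3)))"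
  let ?d = "At CD \<^bold>\<cdot> lam 4 (At (v0 1)) \<^bold>\<cdot> lam 4 ?t \<^bold>\<cdot> At (v0 3) \<^bold>\<cdot> At Zero \<^bold>\<cdot> At Zero"
  obtain G where G: "G \<in> U" "ev M e (lam 0 (lam 1 (lam 2 (lam 3 ?d)))) = Some G"
    "\<And>r. r \<in> U \<Longrightarrow> app M G r = ev M (upd 0 r e) (lam 1 (lam 2 (lam 3 ?d)))"
    using lam[OF e] by metis
  obtain R where R: "R \<in> U" "apo M (ev M e fixpoint) (Some G) = Some R"
    "\<And>x. x \<in> U \<Longrightarrow> app M R x = apo M (app M G R) (Some x)"
    using fixpoint[OF e G(1)] by blast
  have e0: "asgn M (upd 0 R e)" using e R by simp
  obtain G1 where G1: "ev M (upd 0 R e) (lam 1 (lam 2 (lam 3 ?d))) = Some G1"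
    "\<And>r. r \<in> U \<Longrightarrow> app M G1 r = ev M (upd 1 r (upd 0 R e)) (lam 2 (lam 3 ?d))"
    using lam[OF e0] by metis
  have e1: "asgn M (upd 1 a (upd 0 R e))" using e0 a by simp
  obtain G2 where G2: "ev M (upd 1 a (upd 0 R e)) (lam 2 (lam 3 ?d)) = Some G2"
    "\<And>r. r \<in> U \<Longrightarrow> app M G2 r = ev M (upd 2 r (upd 1 a (upd 0 R e))) (lam 3 ?d)"
    using lam[OF e1] by metis
  define e2 where "e2 = upd 2 g (upd 1 a (upd 0 R e))"
  have e2: "asgn M e2" using e1 g by (simp add: e2_def)
  obtain h where h: "h \<in> U" "ev M e2 (lam 3 ?d) = Some h"
    "\<And>r. r \<in> U \<Longrightarrow> app M h r = ev M (upd 3 r e2) ?d"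
    using lam[OF e2] by metis
  have RG: "app M G R = Some G1" using G R G1 by simp
  have Ra: "app M R a = Some G2" using R RG G1 G2 a by simp
  have Rag: "app M G2 g = Some h" using G2 h g by (simp add: e2_def)
  have ev: "ev M e recursor = Some R"
    using R(2) G(2) by (simp add: recursor_def Let_def)
  \<comment> \<open>Both branches are first evaluated as abstractions over a dummy variable and are
    then defined in any case; after the selection, application to zero evaluates the chosen one
    only.\<close>
  have sel: "app M h n = (if n = zero then Some a else
      apo M (apo M (Some g) (app M (cst M CP1) n)) (apo M (Some h) (app M (cst M CP1) n)))"
    if "n \<in> N" for n
  proof -
    have nU: "n \<in> U" using that carr_U by blast
    have e3: "asgn M (upd 3 n e2)" using e2 nU by simp
    obtain A where A: "A \<in> U" "ev M (upd 3 n e2) (lam 4 (At (v0 1))) = Some A"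
      "\<And>r. r \<in> U \<Longrightarrow> app M A r = ev M (upd 4 r (upd 3 n e2)) (At (v0 1))"
      using lam[OF e3] by metis
    obtain B where B: "B \<in> U" "ev M (upd 3 n e2) (lam 4 ?t) = Some B"
      "\<And>r. r \<in> U \<Longrightarrow> app M B r = ev M (upd 4 r (upd 3 n e2)) ?t"
      using lam[OF e3] by metis
    have "app M h n = apo M (Some (if n = zero then A else B)) (Some zero)"
      using h(3)[OF nU] A(2) B(2) app_D[OF A(1) B(1) that cst_U(8)]
      by simp
    also have "\<dots> = (if n = zero then Some a else
        apo M (apo M (Some g) (app M (cst M CP1) n)) (apo M (Some h) (app M (cst M CP1) n)))"
      using A(3)[of zero] B(3)[of zero] by (simp add: e2_def Ra Rag)
    finally show ?thesis .
  qed
  show thesis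
  proof (rule that[OF h(1)])
    show "apo M (apo M (ev M e recursor) (Some a)) (Some g) = Some h"
      by (simp add: ev Ra Rag)
    show "app M h zero = Some a" using sel[of zero] by simp
    show "app M h (suc m) = apo M (app M g m) (app M h m)" if "m \<in> N" for m
      using sel[OF suc_N[OF that]] suc_ne_zero[OF that] pred_suc[OF that] by simp
  qed
qed

end

section \<open>Induction inside a model\<close>

lemma bind_push: "(\<lambda>T' i. den M (push T a (push T b e)) (bind T 0 T' i)) = push T a e"
  by (intro ext) (auto simp: push_def bind_def split: nat.split)

lemma inst_push: "(\<lambda>T' i. den M e (inst T t T' i)) = push T (den M e t) e"
  by (intro ext) (auto simp: push_def inst_def split: nat.split)

lemma repl_push: "(\<lambda>T' i. den M e (repl T 0 t T' i)) = push T (den M e t) (tail T e)"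
  by (intro ext) (auto simp: push_def repl_def tail_def split: nat.split)

text \<open>The induction rule yields the induction schema with parameters when applied to
  \<open>A \<longrightarrow> \<phi>\<close>, where \<open>A\<close> collects the hypotheses of induction for \<open>\<phi>\<close>.\<close>

lemma (in bt_model) sat_induct:
  assumes "wff s \<phi>" "asgn M e" "sat M (push Omega zero e) \<phi>"
    and "\<And>n. n \<in> N \<Longrightarrow> sat M (push Omega n e) \<phi> \<Longrightarrow> sat M (push Omega (suc n) e) \<phi>"
    and "n \<in> N"
  shows "sat M (push Omega n e) \<phi>"
proof -
  define A where "A = (fsub (inst Omega Zero) \<phi> \<^bold>\<and> All Omega (\<phi> \<^bold>\<longrightarrow>
    Ex Omega (sim (pair (At (vN 1)) (At Zero)) (At (vN 0)) \<^bold>\<and> fsub (bind Omega 0) \<phi>)))"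
  define \<psi> where "\<psi> = (lift Omega A \<^bold>\<longrightarrow> \<phi>)"
  have wA: "wff s A" using assms(1) by (simp add: A_def)
  then have w: "wff s \<psi>" using assms(1) by (simp add: \<psi>_def)
  \<comment> \<open>Stated for models on an arbitrary type, since it is applied both to the term
    models behind completeness and to the model at hand.\<close>
  have sat_A: "sat M e A \<longleftrightarrow> sat M (push Omega (cst M Zero) e) \<phi> \<and>
      (\<forall>n\<in>carr M Omega. sat M (push Omega n e) \<phi> \<longrightarrow>
        sat M (push Omega (bt_model.suc M n) e) \<phi>)"
    if "bt_model s M" "asgn M e" for M :: "'v struct" and e
  proof -
    interpret M': bt_model s M by (rule that)
    show ?thesis using that(2) unfolding A_def
      by (auto simp: bind_push inst_push M'.pair_zero M'.suc_N cong: ball_cong bex_cong)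
  qed
  have "BT True s \<psi>"
  \<comment> \<open>The hypotheses A are lifted and do not mention the induction variable. Both
    premises of the rule thus hold in every model by the meaning of A, and completeness supplies
    their derivations.\<close>
  proof (rule BT.induction[of _ _ 0])
    show "BT True s (fsub (repl Omega 0 Zero) \<psi>)"
    proof (rule completeness)
      fix M :: "tm set struct" and e
      assume M: "bt_model s M" "asgn M e"
      interpret M': bt_model s M by (rule M)
      show "sat M e (fsub (repl Omega 0 Zero) \<psi>)"
        using sat_A[OF M(1), of "tail Omega e"] M(2) by (auto simp: repl_push \<psi>_def)
    qed (use w in simp)
    show "BT True s (\<psi> \<^bold>\<longrightarrow> Ex Omega (sim (pair (At (vN (Suc 0))) (At Zero)) (At (vN 0)) \<^bold>\<and>
                              fsub (bind Omega 0) \<psi>))"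
    proof (rule completeness)
      fix M :: "tm set struct" and e
      assume M: "bt_model s M" "asgn M e"
      interpret M': bt_model s M by (rule M)
      define n e' where "n = e Omega 0" and "e' = tail Omega e"
      have e: "e = push Omega n e'" "asgn M e'" "n \<in> M'.N"
        using M(2) by (simp_all add: push_tail n_def e'_def)
      show "sat M e (\<psi> \<^bold>\<longrightarrow> Ex Omega (sim (pair (At (vN (Suc 0))) (At Zero)) (At (vN 0)) \<^bold>\<and>
                              fsub (bind Omega 0) \<psi>))"
        using e(2,3) unfolding e(1) \<psi>_def
        by (auto simp: sat_A[OF M(1) e(2)] bind_push M'.pair_zero M'.suc_N intro!: bexI[of _ "M'.suc n"])
    qed (use w in simp)
  qed
  then have "sat M (push Omega n e) \<psi>" using assms by (intro model) auto
  then show ?thesis using assms sat_A[OF bt_model_axioms assms(2)] by (simp add: \<psi>_def)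
qed

subsection \<open>Addition and multiplication\<close>

context bt_model
begin

abbreviation env0 :: "ty \<Rightarrow> nat \<Rightarrow> 'u" where "env0 \<equiv> env []"

lemma asgn_env0 [simp]: "asgn M env0"
  by (simp add: asgn_env)

lemma ev_closed: "ext_vars t = {} \<Longrightarrow> ev M e t = ev M env0 t"
  by (rule ev_cong) simp

lemma zero_N: "zero \<in> N" by simp

definition op :: "ext \<Rightarrow> 'u \<Rightarrow> 'u \<Rightarrow> 'u option" where
  "op t x y = apo M (apo M (ev M env0 t) (Some x)) (Some y)"

text \<open>The common scheme of addition and multiplication. Base and step may depend on the first
  argument but not on \<open>v0 1\<close>, the recursion argument, so one h from
  \<open>recursor\<close> serves all its values.\<close>

lemma op_recursor:
  assumes vars: "(Ty 0, 1) \<notin> ext_vars A" "(Ty 0, 1) \<notin> ext_vars L" and x: "x \<in> U"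
    and A: "ev M (upd 0 x env0) A = Some a" and L: "ev M (upd 0 x env0) L = Some g"
  shows "op (lam 0 (lam 1 (recursor \<^bold>\<cdot> A \<^bold>\<cdot> L \<^bold>\<cdot> At (v0 1)))) x zero = Some a"
    and "m \<in> N \<Longrightarrow> op (lam 0 (lam 1 (recursor \<^bold>\<cdot> A \<^bold>\<cdot> L \<^bold>\<cdot> At (v0 1)))) x (suc m) =
      apo M (app M g m) (op (lam 0 (lam 1 (recursor \<^bold>\<cdot> A \<^bold>\<cdot> L \<^bold>\<cdot> At (v0 1)))) x m)"
proof -
  let ?b = "recursor \<^bold>\<cdot> A \<^bold>\<cdot> L \<^bold>\<cdot> At (v0 1)" and ?e = "upd 0 x env0"
  have e: "asgn M ?e" using x by simp
  obtain F where F: "ev M env0 (lam 0 (lam 1 ?b)) = Some F" "app M F x = ev M ?e (lam 1 ?b)"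
    using lam[OF asgn_env0] x by metis
  obtain G where G: "ev M ?e (lam 1 ?b) = Some G" "\<And>y. y \<in> U \<Longrightarrow> app M G y = ev M (upd 1 y ?e) ?b"
    using lam[OF e] by metis
  have "a \<in> U" "g \<in> U" using ev_U[OF e] A L by blast+
  from recursor[OF asgn_env0 this] obtain h where
    h: "apo M (apo M (ev M env0 recursor) (Some a)) (Some g) = Some h" "app M h zero = Some a"
    "\<And>m. m \<in> N \<Longrightarrow> app M h (suc m) = apo M (app M g m) (app M h m)" by blast
  have e1: "ev M (upd 1 y ?e) A = Some a" "ev M (upd 1 y ?e) L = Some g" for y
  proof -
    have "ev M (upd 1 y ?e) A = ev M ?e A" "ev M (upd 1 y ?e) L = ev M ?e L"
      by (rule ev_cong; use vars in \<open>auto simp: upd_def\<close>)+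
    then show "ev M (upd 1 y ?e) A = Some a" "ev M (upd 1 y ?e) L = Some g" using A L by simp_all
  qed
  have op: "op (lam 0 (lam 1 ?b)) x y = app M h y" if "y \<in> U" for y
  proof -
    have "op (lam 0 (lam 1 ?b)) x y = app M G y" by (simp only: op_def F G apo_simps)
    also have "\<dots> = app M h y"
      using that ev_closed[of recursor "upd 1 y ?e"] e1[of y] h(1) by (simp add: G del: One_nat_def)
    finally show ?thesis .
  qed
  show "op (lam 0 (lam 1 ?b)) x zero = Some a" using op h by simp
  show "op (lam 0 (lam 1 ?b)) x (suc m) = apo M (app M g m) (op (lam 0 (lam 1 ?b)) x m)" if "m \<in> N"
    using op h(3)[OF that] carr_U[OF suc_N[OF that]] carr_U[OF that] by simp
qed

text \<open>The numbers of the model may be nonstandard, so totality does not follow by iterating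
  the recursion equations; it is expressed by a formula and proved by induction in the
  model.\<close>

lemma op_total:
  assumes t: "ext_vars t = {}" "ext_ty_le s t" and x: "x \<in> N"
    and 0: "op t x zero = Some a" "a \<in> N"
    and Suc: "\<And>m z. m \<in> N \<Longrightarrow> z \<in> N \<Longrightarrow> op t x m = Some z \<Longrightarrow> \<exists>z'\<in>N. op t x (suc m) = Some z'"
    and y: "y \<in> N"
  shows "\<exists>z\<in>N. op t x y = Some z"
proof -
  \<comment> \<open>Under the quantifier for the value, index 1 is the induction variable y and
    index 2 the parameter x.\<close>
  let ?\<phi> = "Ex Omega (sim (t \<^bold>\<cdot> At (vN (Suc (Suc 0))) \<^bold>\<cdot> At (vN (Suc 0))) (At (vN 0)))"
  have e: "asgn M (push Omega x env0)" using x by simp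
  have sat: "sat M (push Omega y (push Omega x env0)) ?\<phi> \<longleftrightarrow> (\<exists>z\<in>N. op t x y = Some z)" if "y \<in> N" for y
    using that x ev_closed[OF t(1), of "push T a e" for T a e] by (simp add: op_def cong: bex_cong)
  have "sat M (push Omega y (push Omega x env0)) ?\<phi>"
  proof (rule sat_induct[OF _ e _ _ y])
    show "wff s ?\<phi>" using t by simp
    show "sat M (push Omega zero (push Omega x env0)) ?\<phi>" using sat[OF zero_N] 0 by simp
    show "sat M (push Omega (suc n) (push Omega x env0)) ?\<phi>"
      if "n \<in> N" "sat M (push Omega n (push Omega x env0)) ?\<phi>" for n
      using that(2) Suc[OF that(1)] unfolding sat[OF that(1)] sat[OF suc_N[OF that(1)]] by blast
  qed
  then show ?thesis using sat[OF y] by blast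
qed

definition plus :: "'u \<Rightarrow> 'u \<Rightarrow> 'u" where "plus x y = the (op addition x y)"
definition times :: "'u \<Rightarrow> 'u \<Rightarrow> 'u" where "times x y = the (op multiplication x y)"

text \<open>The step function discards the predecessor and pairs the previous value with zero. That
  value is assumed to be a number, since only then pairing is known to be \<open>suc\<close>;
  \<open>op_total\<close> removes the assumption.\<close>

lemma op_addition_rec:
  assumes x: "x \<in> N"
  shows "op addition x zero = Some x"
    and "m \<in> N \<Longrightarrow> z \<in> N \<Longrightarrow> op addition x m = Some z \<Longrightarrow> op addition x (suc m) = Some (suc z)"
proof -
  let ?L = "lam 2 (lam 3 (pair (At (v0 3)) (At Zero)))" and ?e = "upd 0 x env0"
  have e: "asgn M ?e" using x carr_U by simp
  obtain g where g: "ev M ?e ?L = Some g"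
    "\<And>m. m \<in> U \<Longrightarrow> app M g m = ev M (upd 2 m ?e) (lam 3 (pair (At (v0 3)) (At Zero)))"
    using lam[OF e] by metis
  note r = op_recursor[of "At (v0 0)" ?L x x g, folded addition_def]
  show "op addition x zero = Some x" using r(1) g carr_U[OF x] by simp
  show "op addition x (suc m) = Some (suc z)" if "m \<in> N" "z \<in> N" "op addition x m = Some z"
  proof -
    have e': "asgn M (upd 2 m ?e)" using e carr_U[OF that(1)] by simp
    obtain G where G: "ev M (upd 2 m ?e) (lam 3 (pair (At (v0 3)) (At Zero))) = Some G"
      "\<And>y. y \<in> U \<Longrightarrow> app M G y = ev M (upd 3 y (upd 2 m ?e)) (pair (At (v0 3)) (At Zero))"
      using lam[OF e'] by metis
    have "op addition x (suc m) = apo M (app M g m) (op addition x m)"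
      using r(2) g carr_U[OF x] that(1) by simp
    also have "\<dots> = Some (suc z)"
      using that g(2)[OF carr_U[OF that(1)]] G carr_U[OF that(2)] pair_zero[OF that(2)] by simp
    finally show ?thesis .
  qed
qed

lemma op_addition:
  assumes "x \<in> N" "y \<in> N" shows "op addition x y = Some (plus x y)" and plus_N: "plus x y \<in> N"
proof -
  have "\<exists>z\<in>N. op addition x y = Some z"
  proof (rule op_total[OF _ _ assms(1) op_addition_rec(1) _ _ assms(2)])
    show "\<exists>z'\<in>N. op addition x (suc m) = Some z'"
      if "m \<in> N" "z \<in> N" "op addition x m = Some z" for m z
      using op_addition_rec(2)[OF assms(1) that] suc_N[OF that(2)] by blast
  qed (use assms in simp_all)
  then show "op addition x y = Some (plus x y)" "plus x y \<in> N" by (auto simp: plus_def)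
qed

lemma plus_zero: "x \<in> N \<Longrightarrow> plus x zero = x"
  using op_addition_rec(1) by (simp add: plus_def)

lemma plus_suc: "x \<in> N \<Longrightarrow> y \<in> N \<Longrightarrow> plus x (suc y) = suc (plus x y)"
  using op_addition_rec(2)[OF _ _ plus_N op_addition(1)] by (simp add: plus_def[of x "suc y"])

lemma op_multiplication_rec:
  assumes x: "x \<in> N"
  shows "op multiplication x zero = Some zero"
    and "m \<in> N \<Longrightarrow> z \<in> N \<Longrightarrow> op multiplication x m = Some z \<Longrightarrow>
      op multiplication x (suc m) = Some (plus z x)"
proof -
  let ?L = "lam 2 (lam 3 (addition \<^bold>\<cdot> At (v0 3) \<^bold>\<cdot> At (v0 0)))" and ?e = "upd 0 x env0"
  have e: "asgn M ?e" using x carr_U by simp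
  obtain g where g: "ev M ?e ?L = Some g"
    "\<And>m. m \<in> U \<Longrightarrow> app M g m = ev M (upd 2 m ?e) (lam 3 (addition \<^bold>\<cdot> At (v0 3) \<^bold>\<cdot> At (v0 0)))"
    using lam[OF e] by metis
  note r = op_recursor[of "At Zero" ?L x zero g, folded multiplication_def]
  show "op multiplication x zero = Some zero" using r(1) g carr_U[OF x] by simp
  show "op multiplication x (suc m) = Some (plus z x)" if "m \<in> N" "z \<in> N" "op multiplication x m = Some z"
  proof -
    have e': "asgn M (upd 2 m ?e)" using e carr_U[OF that(1)] by simp
    obtain G where G: "ev M (upd 2 m ?e) (lam 3 (addition \<^bold>\<cdot> At (v0 3) \<^bold>\<cdot> At (v0 0))) = Some G"
      "\<And>y. y \<in> U \<Longrightarrow> app M G y = ev M (upd 3 y (upd 2 m ?e)) (addition \<^bold>\<cdot> At (v0 3) \<^bold>\<cdot> At (v0 0))"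
      using lam[OF e'] by metis
    have "op multiplication x (suc m) = apo M (app M g m) (op multiplication x m)"
      using r(2) g carr_U[OF x] that(1) by simp
    also have "\<dots> = op addition z x"
      using that g(2)[OF carr_U[OF that(1)]] G carr_U[OF that(2)] ev_closed[of addition "upd i a e" for i a e]
      by (simp add: op_def)
    finally show ?thesis using op_addition[OF that(2) x] by simp
  qed
qed

lemma op_multiplication:
  assumes "x \<in> N" "y \<in> N" shows "op multiplication x y = Some (times x y)" and times_N: "times x y \<in> N"
proof -
  have "\<exists>z\<in>N. op multiplication x y = Some z"
  proof (rule op_total[OF _ _ assms(1) op_multiplication_rec(1) _ _ assms(2)])
    show "\<exists>z'\<in>N. op multiplication x (suc m) = Some z'"
      if "m \<in> N" "z \<in> N" "op multiplication x m = Some z" for m z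
      using op_multiplication_rec(2)[OF assms(1) that] plus_N[OF that(2) assms(1)] by blast
  qed (use assms in simp_all)
  then show "op multiplication x y = Some (times x y)" "times x y \<in> N" by (auto simp: times_def)
qed

lemma times_zero: "x \<in> N \<Longrightarrow> times x zero = zero"
  using op_multiplication_rec(1) by (simp add: times_def)

lemma times_suc: "x \<in> N \<Longrightarrow> y \<in> N \<Longrightarrow> times x (suc y) = plus (times x y) x"
  using op_multiplication_rec(2)[OF _ _ times_N op_multiplication(1)] by (simp add: times_def[of x "suc y"])

primrec sev :: "(ty \<Rightarrow> nat \<Rightarrow> 'u) \<Rightarrow> stm \<Rightarrow> 'u" where
  "sev e (SVar i) = e Omega i"
| "sev e S0 = zero"
| "sev e S1 = suc zero"
| "sev e (SAdd t u) = plus (sev e t) (sev e u)"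
| "sev e (SMul t u) = times (sev e t) (sev e u)"

lemma sev_N [simp]: "asgn M e \<Longrightarrow> sev e t \<in> N"
  by (induction t) (auto simp: suc_N plus_N times_N)

lemma ev_arith_tm [simp]: "asgn M e \<Longrightarrow> ev M e (arith_tm t) = Some (sev e t)"
proof (induction t)
  case (SAdd t u)
  then show ?case
    using op_addition[of "sev e t" "sev e u"] ev_closed[of addition e] by (simp add: op_def)
next
  case (SMul t u)
  then show ?case
    using op_multiplication[of "sev e t" "sev e u"] ev_closed[of multiplication e] by (simp add: op_def)
qed (use pair_zero[OF zero_N] in auto)

end

subsection \<open>Comprehension\<close>

lemma ty_le_mono: "ty_le T m \<Longrightarrow> m \<le> n \<Longrightarrow> ty_le T n"
  by (cases T) auto

lemma wff_mono: "wff m \<phi> \<Longrightarrow> m \<le> n \<Longrightarrow> wff n \<phi>"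
proof (induction \<phi>)
  case (Atom a)
  then show ?case by (cases a) (auto intro: ty_le_mono)
qed (auto intro: ty_le_mono)

lemma ext_ty_le_app_tuple:
  assumes "ext_ty_le n t" "\<And>u. u \<in> set ts \<Longrightarrow> ext_ty_le n u" shows "ext_ty_le n (app_tuple t ts)"
proof (cases ts)
  case (Cons u us)
  have "ext_ty_le n v \<Longrightarrow> (\<And>u. u \<in> set us \<Longrightarrow> ext_ty_le n u) \<Longrightarrow> ext_ty_le n (foldl pair v us)" for v
    by (induction us arbitrary: v) auto
  then show ?thesis using assms Cons by simp
qed (use assms in simp)

lemma push_commute: "T \<noteq> T' \<Longrightarrow> push T a (push T' b e) = push T' b (push T a e)"
  by (intro ext) (auto simp: push_def split: nat.split)

lemma no_top_type_fsub [simp]: "no_top_type n (fsub \<sigma> \<phi>) \<longleftrightarrow> no_top_type n \<phi>"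
proof (induction \<phi> arbitrary: \<sigma>)
  case (Atom a)
  then show ?case by (cases a) auto
qed auto

lemma no_top_type_val [simp]: "ext_ty_le k t \<Longrightarrow> no_top_type (Suc k) (val t x)"
  by (induction t x rule: val.induct) (auto simp: val.simps)

lemma no_top_type_sim [simp]:
  "ext_ty_le k t \<Longrightarrow> ext_ty_le k u \<Longrightarrow> no_top_type (Suc k) (sim t u)"
  by (auto simp: sim_def)

context bt_model
begin

lemma comprehension:
  assumes "elementary (Suc k) \<phi>" "outer_vars (Ty k) (fv \<phi>) \<subseteq> set X"
    "\<forall>(T, i)\<in>set X. ty_le T (Suc k)" "Suc k \<le> s" "asgn M e"
  obtains A where "A \<in> carr M (Ty (Suc k))"
    "ev M e (app_tuple (At (CC (gn k X \<phi>))) (map (\<lambda>(T, i). At (Var T i)) X)) = Some A"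
    "\<And>Z. Z \<in> carr M (Ty k) \<Longrightarrow> mbr M k Z A \<longleftrightarrow> sat M (push (Ty k) Z e) \<phi>"
proof -
  let ?t = "app_tuple (At (CC (gn k X \<phi>))) (map (\<lambda>(T, i). At (Var T i)) X)"
  let ?a = "Ex (Ty (Suc k)) (sim (elift (Ty (Suc k)) ?t) (At (vT (Suc k) 0)) \<^bold>\<and>
       All (Ty k) (In k (vT k 0) (vT (Suc k) 0) \<^bold>\<longleftrightarrow> lift (Ty (Suc k)) \<phi>))"
  have "ext_ty_le s ?t"
    using assms(3) ty_le_mono[OF _ assms(4)] by (fastforce intro!: ext_ty_le_app_tuple)
  moreover have "wff s \<phi>" using assms(1,4) wff_mono by (auto simp: elementary_def)
  ultimately have "BT True s ?a"
    using assms by (intro BT.axiom BT_axiom.comprehension) auto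
  then have "sat M e ?a" using assms(5) by (rule model)
  then obtain A where "A \<in> carr M (Ty (Suc k))" "ev M e ?t = Some A"
    "\<forall>Z\<in>carr M (Ty k). mbr M k Z A \<longleftrightarrow> sat M (push (Ty k) Z e) \<phi>"
    using assms(5) by (auto simp: push_commute[of "Ty k" "Ty (Suc k)"] cong: bex_cong)
  then show thesis using that by blast
qed

text \<open>Where only the existence of the set matters and not the constant that yields it, any
  listing of the free variables can serve as parameter list.\<close>

lemma comprehension_fv:
  assumes "elementary (Suc k) \<phi>" "Suc k \<le> s" "asgn M e"
  obtains A where "A \<in> carr M (Ty (Suc k))"
    "\<And>Z. Z \<in> carr M (Ty k) \<Longrightarrow> mbr M k Z A \<longleftrightarrow> sat M (push (Ty k) Z e) \<phi>"
proof -
  obtain X where X: "set X = outer_vars (Ty k) (fv \<phi>)"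
    using finite_list[OF finite_outer_vars[OF finite_fv]] by blast
  have "\<forall>(T, i)\<in>set X. ty_le T (Suc k)"
    using assms(1) X ty_le_fv by (auto simp: elementary_def outer_vars_def)
  with assms X show thesis using comprehension[of k \<phi> X e] that by blast
qed

section \<open>Iterated singletons in a model\<close>

primrec isg :: "nat \<Rightarrow> 'u \<Rightarrow> 'u" where
  "isg 0 n = n"
| "isg (Suc k) n = the (apo M (ev M env0 (singleton k)) (Some (isg k n)))"

text \<open>Objects are not assumed to be extensional, so having X as its only element does not
  determine A. It has to be the value of the very constant that the translation uses.\<close>

lemma singleton:
  assumes "X \<in> carr M (Ty k)" "Suc k \<le> s"
  obtains A where "A \<in> carr M (Ty (Suc k))" "apo M (ev M env0 (singleton k)) (Some X) = Some A"
    "\<And>Z. Z \<in> carr M (Ty k) \<Longrightarrow> mbr M k Z A \<longleftrightarrow> Z = X"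
proof -
  let ?\<phi> = "sim (At (vT k 0)) (At (vT k 1))"
  have el: "elementary (Suc k) ?\<phi>" by (simp add: elementary_def)
  have fv: "outer_vars (Ty k) (fv ?\<phi>) \<subseteq> set [(Ty k, 0)]"
    by (auto simp: sim_def outer_vars_def shift_def val.simps split: if_splits)
  have e: "asgn M (push (Ty k) X env0)" using assms by simp
  obtain A where A: "A \<in> carr M (Ty (Suc k))"
    "ev M (push (Ty k) X env0) (app_tuple (At (CC (gn k [(Ty k, 0)] ?\<phi>)))
      (map (\<lambda>(T, i). At (Var T i)) [(Ty k, 0)])) = Some A"
    "\<And>Z. Z \<in> carr M (Ty k) \<Longrightarrow> mbr M k Z A \<longleftrightarrow> sat M (push (Ty k) Z (push (Ty k) X env0)) ?\<phi>"
    using comprehension[OF el fv _ assms(2) e] by auto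
  show thesis
  proof (rule that[OF A(1)])
    show "apo M (ev M env0 (singleton k)) (Some X) = Some A"
      using A(2) by (simp add: singleton_def)
    show "mbr M k Z A \<longleftrightarrow> Z = X" if "Z \<in> carr M (Ty k)" for Z
      using A(3)[OF that] e that by (simp add: eq_commute)
  qed
qed

lemma isg_carr: "n \<in> N \<Longrightarrow> k \<le> s \<Longrightarrow> isg k n \<in> carr M (Ty k)"
proof (induction k)
  case (Suc k)
  then have "isg k n \<in> carr M (Ty k)" by simp
  from singleton[OF this Suc.prems(2)] show ?case by force
qed (auto intro: carr_U)

lemma isg_Suc:
  assumes "n \<in> N" "Suc k \<le> s"
  shows "apo M (ev M env0 (singleton k)) (Some (isg k n)) = Some (isg (Suc k) n)"
    and "Z \<in> carr M (Ty k) \<Longrightarrow> mbr M k Z (isg (Suc k) n) \<longleftrightarrow> Z = isg k n"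
proof -
  have "isg k n \<in> carr M (Ty k)" using assms isg_carr by simp
  from singleton[OF this assms(2)] obtain A where
    "apo M (ev M env0 (singleton k)) (Some (isg k n)) = Some A"
    "\<And>Z. Z \<in> carr M (Ty k) \<Longrightarrow> mbr M k Z A \<longleftrightarrow> Z = isg k n" by blast
  then show "apo M (ev M env0 (singleton k)) (Some (isg k n)) = Some (isg (Suc k) n)"
    "Z \<in> carr M (Ty k) \<Longrightarrow> mbr M k Z (isg (Suc k) n) \<longleftrightarrow> Z = isg k n" by simp_all
qed

text \<open>The object \<open>isg k n\<close> is the only element of \<open>isg (Suc k) n\<close>,
  so equality descends one type at a time.\<close>

lemma isg_inject: "n \<in> N \<Longrightarrow> m \<in> N \<Longrightarrow> k \<le> s \<Longrightarrow> isg k n = isg k m \<longleftrightarrow> n = m"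
proof (induction k)
  case (Suc k)
  then have "isg k n \<in> carr M (Ty k)" using isg_carr by simp
  with Suc isg_Suc(2)[of n k "isg k n"] isg_Suc(2)[of m k "isg k n"] show ?case by auto
qed simp

lemma ev_iter_singleton:
  assumes "ev M e t = Some n" "n \<in> N" "k \<le> s"
  shows "ev M e (iter_singleton k t) = Some (isg k n)"
  using assms(3)
proof (induction k)
  case (Suc k)
  have "ev M e (singleton k) = ev M env0 (singleton k)" by (simp add: singleton_def)
  then show ?case using Suc isg_Suc(1)[OF assms(2)] by simp
qed (use assms in simp)

end

lemma ext_ty_le_iter_singleton [simp]: "ext_ty_le n (iter_singleton k t) \<longleftrightarrow> ext_ty_le n t"
  by (induction k) (auto simp: singleton_def)

lemma wff_ext_in [simp]:
  "type_of Y = Ty (Suc k) \<Longrightarrow> Suc k \<le> n \<Longrightarrow> wff n (ext_in k t Y) \<longleftrightarrow> ext_ty_le n t"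
  by (auto simp: ext_in_def)

lemma wff_MM [simp]: "1 \<le> k \<Longrightarrow> k \<le> n \<Longrightarrow> wff n (MM k i)"
  by (auto simp: MM_def)

lemma wff_star: "swff n \<phi> \<Longrightarrow> wff n (star \<phi>)"
  by (induction \<phi> rule: star.induct) auto

section \<open>Interpretation of SA\<close>

lemma no_top_type_ext_in [simp]:
  "j \<le> k \<Longrightarrow> ext_ty_le k t \<Longrightarrow> no_top_type (Suc k) (ext_in j t Y)"
  by (auto simp: ext_in_def)

lemma no_top_type_MM [simp]: "1 \<le> j \<Longrightarrow> j \<le> Suc k \<Longrightarrow> no_top_type (Suc k) (MM j i)"
  by (auto simp: MM_def)

text \<open>Without set quantifiers, \<open>star\<close> quantifies over numbers, over type 0 in
  \<open>sim\<close>, and over the type one below the sort in a membership atom, hence never over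
  type k + 1. This is why simple formulas of SA fall under elementary comprehension.\<close>

lemma no_top_type_star: "swff (Suc k) \<phi> \<Longrightarrow> no_set_quant \<phi> \<Longrightarrow> no_top_type (Suc k) (star \<phi>)"
  by (induction \<phi> rule: star.induct) auto

lemma sort_ok_mono: "sort_ok m T \<Longrightarrow> m \<le> n \<Longrightarrow> sort_ok n T"
  by (cases T) auto

lemma swff_mono: "swff m \<phi> \<Longrightarrow> m \<le> n \<Longrightarrow> swff n \<phi>"
proof (induction \<phi>)
  case (Atom a)
  then show ?case by (cases a) auto
qed (auto intro: sort_ok_mono)

lemma sort_ok_free_list: "swff n \<phi> \<Longrightarrow> (T, i) \<in> set (free_list \<phi>) \<Longrightarrow> sort_ok n T"
proof (induction \<phi> arbitrary: T i)
  case (Atom a)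
  then show ?case by (cases a) auto
qed (auto simp: outer_list_def)

context bt_model
begin

text \<open>The objects satisfying \<open>MM\<close>. Types that are not sorts of the fragment are
  left unrestricted, so that total assignments into \<open>sdom\<close> exist.\<close>

definition sdom :: "ty \<Rightarrow> 'u set" where
  "sdom T = {X \<in> carr M T. \<forall>k. T = Ty k \<longrightarrow> 1 \<le> k \<longrightarrow> k \<le> s \<longrightarrow>
     (\<forall>Z\<in>carr M (Ty (k - 1)). mbr M (k - 1) Z X \<longrightarrow> (\<exists>n\<in>N. isg (k - 1) n = Z))}"

lemma sdom_Omega [simp]: "sdom Omega = N"
  by (simp add: sdom_def)

lemma sdom_carr: "X \<in> sdom T \<Longrightarrow> X \<in> carr M T"
  by (simp add: sdom_def)

primrec satm :: "(ty \<Rightarrow> nat \<Rightarrow> 'u) \<Rightarrow> satom \<Rightarrow> bool" where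
  "satm e (SEqA t u) \<longleftrightarrow> sev e t = sev e u"
| "satm e (SInA k t i) \<longleftrightarrow> mbr M (k - 1) (isg (k - 1) (sev e t)) (e (Ty k) i)"

primrec ssat :: "(ty \<Rightarrow> nat \<Rightarrow> 'u) \<Rightarrow> sfm \<Rightarrow> bool" where
  "ssat e (Atom a) \<longleftrightarrow> satm e a"
| "ssat e Bot \<longleftrightarrow> False"
| "ssat e (\<phi> \<^bold>\<and> \<psi>) \<longleftrightarrow> ssat e \<phi> \<and> ssat e \<psi>"
| "ssat e (\<phi> \<^bold>\<or> \<psi>) \<longleftrightarrow> ssat e \<phi> \<or> ssat e \<psi>"
| "ssat e (\<phi> \<^bold>\<longrightarrow> \<psi>) \<longleftrightarrow> (ssat e \<phi> \<longrightarrow> ssat e \<psi>)"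
| "ssat e (All T \<phi>) \<longleftrightarrow> (\<forall>a\<in>sdom T. ssat (push T a e) \<phi>)"
| "ssat e (Ex T \<phi>) \<longleftrightarrow> (\<exists>a\<in>sdom T. ssat (push T a e) \<phi>)"

lemma ssat_Neg [simp]: "ssat e (Neg \<phi>) \<longleftrightarrow> \<not> ssat e \<phi>"
  and ssat_Iff [simp]: "ssat e (\<phi> \<^bold>\<longleftrightarrow> \<psi>) \<longleftrightarrow> (ssat e \<phi> \<longleftrightarrow> ssat e \<psi>)"
  by (auto simp: Neg_def Iff_def)

lemma sat_MM:
  assumes "asgn M e" "X \<in> carr M (Ty k)" "1 \<le> k" "k \<le> s"
  shows "sat M (push (Ty k) X e) (MM k 0) \<longleftrightarrow> X \<in> sdom (Ty k)"
proof -
  obtain j where k: "k = Suc j" using assms(3) by (cases k) auto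
  have iter: "ev M e (iter_singleton j (At (vN 0))) = Some (isg j (e Omega 0))"
    if "asgn M e" for e
    using that assms(4) k by (intro ev_iter_singleton) auto
  show ?thesis
    using assms by (auto simp: MM_def sdom_def iter k cong: ball_cong bex_cong)
qed

text \<open>By \<open>sat_MM\<close> the relativised quantifiers range exactly over
  \<open>sdom\<close>. Free set variables are not restricted here.\<close>

lemma sat_star: "swff s \<phi> \<Longrightarrow> asgn M e \<Longrightarrow> sat M e (star \<phi>) \<longleftrightarrow> ssat e \<phi>"
proof (induction \<phi> arbitrary: e rule: star.induct)
  case (2 k t i)
  then have "ev M e (iter_singleton (k - 1) (arith_tm t)) = Some (isg (k - 1) (sev e t))"
    by (intro ev_iter_singleton) auto
  moreover have "isg (k - 1) (sev e t) \<in> carr M (Ty (k - 1))"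
    using 2 by (intro isg_carr) auto
  ultimately show ?case using 2 by auto
next
  case (9 k \<phi>)
  have "sat M (push (Ty k) X e) (MM k 0 \<^bold>\<longrightarrow> star \<phi>) \<longleftrightarrow> (X \<in> sdom (Ty k) \<longrightarrow> ssat (push (Ty k) X e) \<phi>)"
    if "X \<in> carr M (Ty k)" for X
    using that 9 sat_MM[of e X k] by simp
  then show ?case using sdom_carr by auto
next
  case (10 k \<phi>)
  have "sat M (push (Ty k) X e) (MM k 0 \<^bold>\<and> star \<phi>) \<longleftrightarrow> (X \<in> sdom (Ty k) \<and> ssat (push (Ty k) X e) \<phi>)"
    if "X \<in> carr M (Ty k)" for X
    using that 10 sat_MM[of e X k] by simp
  then show ?case using sdom_carr by auto
qed auto

section \<open>Substitution in formulas of SA\<close>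

definition ren :: "(nat \<Rightarrow> stm) \<Rightarrow> (nat \<Rightarrow> nat \<Rightarrow> nat) \<Rightarrow> (ty \<Rightarrow> nat \<Rightarrow> 'u) \<Rightarrow> ty \<Rightarrow> nat \<Rightarrow> 'u" where
  "ren \<sigma> \<rho> e T i = (case T of Omega \<Rightarrow> sev e (\<sigma> i) | Ty k \<Rightarrow> e (Ty k) (\<rho> k i))"

lemma ren_simps [simp]: "ren \<sigma> \<rho> e Omega i = sev e (\<sigma> i)" "ren \<sigma> \<rho> e (Ty k) i = e (Ty k) (\<rho> k i)"
  by (simp_all add: ren_def)

lemma sev_cong: "(\<And>i. e Omega i = e' Omega i) \<Longrightarrow> sev e t = sev e' t"
  by (induction t) auto

lemma sev_push_Ty [simp]: "sev (push (Ty k) a e) t = sev e t"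
  by (rule sev_cong) simp

lemma sev_stsub: "sev e (stsub \<sigma> t) = sev (ren \<sigma> \<rho> e) t"
  by (induction t) auto

lemma sev_shift [simp]: "sev (push Omega a e) (stsub (\<lambda>l. SVar (Suc l)) t) = sev e t"
  unfolding sev_stsub[where \<rho> = "\<lambda>k i. i"] by (rule sev_cong) simp

lemma ren_under: "ren (num_under T \<sigma>) (set_under T \<rho>) (push T a e) = push T a (ren \<sigma> \<rho> e)"
proof (intro ext)
  fix T' i
  show "ren (num_under T \<sigma>) (set_under T \<rho>) (push T a e) T' i = push T a (ren \<sigma> \<rho> e) T' i"
    by (cases T; cases T') (auto simp: push_def split: nat.split)
qed

lemma ssat_ssub [simp]: "ssat e (ssub \<sigma> \<rho> \<phi>) \<longleftrightarrow> ssat (ren \<sigma> \<rho> e) \<phi>"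
proof (induction \<phi> arbitrary: e \<sigma> \<rho>)
  case (Atom a)
  then show ?case by (cases a) (auto simp: sev_stsub[where \<rho> = \<rho>])
qed (auto simp: ren_under)

lemma ren_ninst [simp]: "ren (ninst t) (\<lambda>k i. i) e = push Omega (sev e t) e"
  by (intro ext) (auto simp: ren_def push_def ninst_def split: ty.split nat.split)

lemma ren_set_inst [simp]: "ren SVar ((\<lambda>k i. i)(k := set_inst y)) e = push (Ty k) (e (Ty k) y) e"
  by (intro ext) (auto simp: ren_def push_def set_inst_def split: ty.split nat.split)

lemma ssat_slift [simp]: "ssat (push T a e) (slift T \<phi>) \<longleftrightarrow> ssat e \<phi>"
proof -
  have "ren (\<lambda>i. SVar (Suc i)) (\<lambda>k i. i) (push Omega a e) = e"
    "ren SVar ((\<lambda>k i. i)(k := Suc)) (push (Ty k) a e) = e" for k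
    by (intro ext; auto simp: ren_def push_def split: ty.split)+
  then show ?thesis by (cases T) auto
qed

text \<open>Serves to discard the set of sort k + 1 in the choice axiom and to correct an assignment
  outside the free variables of a formula.\<close>

lemma ssat_cong:
  "(\<And>T i. (T, i) \<in> set (free_list \<phi>) \<Longrightarrow> e T i = e' T i) \<Longrightarrow> ssat e \<phi> \<longleftrightarrow> ssat e' \<phi>"
proof (induction \<phi> arbitrary: e e')
  case (Atom a)
  have sev: "(\<And>i. i \<in> set (stm_vars t) \<Longrightarrow> e Omega i = e' Omega i) \<Longrightarrow> sev e t = sev e' t" for t
    by (induction t) auto
  show ?case
  proof (cases a)
    case (SEqA t u)
    then have "sev e t = sev e' t" "sev e u = sev e' u"
      by (auto intro!: sev Atom.prems)
    then show ?thesis using SEqA by simp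
  next
    case (SInA k t i)
    then have "sev e t = sev e' t" "e (Ty k) i = e' (Ty k) i"
      by (auto intro!: sev Atom.prems)
    then show ?thesis using SInA by simp
  qed
next
  case (And \<phi> \<psi>)
  have "ssat e \<phi> = ssat e' \<phi>" "ssat e \<psi> = ssat e' \<psi>"
    by (rule And.IH, rule And.prems, simp)+
  then show ?case by simp
next
  case (Or \<phi> \<psi>)
  have "ssat e \<phi> = ssat e' \<phi>" "ssat e \<psi> = ssat e' \<psi>"
    by (rule Or.IH, rule Or.prems, simp)+
  then show ?case by simp
next
  case (Imp \<phi> \<psi>)
  have "ssat e \<phi> = ssat e' \<phi>" "ssat e \<psi> = ssat e' \<psi>"
    by (rule Imp.IH, rule Imp.prems, simp)+
  then show ?case by simp
next
  case (All T \<phi>)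
  have "push T a e T' i = push T a e' T' i" if "(T', i) \<in> set (free_list \<phi>)" for a T' i
    using that All.prems[of T' "if T' = T then i - 1 else i"]
    by (cases i) (force simp: outer_list_def push_def)+
  then have "ssat (push T a e) \<phi> = ssat (push T a e') \<phi>" for a by (rule All.IH)
  then show ?case by simp
next
  case (Ex T \<phi>)
  have "push T a e T' i = push T a e' T' i" if "(T', i) \<in> set (free_list \<phi>)" for a T' i
    using that Ex.prems[of T' "if T' = T then i - 1 else i"]
    by (cases i) (force simp: outer_list_def push_def)+
  then have "ssat (push T a e) \<phi> = ssat (push T a e') \<phi>" for a by (rule Ex.IH)
  then show ?case by simp
qed simp

subsection \<open>Arithmetic in a model\<close>

text \<open>Every formula of the fragment is expressed in BT by \<open>star\<close>, so induction of
  BT applies to it.\<close>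

lemma ssat_induct:
  assumes "swff s \<phi>" "asgn M e" "ssat (push Omega zero e) \<phi>"
    and "\<And>n. n \<in> N \<Longrightarrow> ssat (push Omega n e) \<phi> \<Longrightarrow> ssat (push Omega (suc n) e) \<phi>"
    and "n \<in> N"
  shows "ssat (push Omega n e) \<phi>"
proof -
  have eq: "sat M (push Omega n e) (star \<phi>) \<longleftrightarrow> ssat (push Omega n e) \<phi>" if "n \<in> N" for n
    using assms(1,2) that by (intro sat_star) auto
  have "sat M (push Omega n e) (star \<phi>)"
    by (rule sat_induct[OF wff_star[OF assms(1)] assms(2) _ _ assms(5)])
      (use assms(3,4) eq suc_N in auto)
  then show ?thesis using eq assms(5) by simp
qed

text \<open>Holds the parameters of an induction: once the induction variable is pushed as index 0,
  x has index 1 and y index 2.\<close>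

definition num_env :: "'u \<Rightarrow> 'u \<Rightarrow> ty \<Rightarrow> nat \<Rightarrow> 'u" where
  "num_env x y = push Omega x (push Omega y env0)"

lemma asgn_num_env: "x \<in> N \<Longrightarrow> y \<in> N \<Longrightarrow> asgn M (num_env x y)"
  by (simp add: num_env_def)

lemmas num_simps = num_env_def suc_N plus_N times_N plus_zero plus_suc times_zero times_suc

abbreviation (input) X0 :: stm where "X0 \<equiv> SVar 0"
abbreviation (input) X1 :: stm where "X1 \<equiv> SVar (Suc 0)"
abbreviation (input) X2 :: stm where "X2 \<equiv> SVar (Suc (Suc 0))"

lemma zero_plus: assumes "x \<in> N" shows "plus zero x = x"
  using ssat_induct[of "SEq (SAdd S0 X0) X0" env0 x] assms by (simp add: num_simps)

lemma suc_plus: assumes "x \<in> N" "y \<in> N" shows "plus (suc x) y = suc (plus x y)"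
  using ssat_induct[of "SEq (SAdd (SAdd X1 S1) X0) (SAdd (SAdd X1 X0) S1)" "num_env x x" y]
    asgn_num_env assms by (simp add: num_simps)

lemma plus_commute: assumes "x \<in> N" "y \<in> N" shows "plus x y = plus y x"
  using ssat_induct[of "SEq (SAdd X1 X0) (SAdd X0 X1)" "num_env x x" y]
    asgn_num_env assms by (simp add: num_simps zero_plus suc_plus)

lemma plus_assoc: assumes "x \<in> N" "y \<in> N" "z \<in> N" shows "plus (plus x y) z = plus x (plus y z)"
  using ssat_induct[of "SEq (SAdd (SAdd X1 X2) X0) (SAdd X1 (SAdd X2 X0))" "num_env x y" z]
    asgn_num_env assms by (simp add: num_simps)

lemma plus_cancel: assumes "x \<in> N" "y \<in> N" "z \<in> N" shows "plus x z = plus y z \<longleftrightarrow> x = y"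
  using ssat_induct[of "SEq (SAdd X1 X0) (SAdd X2 X0) \<^bold>\<longrightarrow> SEq X1 X2" "num_env x y" z]
    asgn_num_env assms by (auto simp: num_simps suc_inject)

lemma times_plus: assumes "x \<in> N" "y \<in> N" "z \<in> N"
  shows "times x (plus y z) = plus (times x y) (times x z)"
  using ssat_induct[of "SEq (SMul X1 (SAdd X2 X0)) (SAdd (SMul X1 X2) (SMul X1 X0))" "num_env x y" z]
    asgn_num_env assms by (simp add: num_simps plus_assoc)

lemma plus_left_commute:
  assumes "x \<in> N" "y \<in> N" "z \<in> N" shows "plus x (plus y z) = plus y (plus x z)"
  using assms plus_assoc plus_commute by metis

lemma plus_times: assumes "x \<in> N" "y \<in> N" "z \<in> N"
  shows "times (plus x y) z = plus (times x z) (times y z)"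
  using ssat_induct[of "SEq (SMul (SAdd X1 X2) X0) (SAdd (SMul X1 X0) (SMul X2 X0))" "num_env x y" z]
    asgn_num_env assms by (simp add: num_simps plus_assoc plus_left_commute)

lemma zero_or_suc: assumes "x \<in> N" shows "x = zero \<or> (\<exists>y\<in>N. x = suc y)"
  using ssat_induct[of "SEq X0 S0 \<^bold>\<or> Ex Omega (SEq X1 (SAdd X0 S1))" env0 x] assms
  by (auto simp: num_simps suc_inject)

text \<open>Comparability by induction on x. Stating it with a difference z avoids introducing an
  order on the numbers of the model.\<close>

lemma linear: assumes "x \<in> N" "y \<in> N" shows "\<exists>z\<in>N. x = plus y z \<or> y = plus x z"
proof -
  let ?\<phi> = "Ex Omega (SEq X1 (SAdd X2 X0) \<^bold>\<or> SEq X2 (SAdd X1 X0))"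
  have sat: "ssat (push Omega x (num_env y y)) ?\<phi> \<longleftrightarrow> (\<exists>z\<in>N. x = plus y z \<or> y = plus x z)" for x
    by (simp add: num_env_def)
  have "ssat (push Omega x (num_env y y)) ?\<phi>"
  proof (rule ssat_induct[OF _ asgn_num_env[OF assms(2) assms(2)] _ _ assms(1)])
    show "ssat (push Omega zero (num_env y y)) ?\<phi>"
      unfolding sat using zero_plus[OF assms(2)] assms(2) by metis
    show "ssat (push Omega (suc n) (num_env y y)) ?\<phi>"
      if n: "n \<in> N" and IH: "ssat (push Omega n (num_env y y)) ?\<phi>" for n
    proof -
      obtain z where z: "z \<in> N" "n = plus y z \<or> y = plus n z"
        using IH unfolding sat by blast
      show ?thesis unfolding sat
      proof (cases "n = plus y z")
        case True
        then show "\<exists>z\<in>N. suc n = plus y z \<or> y = plus (suc n) z"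
          using z plus_suc[OF assms(2) z(1)] suc_N[OF z(1)] by metis
      next
        case False
        \<comment> \<open>If z is zero, then \<open>suc n\<close> exceeds y by one; otherwise
          lowering z by one compensates for the successor.\<close>
        then have y: "y = plus n z" using z by blast
        show "\<exists>z\<in>N. suc n = plus y z \<or> y = plus (suc n) z"
        proof (cases "z = zero")
          case True
          then have "suc n = plus y (suc zero)"
            using y n by (simp add: num_simps)
          then show ?thesis using suc_N[OF zero_N] by blast
        next
          case False
          then obtain w where "w \<in> N" "z = suc w" using zero_or_suc[OF z(1)] by blast
          then show ?thesis using y n by (auto simp: num_simps suc_plus)
        qed
      qed
    qed
  qed simp
  then show ?thesis unfolding sat .
qed

section \<open>Injectivity of the pairing\<close>

definition pr :: "'u \<Rightarrow> 'u \<Rightarrow> 'u" where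
  "pr x y = plus (times (plus x y) (plus x y)) x"

lemma pr_N: "x \<in> N \<Longrightarrow> y \<in> N \<Longrightarrow> pr x y \<in> N"
  by (simp add: pr_def plus_N times_N)

lemma sev_spair [simp]: "sev e (spair t u) = pr (sev e t) (sev e u)"
  by (simp add: spair_def pr_def)

text \<open>If \<open>a = x + y\<close> and \<open>b = a + (c + 1)\<close>, then \<open>b\<^sup>2 > a\<^sup>2 + a\<close>.\<close>

lemma pr_ne:
  assumes N: "x \<in> N" "y \<in> N" "x' \<in> N" "y' \<in> N" "c \<in> N"
    and b: "plus x' y' = plus (plus x y) (suc c)"
  shows "pr x' y' \<noteq> pr x y"
proof
  assume eq: "pr x' y' = pr x y"
  define a b where "a = plus x y" and "b = plus x' y'"
  have aN: "a \<in> N" "b \<in> N" using N by (simp_all add: a_def b_def plus_N)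
  have b': "b = plus a (suc c)" using b by (simp add: a_def b_def)
  \<comment> \<open>From b = a + (c + 1) follows b b = b a + b c + b and b a = a a + (c + 1) a, so v
    is what b b has beyond a a + b.\<close>
  define v where "v = plus (times (suc c) a) (times b c)"
  have vN: "v \<in> N" using aN N by (simp add: v_def plus_N times_N suc_N)
  have "times b b = plus (times b a) (plus (times b c) b)"
    by (subst (2) b') (use aN N in \<open>simp add: times_plus times_suc suc_N\<close>)
  also have "times b a = plus (times a a) (times (suc c) a)"
    unfolding b' using aN N by (simp add: plus_times suc_N)
  finally have bb: "times b b = plus (times a a) (plus v b)"
    using aN N vN by (simp add: v_def plus_assoc plus_N times_N suc_N)
  have "plus (times a a) (plus (plus v b) x') = plus (times a a) x"
    using eq bb aN N vN by (simp add: pr_def a_def[symmetric] b_def[symmetric] plus_assoc plus_N times_N)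
  then have *: "plus (plus v b) x' = x"
    using aN N vN plus_cancel[of "plus (plus v b) x'" x "times a a"]
    by (simp add: plus_commute[of "times a a"] plus_N times_N)
  \<comment> \<open>Splitting b as x + y + c + 1 leaves v + b + x' = (w + 1) + x. With v + b + x' =
    x, cancelling x makes a successor zero.\<close>
  define w where "w = plus (plus v (plus y c)) x'"
  have wN: "w \<in> N" using vN N by (simp add: w_def plus_N)
  have "plus (plus v b) x' = plus (suc w) x"
    unfolding b' a_def w_def using vN N
    by (simp add: plus_suc suc_plus plus_N plus_assoc plus_left_commute plus_commute suc_N)
  then have "plus (suc w) x = plus zero x" using * zero_plus N by simp
  then have "suc w = zero" using plus_cancel[of "suc w" zero x] wN N by (simp add: suc_N)
  then show False using suc_ne_zero[OF wN] by simp
qed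

text \<open>If the sums differed, one would exceed the other by a successor, against
  \<open>pr_ne\<close>. As they agree, the common square can be cancelled.\<close>

lemma pr_inject:
  assumes N: "x \<in> N" "y \<in> N" "x' \<in> N" "y' \<in> N" and eq: "pr x y = pr x' y'"
  shows "x = x' \<and> y = y'"
proof -
  have "\<exists>z\<in>N. plus x y = plus (plus x' y') z \<or> plus x' y' = plus (plus x y) z"
    using N by (intro linear) (auto simp: plus_N)
  then obtain z where z: "z \<in> N" "plus x y = plus (plus x' y') z \<or> plus x' y' = plus (plus x y) z"
    by blast
  have "z = zero"
    using zero_or_suc[OF z(1)] z pr_ne N eq by metis
  then have s: "plus x y = plus x' y'" using z N by (auto simp: plus_zero plus_N)
  have "x = x'"
    using eq N plus_cancel[of x x' "times (plus x y) (plus x y)"]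
    by (simp add: pr_def s plus_commute[of "times (plus x' y') (plus x' y')"] plus_N times_N)
  moreover from this have "y = y'"
    using s N plus_cancel[of y y' x'] by (simp add: plus_commute[of x'])
  ultimately show ?thesis by blast
qed

end

subsection \<open>Soundness\<close>

context bt_model
begin

text \<open>A collects the k-fold singletons of the numbers with \<phi>, so it lies in
  \<open>sdom\<close> by its definition; injectivity of \<open>isg\<close> ensures that the
  singleton of n enters only through n itself.\<close>

lemma SA_comprehension:
  assumes "simple (Suc k) \<phi>" "Suc k \<le> s" "asgn M e"
  obtains A where "A \<in> sdom (Ty (Suc k))"
    "\<And>n. n \<in> N \<Longrightarrow> mbr M k (isg k n) A \<longleftrightarrow> ssat (push Omega n e) \<phi>"
proof -
  let ?\<theta> = "Ex Omega (sim (iter_singleton k (At (vN 0))) (At (vT k 0)) \<^bold>\<and> lift (Ty k) (star \<phi>))"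
  have \<phi>: "swff (Suc k) \<phi>" "no_set_quant \<phi>" using assms(1) by (auto simp: simple_def)
  then have "elementary (Suc k) ?\<theta>"
    by (simp add: elementary_def wff_star no_top_type_star)
  then obtain A where A: "A \<in> carr M (Ty (Suc k))"
    "\<And>Z. Z \<in> carr M (Ty k) \<Longrightarrow> mbr M k Z A \<longleftrightarrow> sat M (push (Ty k) Z e) ?\<theta>"
    using comprehension_fv assms(2,3) by metis
  have iter: "ev M e (iter_singleton k (At (vN 0))) = Some (isg k (e Omega 0))" if "asgn M e" for e
    using that assms(2) by (intro ev_iter_singleton) auto
  have \<phi>': "swff s \<phi>" using \<phi>(1) assms(2) by (rule swff_mono)
  have *: "mbr M k Z A \<longleftrightarrow> (\<exists>n\<in>N. isg k n = Z \<and> ssat (push Omega n e) \<phi>)"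
    if "Z \<in> carr M (Ty k)" for Z
    using that assms(3)
    by (auto simp: A(2) iter push_commute[of Omega "Ty k"] sat_star[OF \<phi>'] cong: bex_cong)
  show thesis
  proof (rule that)
    show "A \<in> sdom (Ty (Suc k))" using A(1) * by (auto simp: sdom_def)
    show "mbr M k (isg k n) A \<longleftrightarrow> ssat (push Omega n e) \<phi>" if "n \<in> N" for n
      using * isg_carr[of n k] isg_inject[of _ n k] that assms(2) by auto
  qed
qed

text \<open>A collects the singletons of all pairs of n and m such that m belongs to some X with
  \<phi>. The quantifier over X has type k, which is below the type of A, so the defining formula is
  elementary. Reading off the membership of one pair needs the injectivity of \<open>pr\<close> and
  \<open>isg\<close>.\<close>

lemma SA_choice:
  assumes "simple k \<phi>" "1 \<le> k" "Suc k \<le> s" "asgn M e"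
  obtains A where "A \<in> sdom (Ty (Suc k))"
    "\<And>n m. n \<in> N \<Longrightarrow> m \<in> N \<Longrightarrow> mbr M k (isg k (pr n m)) A \<longleftrightarrow>
      (\<exists>X\<in>sdom (Ty k). ssat (push (Ty k) X (push Omega n e)) \<phi> \<and> mbr M (k - 1) (isg (k - 1) m) X)"
proof -
  \<comment> \<open>Inside ?\<theta> the formula \<phi> stands below two variables that it does not
    know: the lift skips the number m, and the shift under the binder of type k skips Z while
    keeping X at index 0.\<close>
  let ?\<phi> = "fsub (under (Ty k) (shift (Ty k))) (lift Omega (star \<phi>))"
  let ?\<theta> = "Ex Omega (Ex Omega (
      sim (iter_singleton k (arith_tm (spair (SVar (Suc 0)) (SVar 0)))) (At (vT k 0)) \<^bold>\<and>
      Ex (Ty k) (MM k 0 \<^bold>\<and> ?\<phi> \<^bold>\<and> star (SIn k (SVar 0) 0))))"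
  have \<phi>: "swff (Suc k) \<phi>" "no_set_quant \<phi>" "swff s \<phi>"
    using assms(1,3) swff_mono[of k \<phi>] by (auto simp: simple_def)
  have "swff (Suc k) (SIn k (SVar 0) 0)" "no_set_quant (SIn k (SVar 0) 0)" using assms(2) by auto
  then have "elementary (Suc k) ?\<theta>"
    using \<phi> assms(2) by (simp add: elementary_def wff_star no_top_type_star del: star.simps)
  then obtain A where A: "A \<in> carr M (Ty (Suc k))"
    "\<And>Z. Z \<in> carr M (Ty k) \<Longrightarrow> mbr M k Z A \<longleftrightarrow> sat M (push (Ty k) Z e) ?\<theta>"
    using comprehension_fv assms(3,4) by metis
  have iter: "ev M e (iter_singleton k (arith_tm t)) = Some (isg k (sev e t))" if "asgn M e" for e t
    using that assms(3) by (intro ev_iter_singleton) auto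
  have \<theta>: "sat M (push (Ty k) Z e) ?\<theta> \<longleftrightarrow> (\<exists>n\<in>N. \<exists>m\<in>N. isg k (pr n m) = Z \<and>
      (\<exists>X\<in>sdom (Ty k). ssat (push (Ty k) X (push Omega n e)) \<phi> \<and> mbr M (k - 1) (isg (k - 1) m) X))"
    if Z: "Z \<in> carr M (Ty k)" for Z
  proof -
    have body: "sat M (push (Ty k) X (push Omega m (push Omega n (push (Ty k) Z e))))
        (MM k 0 \<^bold>\<and> ?\<phi> \<^bold>\<and> star (SIn k (SVar 0) 0)) \<longleftrightarrow>
        X \<in> sdom (Ty k) \<and> ssat (push (Ty k) X (push Omega n e)) \<phi> \<and> mbr M (k - 1) (isg (k - 1) m) X"
      if "X \<in> carr M (Ty k)" "n \<in> N" "m \<in> N" for X n m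
    proof -
      let ?e = "push Omega m (push Omega n (push (Ty k) Z e))"
      have e: "asgn M ?e" "asgn M (push (Ty k) X ?e)" "asgn M (push (Ty k) X (push Omega n e))"
        using that Z assms(4) by auto
      have "sat M (push (Ty k) X ?e) ?\<phi> \<longleftrightarrow>
          sat M (push (Ty k) X (push Omega m (push Omega n e))) (lift Omega (star \<phi>))"
        by (simp only: sat_fsub den_under push_commute[of Omega "Ty k"] den_shift ty.distinct
            not_False_eq_True)
      also have "\<dots> \<longleftrightarrow> sat M (push (Ty k) X (push Omega n e)) (star \<phi>)"
        by (simp add: push_commute[of "Ty k" Omega X m])
      finally have "sat M (push (Ty k) X ?e) ?\<phi> \<longleftrightarrow> sat M (push (Ty k) X (push Omega n e)) (star \<phi>)" .
      moreover have "sat M (push (Ty k) X ?e) (star (SIn k (SVar 0) 0)) \<longleftrightarrow>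
          mbr M (k - 1) (isg (k - 1) m) X"
        using sat_star[of "SIn k (SVar 0) 0" "push (Ty k) X ?e"] assms(2,3) e by (simp del: star.simps)
      moreover have "sat M (push (Ty k) X ?e) (MM k 0) \<longleftrightarrow> X \<in> sdom (Ty k)"
        using sat_MM[OF e(1) that(1)] assms(2,3) by simp
      ultimately show ?thesis using sat_star[OF \<phi>(3) e(3)] by (simp only: sat.simps)
    qed
    have "sat M (push Omega m (push Omega n (push (Ty k) Z e)))
        (sim (iter_singleton k (arith_tm (spair (SVar (Suc 0)) (SVar 0)))) (At (vT k 0))) \<longleftrightarrow>
        isg k (pr n m) = Z" if "n \<in> N" "m \<in> N" for n m
      using that Z assms(4) by (auto simp: iter)
    with body show ?thesis
      using sdom_carr by (simp add: sat.simps(3,7) cong: bex_cong conj_cong del: sat_sim sat_fsub) blast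
  qed
  show thesis
  proof (rule that)
    show "A \<in> sdom (Ty (Suc k))" using A \<theta> pr_N by (auto simp: sdom_def)
    show "mbr M k (isg k (pr n m)) A \<longleftrightarrow> (\<exists>X\<in>sdom (Ty k).
        ssat (push (Ty k) X (push Omega n e)) \<phi> \<and> mbr M (k - 1) (isg (k - 1) m) X)"
      if nm: "n \<in> N" "m \<in> N" for n m
    proof -
      have "isg k (pr n m) \<in> carr M (Ty k)" using pr_N nm assms(3) isg_carr by simp
      moreover have "isg k (pr n' m') = isg k (pr n m) \<longleftrightarrow> n' = n \<and> m' = m" if "n' \<in> N" "m' \<in> N" for n' m'
        using isg_inject[of "pr n' m'" "pr n m" k] pr_inject[of n' m' n m] pr_N nm that assms(3) by auto
      ultimately show ?thesis using A(2) \<theta> nm by (auto cong: bex_cong)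
    qed
  qed
qed

section \<open>Soundness of SA in the induced structure\<close>

definition sasgn :: "(ty \<Rightarrow> nat \<Rightarrow> 'u) \<Rightarrow> bool" where
  "sasgn e \<longleftrightarrow> (\<forall>T i. e T i \<in> sdom T)"

lemma sasgn_asgn [simp]: "sasgn e \<Longrightarrow> asgn M e"
  using sdom_carr by (auto simp: sasgn_def asgn_def)

lemma sasgn_push [simp]: "sasgn e \<Longrightarrow> a \<in> sdom T \<Longrightarrow> sasgn (push T a e)"
  by (auto simp: sasgn_def push_def split: nat.split)

text \<open>For a sort of the fragment, comprehension for \<open>Bot\<close> gives an empty set,
  which meets the condition on elements trivially.\<close>

lemma sdom_ne: "sdom T \<noteq> {}"
proof (cases "\<exists>k. T = Ty (Suc k) \<and> Suc k \<le> s")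
  case True
  then obtain k where "T = Ty (Suc k)" "Suc k \<le> s" by blast
  then obtain A where "A \<in> sdom T"
    using SA_comprehension[of k Bot env0] asgn_env0 by (force simp: simple_def)
  then show ?thesis by blast
next
  case False
  then have "\<not> (T = Ty k \<and> 1 \<le> k \<and> k \<le> s)" for k by (cases k) auto
  then have "sdom T = carr M T" unfolding sdom_def by blast
  then show ?thesis using carr_ne by simp
qed

lemma ipl_sound: "ipl_axiom \<phi> \<Longrightarrow> ssat e \<phi>"
  by (induction rule: ipl_axiom.induct) auto

lemma ssat_ex_unique:
  "ssat e (ex_unique k \<phi>) \<longleftrightarrow> (\<exists>X\<in>sdom (Ty k). ssat (push (Ty k) X e) \<phi>) \<and>
    (\<forall>X\<in>sdom (Ty k). \<forall>Y\<in>sdom (Ty k). ssat (push (Ty k) X e) \<phi> \<longrightarrow> ssat (push (Ty k) Y e) \<phi> \<longrightarrow>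
      (\<forall>n\<in>N. mbr M (k - 1) (isg (k - 1) n) X \<longleftrightarrow> mbr M (k - 1) (isg (k - 1) n) Y))"
proof -
  have "ren SVar ((\<lambda>k i. i)(k := Suc)) (push (Ty k) Y (push (Ty k) X e)) = push (Ty k) X e"
    "ren SVar ((\<lambda>k i. i)(k := \<lambda>i. case i of 0 \<Rightarrow> 0 | Suc j \<Rightarrow> Suc (Suc j)))
      (push (Ty k) Y (push (Ty k) X e)) = push (Ty k) Y e" for X Y
    by (intro ext; auto simp: ren_def push_def split: ty.split nat.split)+
  then show ?thesis unfolding ex_unique_def by (simp add: imp_conjL)
qed

lemma SA_axiom_sound: "SA_axiom \<phi> \<Longrightarrow> swff s \<phi> \<Longrightarrow> sasgn e \<Longrightarrow> ssat e \<phi>"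
proof (induction rule: SA_axiom.induct)
  case (succ_not_0 n)
  have "e Omega n \<in> N" by (rule asgn_carr[OF sasgn_asgn[OF succ_not_0.prems(2)]])
  then show ?case by (simp add: num_simps suc_ne_zero)
next
  case (induction \<phi>)
  have "ren (\<lambda>i. case i of 0 \<Rightarrow> SSuc (SVar 0) | Suc j \<Rightarrow> SVar (Suc j)) (\<lambda>k i. i) (push Omega n e) =
      push Omega (suc n) e" if "n \<in> N" for n
    using that by (intro ext) (auto simp: ren_def push_def num_simps split: ty.split nat.split)
  note step = this
  have w: "swff s \<phi>" using induction.prems by simp
  have e: "asgn M e" using induction.prems by simp
  show ?case
    unfolding ssat.simps(3,5,6)
  proof (intro impI ballI, elim conjE)
    fix n assume "n \<in> sdom Omega" and base: "ssat e (nsub (ninst S0) \<phi>)"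
      and hyp: "\<forall>n\<in>sdom Omega. ssat (push Omega n e) \<phi> \<longrightarrow> ssat (push Omega n e)
        (nsub (\<lambda>i. case i of 0 \<Rightarrow> SSuc (SVar 0) | Suc j \<Rightarrow> SVar (Suc j)) \<phi>)"
    have 1: "ssat (push Omega zero e) \<phi>" using base by simp
    have 2: "ssat (push Omega (suc m) e) \<phi>" if "m \<in> N" "ssat (push Omega m e) \<phi>" for m
      using hyp that unfolding sdom_Omega ssat_ssub by (metis step)
    have "n \<in> N" using \<open>n \<in> sdom Omega\<close> by simp
    from ssat_induct[OF w e 1 2 this] show "ssat (push Omega n e) \<phi>" .
  qed
next
  case (comprehension k \<phi>)
  then obtain j where k: "k = Suc j" "Suc j \<le> s" by (cases k) auto
  obtain A where A: "A \<in> sdom (Ty k)"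
    "\<And>n. n \<in> N \<Longrightarrow> mbr M j (isg j n) A \<longleftrightarrow> ssat (push Omega n e) \<phi>"
    using SA_comprehension[OF comprehension.hyps[unfolded k(1)] k(2) sasgn_asgn[OF comprehension.prems(2)]]
    unfolding k(1) by blast
  have "ssat (push Omega n (push (Ty k) A e)) (SIn k (SVar 0) 0 \<^bold>\<longleftrightarrow> slift (Ty k) \<phi>)" if "n \<in> N" for n
    by (simp only: push_commute[of Omega "Ty k"] ty.distinct not_False_eq_True ssat_Iff ssat_slift)
      (simp add: k A(2) that)
  then show ?case
    unfolding ssat.simps(6,7) sdom_Omega by (intro bexI[OF _ A(1)] ballI)
next
  case (choice k \<phi>)
  have k: "1 \<le> k" "Suc k \<le> s" using choice.prems by auto
  obtain A where A: "A \<in> sdom (Ty (Suc k))"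
    "\<And>n m. n \<in> N \<Longrightarrow> m \<in> N \<Longrightarrow> mbr M k (isg k (pr n m)) A \<longleftrightarrow>
      (\<exists>X\<in>sdom (Ty k). ssat (push (Ty k) X (push Omega n e)) \<phi> \<and> mbr M (k - 1) (isg (k - 1) m) X)"
    using SA_choice[OF choice.hyps k sasgn_asgn[OF choice.prems(2)]] by blast
  \<comment> \<open>The axiom puts \<phi> below the quantifier of sort k + 1 without a shift; this
    is harmless because \<phi> contains no variable of that sort.\<close>
  have fresh: "ssat (push (Ty k) X (push Omega n (push (Ty (Suc k)) A e))) \<phi> \<longleftrightarrow>
      ssat (push (Ty k) X (push Omega n e)) \<phi>" for X n
  proof (rule ssat_cong)
    fix T i assume "(T, i) \<in> set (free_list \<phi>)"
    then have "sort_ok k T" using choice.hyps sort_ok_free_list by (auto simp: simple_def)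
    then have "T \<noteq> Ty (Suc k)" by auto
    then show "push (Ty k) X (push Omega n (push (Ty (Suc k)) A e)) T i =
        push (Ty k) X (push Omega n e) T i" by (auto simp: push_def split: nat.split)
  qed
  show ?case
    unfolding ssat.simps(5)
  proof
    assume "ssat e (All Omega (ex_unique k \<phi>))"
    then have u: "\<And>n. n \<in> N \<Longrightarrow> ssat (push Omega n e) (ex_unique k \<phi>)" by simp
    show "ssat e (Ex (Ty (Suc k)) (All Omega (Ex (Ty k) (\<phi> \<^bold>\<and>
        All Omega (SIn k (SVar 0) 0 \<^bold>\<longleftrightarrow> SIn (Suc k) (spair (SVar 1) (SVar 0)) 0)))))"
      unfolding ssat.simps(6,7)
    proof (intro bexI[OF _ A(1)] ballI)
      fix n assume "n \<in> sdom Omega"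
      then have n: "n \<in> N" by simp
      obtain X where X: "X \<in> sdom (Ty k)" "ssat (push (Ty k) X (push Omega n e)) \<phi>"
        using u[OF n] unfolding ssat_ex_unique by blast
      \<comment> \<open>By uniqueness every set with \<phi> at n contains the same numbers as X, so
        the existential condition for A reduces to membership in X.\<close>
      have "mbr M k (isg k (pr n m)) A \<longleftrightarrow> mbr M (k - 1) (isg (k - 1) m) X" if "m \<in> N" for m
        using u[OF n] X that unfolding A(2)[OF n that] ssat_ex_unique by blast
      then show "\<exists>X\<in>sdom (Ty k). ssat (push (Ty k) X (push Omega n (push (Ty (Suc k)) A e))) (\<phi> \<^bold>\<and>
          All Omega (SIn k (SVar 0) 0 \<^bold>\<longleftrightarrow> SIn (Suc k) (spair (SVar 1) (SVar 0)) 0))"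
        using X by (intro bexI[of _ X]) (simp_all add: fresh)
    qed
  qed
qed (auto simp: num_simps suc_inject)

text \<open>Set variables must take values in \<open>sdom\<close>, since instantiating a quantifier
  with a set variable uses its value as an element of the range of the quantifier.\<close>

lemma SA_sound: "SA s \<phi> \<Longrightarrow> sasgn e \<Longrightarrow> ssat e \<phi>"
proof (induction arbitrary: e rule: SA.induct)
  case (propositional \<phi>)
  then show ?case by (simp add: ipl_sound)
next
  case (axiom \<phi>)
  then show ?case by (simp add: SA_axiom_sound)
next
  case (all_intro T \<phi> \<psi>)
  have "ssat (push T a e) (slift T \<phi> \<^bold>\<longrightarrow> \<psi>)" if "a \<in> sdom T" for a
    using all_intro.IH[of "push T a e"] all_intro.prems that by simp
  then show ?case by (simp del: slift.simps)
next
  case (ex_elim \<psi> T \<phi>)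
  have "ssat (push T a e) (\<psi> \<^bold>\<longrightarrow> slift T \<phi>)" if "a \<in> sdom T" for a
    using ex_elim.IH[of "push T a e"] ex_elim.prems that by simp
  then show ?case by (auto simp del: slift.simps)
next
  case (all_set_elim k \<phi> y)
  then show ?case by (auto simp: sasgn_def)
next
  case (ex_set_intro k \<phi> y)
  then show ?case by (auto simp: sasgn_def)
next
  case (mp \<phi> \<psi>)
  from mp.IH(1)[OF mp.prems] mp.IH(2)[OF mp.prems] show ?case by simp
qed (auto simp: sev_N[OF sasgn_asgn])

lemma ssat_all_var: "ssat e (all_var (T, i) \<phi>) \<longleftrightarrow> (\<forall>a\<in>sdom T. ssat (e(T := (e T)(i := a))) \<phi>)"
proof -
  have "ren (\<lambda>j. SVar (if j = i then 0 else Suc j)) (\<lambda>k i. i) (push Omega a e) = e(Omega := (e Omega)(i := a))"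
    "ren SVar ((\<lambda>k i. i)(k := \<lambda>j. if j = i then 0 else Suc j)) (push (Ty k) a e) =
      e(Ty k := (e (Ty k))(i := a))" for a k
    by (intro ext; auto simp: ren_def push_def split: ty.split)+
  then show ?thesis by (cases T) auto
qed

text \<open>The second hypothesis excludes the variables still to be quantified, so it survives each
  update of e in the induction and is vacuous when all free variables are quantified.\<close>

lemma ssat_foldr_all_var:
  assumes "\<And>e. (\<And>T i. (T, i) \<in> set ys \<Longrightarrow> e T i \<in> sdom T) \<Longrightarrow> ssat e \<psi>"
    and "\<And>T i. (T, i) \<in> set ys - set xs \<Longrightarrow> e T i \<in> sdom T"
  shows "ssat e (foldr all_var xs \<psi>)"
  using assms(2)
proof (induction xs arbitrary: e)
  case Nil
  then show ?case by (auto intro: assms(1))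
next
  case (Cons x xs)
  obtain T i where x: "x = (T, i)" by fastforce
  have "ssat (e(T := (e T)(i := a))) (foldr all_var xs \<psi>)" if "a \<in> sdom T" for a
    using Cons.prems that by (intro Cons.IH) (auto simp: x)
  then show ?case by (simp add: x ssat_all_var)
qed

text \<open>Here e is unrestricted: once the closure has bound every free variable, values outside
  \<open>sdom\<close> have no influence.\<close>

lemma universal_closure_sound:
  assumes "SA s \<psi>"
  shows "ssat e (universal_closure \<psi>)"
  unfolding universal_closure_def
proof (rule ssat_foldr_all_var[where ys = "free_list \<psi>"])
  fix e assume e: "\<And>T i. (T, i) \<in> set (free_list \<psi>) \<Longrightarrow> e T i \<in> sdom T"
  \<comment> \<open>Replaces the values outside \<open>sdom\<close>, which e takes only at variables
    not free in \<psi>.\<close>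
  define e' where "e' T i = (if e T i \<in> sdom T then e T i else (SOME a. a \<in> sdom T))" for T i
  have "sasgn e'" using sdom_ne some_in_eq by (auto simp: sasgn_def e'_def)
  then have "ssat e' \<psi>" by (rule SA_sound[OF assms])
  then show "ssat e \<psi>" using e by (subst ssat_cong[of _ _ e']) (auto simp: e'_def)
qed simp

end

section \<open>Well-formedness of the closure and the final result\<close>

lemma swff_ssub [simp]: "swff n (ssub \<sigma> \<rho> \<phi>) \<longleftrightarrow> swff n \<phi>"
proof (induction \<phi> arbitrary: \<sigma> \<rho>)
  case (Atom a)
  then show ?case by (cases a) auto
qed auto

lemma swff_universal_closure: assumes "swff n \<psi>" shows "swff n (universal_closure \<psi>)"
proof -
  have "set xs \<subseteq> set (free_list \<psi>) \<Longrightarrow> swff n (foldr all_var xs \<psi>)" for xs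
  proof (induction xs)
    case (Cons x xs)
    obtain T i where x: "x = (T, i)" by fastforce
    then have "sort_ok n T" using Cons.prems sort_ok_free_list[OF assms] by auto
    then show ?case using Cons x by (cases T) auto
  qed (use assms in simp)
  then show ?thesis by (simp add: universal_closure_def)
qed

text \<open>Without set variables the clauses of the two functions coincide, so the first claim
  becomes the equivalence of a formula with itself.\<close>

lemma star_arithmetical: "arithmetical \<psi> \<Longrightarrow> star \<psi> = arith_fm \<psi>"
  unfolding arithmetical_def by (induction \<psi> rule: star.induct) auto

theorem theorem8:
  shows "(\<forall>\<psi>. arithmetical \<psi> \<longrightarrow> BT True 0 (star \<psi> \<^bold>\<longleftrightarrow> arith_fm \<psi>)) \<and>
    (\<forall>s \<psi>. swff s \<psi> \<longrightarrow> SA s \<psi> \<longrightarrow> BT True s (star (universal_closure \<psi>)))"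
proof (intro conjI allI impI)
  fix \<psi> assume \<psi>: "arithmetical \<psi>"
  then have "wff 0 (star \<psi>)" by (simp add: arithmetical_def wff_star)
  then show "BT True 0 (star \<psi> \<^bold>\<longleftrightarrow> arith_fm \<psi>)"
    unfolding star_arithmetical[OF \<psi>, symmetric] by (intro completeness) auto
next
  fix s \<psi> assume \<psi>: "swff s \<psi>" "SA s \<psi>"
  have w: "swff s (universal_closure \<psi>)" using \<psi>(1) by (rule swff_universal_closure)
  show "BT True s (star (universal_closure \<psi>))"
  proof (rule completeness[OF wff_star[OF w]])
    fix M :: "tm set struct" and e
    assume M: "bt_model s M" "asgn M e"
    interpret bt_model s M by (rule M)
    show "sat M e (star (universal_closure \<psi>))"
      using sat_star[OF w M(2)] universal_closure_sound[OF \<psi>(2)] by simp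
  qed
qed

end
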